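(* Let $(\Delta,\mathbf L)$ be a compact convex simple labelled polytope in $\mathbb R^m$ and $f$ an affine function positive on $\Delta$. If the weighted Abreu equation $$-f^{2m+1}\sum_{i,j=1}^m\big(f^{1-2m}\mathbf H^v_{ij}\big)_{,ij}=s_{(\Delta,\mathbf L,f)}$$ has a solution $v\in\mathcal S$, then $(\Delta,\mathbf L,f)$ is uniformly K-stable, i.e. there exists $\lambda>0$ such that $\mathcal F_{(\Delta,f)}(u)\ge\lambda\|u\|_b$ for all $u\in\widetilde{\mathcal C}$.
   Context: $\mathfrak t^*\cong\mathbb R^m$ ($m\ge2$) has coordinates $x=(x_1,\dots,x_m)$ and Lebesgue measure $d\mu$; subscripts $_{,i}$ denote $\partial/\partial x_i$. $\Delta=\{x:L_j(x)\ge0,\ j=1,\dots,d\}$ with affine $\mathbf L=(L_1,\dots,L_d)$, facets $F_j=\Delta\cap\{L_j=0\}$, inward normals $u_j=dL_j$, interior $\Delta^0$; on $F_j$ the measure $d\sigma$ is defined by $dL_j\wedge d\sigma=-d\mu$. $\mathcal S$ is the set of smooth strictly convex functions $u$ on $\Delta^0$ such that $\mathbf H^u=(\mathrm{Hess}\,u)^{-1}$ (i) extends smoothly to $\Delta$; (ii) at each point $\xi$ of a facet $F_j$, $\mathbf H^u_\xi(u_j,\cdot)=0$ and $(d\mathbf H^u)_\xi(u_j,u_j)=2u_j$; (iii) for $\xi$ in the interior of any face $F$, $\mathbf H^u_\xi$ is positive definite on $(\mathfrak t/\mathfrak t_F)^*$, $\mathfrak t_F$ being spanned by the normals of facets containing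 $F$. $s_{(\Delta,\mathbf L,f)}$ is the unique affine function with $2\int_{\partial\Delta}\varphi f^{1-2m}d\sigma=\int_\Delta s_{(\Delta,\mathbf L,f)}\varphi f^{-2m-1}d\mu$ for all affine $\varphi$. $\mathcal F_{(\Delta,f)}(u)=2\int_{\partial\Delta}u f^{1-2m}d\sigma-\int_\Delta s_{(\Delta,\mathbf L,f)}u f^{-2m-1}d\mu$. $\mathcal C_\infty$: continuous convex functions on $\Delta$ smooth in $\Delta^0$; for a fixed $x_0\in\Delta^0$, $\widetilde{\mathcal C}=\{u\in\mathcal C_\infty:u\ge u(x_0)=0\}$; $\|u\|_b=\int_{\partial\Delta}u f^{1-2m}d\sigma$. *)

theory Defs
  imports "HOL-Analysis.Analysis"
begin

definition partial :: "'n::finite \<Rightarrow> (real^'n \<Rightarrow> real) \<Rightarrow> real^'n \<Rightarrow> real" where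
  "partial i g x = deriv (\<lambda>t. g (x + t *\<^sub>R axis i 1)) 0"

fun iter_partial :: "'n::finite list \<Rightarrow> (real^'n \<Rightarrow> real) \<Rightarrow> real^'n \<Rightarrow> real" where
  "iter_partial [] g = g"
| "iter_partial (i # is) g = partial i (iter_partial is g)"

definition smooth_on :: "(real^'n::finite) set \<Rightarrow> (real^'n \<Rightarrow> real) \<Rightarrow> bool" where
  "smooth_on U g \<longleftrightarrow> open U \<and>
     (\<forall>is. continuous_on U (iter_partial is g) \<and>
        (\<forall>i. \<forall>x\<in>U. (\<lambda>t. iter_partial is g (x + t *\<^sub>R axis i 1)) differentiable (at 0)))"

definition hessian :: "(real^'n::finite \<Rightarrow> real) \<Rightarrow> real^'n \<Rightarrow> real^'n^'n" where
  "hessian u x = (\<chi> i j. partial i (partial j u) x)"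

definition strictly_convex_on :: "(real^'n::finite) set \<Rightarrow> (real^'n \<Rightarrow> real) \<Rightarrow> bool" where
  "strictly_convex_on S u \<longleftrightarrow>
     (\<forall>x\<in>S. \<forall>y\<in>S. x \<noteq> y \<longrightarrow> (\<forall>t::real. 0 < t \<and> t < 1 \<longrightarrow>
        u ((1 - t) *\<^sub>R x + t *\<^sub>R y) < (1 - t) * u x + t * u y))"

definition affine_fun :: "(real^'n::finite \<Rightarrow> real) \<Rightarrow> bool" where
  "affine_fun g \<longleftrightarrow> (\<exists>a b. g = (\<lambda>x. a \<bullet> x + b))"

definition Lfun :: "(nat \<Rightarrow> real^'n::finite) \<Rightarrow> (nat \<Rightarrow> real) \<Rightarrow> nat \<Rightarrow> real^'n \<Rightarrow> real" where
  "Lfun nrm c j x = nrm j \<bullet> x + c j"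

definition polytope_of :: "nat \<Rightarrow> (nat \<Rightarrow> real^'n::finite) \<Rightarrow> (nat \<Rightarrow> real) \<Rightarrow> (real^'n) set" where
  "polytope_of d nrm c = {x. \<forall>j<d. Lfun nrm c j x \<ge> 0}"

definition facet :: "nat \<Rightarrow> (nat \<Rightarrow> real^'n::finite) \<Rightarrow> (nat \<Rightarrow> real) \<Rightarrow> nat \<Rightarrow> (real^'n) set" where
  "facet d nrm c j = polytope_of d nrm c \<inter> {x. Lfun nrm c j x = 0}"

definition simple_labelled_polytope :: "nat \<Rightarrow> (nat \<Rightarrow> real^'n::finite) \<Rightarrow> (nat \<Rightarrow> real) \<Rightarrow> bool" where
  "simple_labelled_polytope d nrm c \<longleftrightarrow>
     bounded (polytope_of d nrm c) \<and> interior (polytope_of d nrm c) \<noteq> {} \<and>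
     (\<forall>j<d. aff_dim (facet d nrm c j) = int CARD('n) - 1) \<and>
     (\<forall>i<d. \<forall>j<d. i \<noteq> j \<longrightarrow> facet d nrm c i \<noteq> facet d nrm c j) \<and>
     (\<forall>x\<in>polytope_of d nrm c.
        inj_on nrm {j. j < d \<and> Lfun nrm c j x = 0} \<and>
        independent (nrm ` {j. j < d \<and> Lfun nrm c j x = 0}))"

text \<open>Integral over the facet \<open>F_j\<close> w.r.t. the measure \<open>d\<sigma>\<close> defined by \<open>dL_j \<and> d\<sigma> = -d\<mu>\<close>,
  realised as the disintegration of Lebesgue measure along \<open>L_j\<close>:
  \<open>\<integral>_{F_j} g d\<sigma> = lim_{\<epsilon>\<rightarrow>0+} \<epsilon>\<^sup>-\<^sup>1 \<integral>_{\<Delta> \<inter> {L_j \<le> \<epsilon>}} g d\<mu>\<close>.\<close>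
definition facet_integral ::
  "nat \<Rightarrow> (nat \<Rightarrow> real^'n::finite) \<Rightarrow> (nat \<Rightarrow> real) \<Rightarrow> nat \<Rightarrow> (real^'n \<Rightarrow> real) \<Rightarrow> real" where
  "facet_integral d nrm c j g =
     Lim (at_right 0) (\<lambda>\<epsilon>. (1 / \<epsilon>) *
        (LINT x : {x \<in> polytope_of d nrm c. Lfun nrm c j x \<le> \<epsilon>} | lborel. g x))"

definition boundary_integral ::
  "nat \<Rightarrow> (nat \<Rightarrow> real^'n::finite) \<Rightarrow> (nat \<Rightarrow> real) \<Rightarrow> (real^'n \<Rightarrow> real) \<Rightarrow> real" where
  "boundary_integral d nrm c g = (\<Sum>j<d. facet_integral d nrm c j g)"

definition s_fun ::
  "nat \<Rightarrow> (nat \<Rightarrow> real^'n::finite) \<Rightarrow> (nat \<Rightarrow> real) \<Rightarrow> (real^'n \<Rightarrow> real) \<Rightarrow> real^'n \<Rightarrow> real" where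
  "s_fun d nrm c f = (THE s. affine_fun s \<and>
     (\<forall>\<phi>. affine_fun \<phi> \<longrightarrow>
        2 * boundary_integral d nrm c (\<lambda>x. \<phi> x / f x ^ (2 * CARD('n) - 1)) =
        (LINT x : polytope_of d nrm c | lborel. s x * \<phi> x / f x ^ (2 * CARD('n) + 1))))"

definition Futaki ::
  "nat \<Rightarrow> (nat \<Rightarrow> real^'n::finite) \<Rightarrow> (nat \<Rightarrow> real) \<Rightarrow> (real^'n \<Rightarrow> real) \<Rightarrow> (real^'n \<Rightarrow> real) \<Rightarrow> real" where
  "Futaki d nrm c f u =
     2 * boundary_integral d nrm c (\<lambda>x. u x / f x ^ (2 * CARD('n) - 1))
     - (LINT x : polytope_of d nrm c | lborel.
          s_fun d nrm c f x * u x / f x ^ (2 * CARD('n) + 1))"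

definition bnorm ::
  "nat \<Rightarrow> (nat \<Rightarrow> real^'n::finite) \<Rightarrow> (nat \<Rightarrow> real) \<Rightarrow> (real^'n \<Rightarrow> real) \<Rightarrow> (real^'n \<Rightarrow> real) \<Rightarrow> real" where
  "bnorm d nrm c f u = boundary_integral d nrm c (\<lambda>x. u x / f x ^ (2 * CARD('n) - 1))"

text \<open>The class \<open>\<S>\<close> of symplectic potentials satisfying the Guillemin boundary conditions.
  \<open>G\<close> is the smooth extension of \<open>H^u = (Hess u)\<^sup>-\<^sup>1\<close> to (a neighbourhood of) \<open>\<Delta>\<close>.\<close>
definition class_S ::
  "nat \<Rightarrow> (nat \<Rightarrow> real^'n::finite) \<Rightarrow> (nat \<Rightarrow> real) \<Rightarrow> (real^'n \<Rightarrow> real) set" where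
  "class_S d nrm c = {u.
     let P = polytope_of d nrm c in
     smooth_on (interior P) u \<and> strictly_convex_on (interior P) u \<and>
     (\<forall>x\<in>interior P. invertible (hessian u x)) \<and>
     (\<exists>U G. open U \<and> P \<subseteq> U \<and> (\<forall>i j. smooth_on U (\<lambda>x. G x $ i $ j)) \<and>
        (\<forall>x\<in>interior P. G x = matrix_inv (hessian u x)) \<and>
        (\<forall>j<d. \<forall>\<xi>\<in>facet d nrm c j.
            G \<xi> *v nrm j = 0 \<and>
            ((\<lambda>x. nrm j \<bullet> (G x *v nrm j)) has_derivative (\<lambda>h. 2 * (nrm j \<bullet> h))) (at \<xi>)) \<and>
        (\<forall>\<xi>\<in>P. \<forall>v. v \<noteq> 0 \<longrightarrow> (\<forall>j<d. Lfun nrm c j \<xi> = 0 \<longrightarrow> nrm j \<bullet> v = 0)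
            \<longrightarrow> v \<bullet> (G \<xi> *v v) > 0))}"

definition C_infty :: "nat \<Rightarrow> (nat \<Rightarrow> real^'n::finite) \<Rightarrow> (nat \<Rightarrow> real) \<Rightarrow> (real^'n \<Rightarrow> real) set" where
  "C_infty d nrm c = {u. continuous_on (polytope_of d nrm c) u \<and> convex_on (polytope_of d nrm c) u
       \<and> smooth_on (interior (polytope_of d nrm c)) u}"

definition C_tilde ::
  "nat \<Rightarrow> (nat \<Rightarrow> real^'n::finite) \<Rightarrow> (nat \<Rightarrow> real) \<Rightarrow> real^'n \<Rightarrow> (real^'n \<Rightarrow> real) set" where
  "C_tilde d nrm c x0 = {u \<in> C_infty d nrm c. u x0 = 0 \<and> (\<forall>x\<in>polytope_of d nrm c. u x \<ge> u x0)}"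

end

theory Submission
  imports Defs
begin

text \<open>
  Put \<open>w = f\<^sup>1\<^sup>-\<^sup>2\<^sup>m\<close> and \<open>A = w * H\<^sup>v\<close>. For \<open>u\<close> smooth up to the boundary, integrating by parts
  twice with the boundary conditions on \<open>H\<^sup>v\<close> and the Abreu equation gives \<open>F(u) = \<integral> A : Hess u\<close>.
  This energy controls \<open>u\<close> on compact subsets of the interior: \<open>A\<close> is uniformly positive there, and a
  convex \<open>u \<ge> 0\<close> with \<open>u(x\<^sub>0) = 0\<close> is bounded by the integral of its Laplacian. On the other hand
  \<open>F(u) = 2 \<parallel>u\<parallel>\<^sub>b + \<integral> \<rho> u\<close> with \<open>\<rho>\<close> bounded, and convexity along the rays from \<open>x\<^sub>0\<close> bounds \<open>\<integral> u\<close> by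
  an interior term plus \<open>\<delta> * C * \<parallel>u\<parallel>\<^sub>b\<close>. Choosing \<open>\<delta>\<close> small yields \<open>\<parallel>u\<parallel>\<^sub>b \<le> C * F(u)\<close>. A general \<open>u\<close> is
  the uniform limit of its dilations \<open>x \<mapsto> u(x\<^sub>0 + t (x - x\<^sub>0))\<close>, \<open>t < 1\<close>, which are smooth up to the boundary.
\<close>

section \<open>Functions with continuous partial derivatives\<close>

text \<open>The facet measure is given only as a limit of slab averages, so the divergence theorem
  has to be proved for that limit itself. Truncating by functions piecewise linear in the
  \<open>L j\<close> makes exactly such averages appear, and stretching a slab to unit height turns
  its limit into an integral over a fixed cylinder, \<open>face_mean\<close>. In the double
  integration by parts, \<open>H(u_j, .) = 0\<close> removes the boundary term with the gradient of
  \<open>u\<close>, and the condition on the normal derivative turns the other one into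
  \<open>2 w u\<close>. The density \<rho> is the double divergence of \<open>A\<close>: inside it
  equals \<open>- s / f^(2m+1)\<close>, and it is bounded because \<open>H\<close> extends smoothly.
  The Hessian of \<open>u\<close> is controlled only through an integral over a compact core. This
  is why means over small cubes, and not values, are compared, and why the resulting constant does
  not depend on \<open>u\<close>. That constant may explode as \<delta> tends to 0; this is
  harmless, since the \<delta> that absorbs the boundary term is fixed beforehand from
  \<open>P\<close>, \<open>x0\<close>, \<open>w\<close> and \<rho>.\<close>

lemma has_partial:
  assumes "(\<lambda>t. g (x + t *\<^sub>R axis i 1)) differentiable (at 0)"
  shows "((\<lambda>t. g (x + t *\<^sub>R axis i 1)) has_real_derivative partial i g x) (at 0)"
  using assms unfolding partial_def by (simp add: DERIV_deriv_iff_real_differentiable)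

lemma partialI:
  assumes "((\<lambda>t. g (x + t *\<^sub>R axis i 1)) has_real_derivative D) (at 0)"
  shows "(\<lambda>t. g (x + t *\<^sub>R axis i 1)) differentiable (at 0)" "partial i g x = D"
  using assms unfolding partial_def by (auto simp: real_differentiable_def intro: DERIV_imp_deriv)

lemma eventually_line_in_open:
  fixes x v :: "'a::real_normed_vector"
  assumes "open U" "x + s *\<^sub>R v \<in> U"
  shows "\<forall>\<^sub>F t in nhds s. x + t *\<^sub>R v \<in> U"
proof -
  have "((\<lambda>t. x + t *\<^sub>R v) \<longlongrightarrow> x + s *\<^sub>R v) (nhds s)"
    by (intro tendsto_intros filterlim_ident)
  then show ?thesis using assms topological_tendstoD by blast
qed

text \<open>\<open>deriv\<close> sees only the germ of the function on the coordinate line. This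
  allows \<open>G\<close> and \<open>matrix_inv (hessian v y)\<close>, which are known to agree only
  in the interior, to be exchanged under derivatives.\<close>

lemma partial_cong:
  assumes "open U" "x \<in> U" "\<And>y. y \<in> U \<Longrightarrow> g y = h y"
  shows "partial i g x = partial i h x"
    "(\<lambda>t. g (x + t *\<^sub>R axis i 1)) differentiable (at 0) \<longleftrightarrow>
     (\<lambda>t. h (x + t *\<^sub>R axis i 1)) differentiable (at 0)"
proof -
  have ev: "\<forall>\<^sub>F t in nhds 0. g (x + t *\<^sub>R axis i 1) = h (x + t *\<^sub>R axis i 1)"
    using eventually_line_in_open[OF assms(1), of x 0 "axis i 1"] assms(2,3)
    by (auto elim: eventually_mono)
  show "partial i g x = partial i h x"
    unfolding partial_def by (rule deriv_cong_ev[OF ev refl])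
  show "(\<lambda>t. g (x + t *\<^sub>R axis i 1)) differentiable (at 0) \<longleftrightarrow>
     (\<lambda>t. h (x + t *\<^sub>R axis i 1)) differentiable (at 0)"
    unfolding real_differentiable_def using DERIV_cong_ev[OF refl ev refl] by simp
qed

text \<open>Finite order replaces \<open>smooth_on\<close> because closure under products and
  quotients becomes an induction on \<open>k\<close>, and order 2 covers both integrations by parts.
  The recursion peels off the derivative applied first to \<open>g\<close>, whereas
  \<open>iter_partial\<close> peels off the one applied last.\<close>

fun Ck_on :: "nat \<Rightarrow> (real^'n::finite) set \<Rightarrow> (real^'n \<Rightarrow> real) \<Rightarrow> bool" where
  "Ck_on 0 U g \<longleftrightarrow> continuous_on U g"
| "Ck_on (Suc k) U g \<longleftrightarrow> continuous_on U g \<and>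
     (\<forall>i. (\<forall>x\<in>U. (\<lambda>t. g (x + t *\<^sub>R axis i 1)) differentiable (at 0)) \<and> Ck_on k U (partial i g))"

lemma smooth_on_imp_Ck_on:
  assumes "smooth_on U g"
  shows "Ck_on k U g"
proof -
  \<comment> \<open>All lists at once: one step of \<open>Ck_on\<close> leads from
    \<open>iter_partial is g\<close> to \<open>iter_partial (i # is) g\<close>.\<close>
  have "Ck_on k U (iter_partial is g)" for "is"
  proof (induction k arbitrary: "is")
    case (Suc k)
    show ?case using assms Suc[of "_ # is"] by (auto simp: smooth_on_def)
  qed (use assms in \<open>auto simp: smooth_on_def\<close>)
  from this[of "[]"] show ?thesis by simp
qed

lemma Ck_on_continuous: "Ck_on k U g \<Longrightarrow> continuous_on U g"
  by (cases k) auto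

lemma Ck_on_Suc_lower: "Ck_on (Suc k) U g \<Longrightarrow> Ck_on k U g"
  by (induction k arbitrary: g) auto

lemma Ck_on_subset: "Ck_on k U g \<Longrightarrow> V \<subseteq> U \<Longrightarrow> Ck_on k V g"
  by (induction k arbitrary: g) (auto intro: continuous_on_subset)

lemma Ck_on_cong:
  assumes "open U" "\<And>y. y \<in> U \<Longrightarrow> g y = h y" "Ck_on k U g"
  shows "Ck_on k U h"
  using assms(2,3)
proof (induction k arbitrary: g h)
  case 0
  then show ?case unfolding Ck_on.simps by (metis continuous_on_eq)
next
  case (Suc k)
  have "Ck_on k U (partial i h)" for i
  proof (rule Suc.IH[of "partial i g"])
    show "partial i g y = partial i h y" if "y \<in> U" for y
      using partial_cong(1)[OF assms(1) that, of g h] Suc.prems(1) by blast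
    show "Ck_on k U (partial i g)" using Suc.prems(2) by simp
  qed
  moreover have "(\<lambda>t. h (x + t *\<^sub>R axis i 1)) differentiable at 0" if "x \<in> U" for i x
    using partial_cong(2)[OF assms(1) that, of g h] Suc.prems that by auto
  moreover have "continuous_on U h"
    using continuous_on_eq[OF Ck_on_continuous[OF Suc.prems(2)] Suc.prems(1)] .
  ultimately show ?case by simp
qed

lemma Ck_on_has_partial:
  assumes "Ck_on (Suc k) U g" "x \<in> U"
  shows "((\<lambda>t. g (x + t *\<^sub>R axis i 1)) has_real_derivative partial i g x) (at 0)"
  using assms by (auto intro: has_partial)

lemma Ck_on_has_partial_line:
  assumes "Ck_on (Suc k) U g" "x + s *\<^sub>R axis i 1 \<in> U"
  shows "((\<lambda>t. g (x + t *\<^sub>R axis i 1)) has_real_derivative partial i g (x + s *\<^sub>R axis i 1)) (at s)"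
proof -
  have "((\<lambda>t. g (x + (s + t) *\<^sub>R axis i 1)) has_real_derivative partial i g (x + s *\<^sub>R axis i 1)) (at 0)"
    using Ck_on_has_partial[OF assms, of i] by (simp add: scaleR_add_left add.assoc)
  then show ?thesis
    using DERIV_shift[of "\<lambda>t. g (x + t *\<^sub>R axis i 1)" _ 0 s] by (simp add: add.commute)
qed

text \<open>The common route to the closure properties: the class is checked on an explicit
  derivative \<open>D i\<close> and carried over to \<open>partial i g\<close>, which agrees with it
  on the open set.\<close>

lemma Ck_on_SucI:
  assumes "open U" "continuous_on U g"
    and "\<And>i x. x \<in> U \<Longrightarrow> ((\<lambda>t. g (x + t *\<^sub>R axis i 1)) has_real_derivative D i x) (at 0)"
    and "\<And>i. Ck_on k U (D i)"
  shows "Ck_on (Suc k) U g"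
proof -
  have "Ck_on k U (partial i g)" for i
    using Ck_on_cong[OF assms(1), of "D i" "partial i g"] partialI(2)[OF assms(3)] assms(4) by metis
  then show ?thesis using assms(2) partialI(1)[OF assms(3)] by simp
qed

lemma Ck_on_const: "open U \<Longrightarrow> Ck_on k U (\<lambda>x. a)"
proof (induction k arbitrary: a)
  case (Suc k)
  show ?case by (rule Ck_on_SucI[OF Suc.prems, of _ "\<lambda>i x. 0"]) (use Suc in simp_all)
qed auto

lemma Ck_on_affine: "open U \<Longrightarrow> Ck_on k U (\<lambda>x. a \<bullet> x + b)"
proof (induction k)
  case (Suc k)
  show ?case
  proof (rule Ck_on_SucI[OF Suc.prems, of _ "\<lambda>i x. a \<bullet> axis i 1"])
    show "((\<lambda>t. a \<bullet> (x + t *\<^sub>R axis i 1) + b) has_real_derivative a \<bullet> axis i 1) (at 0)" for i x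
      by (simp only: inner_add_right inner_scaleR_right) (auto intro!: derivative_eq_intros)
    show "continuous_on U (\<lambda>x. a \<bullet> x + b)" by (intro continuous_intros)
  qed (rule Ck_on_const[OF Suc.prems])
qed (auto intro!: continuous_intros)

lemma Ck_on_add:
  assumes "open U"
  shows "Ck_on k U g \<Longrightarrow> Ck_on k U h \<Longrightarrow> Ck_on k U (\<lambda>x. g x + h x)"
proof (induction k arbitrary: g h)
  case (Suc k)
  show ?case
  proof (rule Ck_on_SucI[OF assms, of _ "\<lambda>i x. partial i g x + partial i h x"])
    show "continuous_on U (\<lambda>x. g x + h x)"
      using Suc.prems[THEN Ck_on_continuous] by (rule continuous_on_add)
    show "((\<lambda>t. g (x + t *\<^sub>R axis i 1) + h (x + t *\<^sub>R axis i 1)) has_real_derivative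
        partial i g x + partial i h x) (at 0)" if "x \<in> U" for i x
      by (intro DERIV_add Ck_on_has_partial[OF Suc.prems(1) that] Ck_on_has_partial[OF Suc.prems(2) that])
    show "Ck_on k U (\<lambda>x. partial i g x + partial i h x)" for i
      using Suc by auto
  qed
next
  case 0
  then show ?case unfolding Ck_on.simps by (rule continuous_on_add)
qed

lemma Ck_on_mult:
  assumes "open U"
  shows "Ck_on k U g \<Longrightarrow> Ck_on k U h \<Longrightarrow> Ck_on k U (\<lambda>x. g x * h x)"
proof (induction k arbitrary: g h)
  case (Suc k)
  have lower: "Ck_on k U g" "Ck_on k U h" using Suc.prems Ck_on_Suc_lower by blast+
  show ?case
  proof (rule Ck_on_SucI[OF assms, of _ "\<lambda>i x. partial i g x * h x + partial i h x * g x"])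
    show "continuous_on U (\<lambda>x. g x * h x)"
      using Suc.prems[THEN Ck_on_continuous] by (rule continuous_on_mult)
    show "((\<lambda>t. g (x + t *\<^sub>R axis i 1) * h (x + t *\<^sub>R axis i 1)) has_real_derivative
        partial i g x * h x + partial i h x * g x) (at 0)" if "x \<in> U" for i x
      using DERIV_mult[OF Ck_on_has_partial[OF Suc.prems(1) that] Ck_on_has_partial[OF Suc.prems(2) that]]
      by simp
    show "Ck_on k U (\<lambda>x. partial i g x * h x + partial i h x * g x)" for i
    proof -
      have "Ck_on k U (partial i g)" "Ck_on k U (partial i h)" using Suc.prems by auto
      then show ?thesis using lower by (intro Ck_on_add[OF assms] Suc.IH)
    qed
  qed
next
  case 0
  then show ?case unfolding Ck_on.simps by (rule continuous_on_mult)
qed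

lemma Ck_on_sum:
  assumes "open U" "\<And>i. i \<in> A \<Longrightarrow> Ck_on k U (g i)"
  shows "Ck_on k U (\<lambda>x. \<Sum>i\<in>A. g i x)"
  using assms(2)
proof (induction A rule: infinite_finite_induct)
  case (insert a A)
  then show ?case using Ck_on_add[OF assms(1), of k "g a" "\<lambda>x. \<Sum>i\<in>A. g i x"] by simp
qed (simp_all add: Ck_on_const[OF assms(1)])

lemma Ck_on_minus:
  assumes "open U" "Ck_on k U g"
  shows "Ck_on k U (\<lambda>x. - g x)"
  using Ck_on_mult[OF assms(1) Ck_on_const[OF assms(1)] assms(2), of "-1"] by simp

lemma Ck_on_diff:
  assumes "open U" "Ck_on k U g" "Ck_on k U h"
  shows "Ck_on k U (\<lambda>x. g x - h x)"
  using Ck_on_add[OF assms(1,2) Ck_on_minus[OF assms(1,3)]] by simp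

lemma Ck_on_power:
  assumes "open U" "Ck_on k U g"
  shows "Ck_on k U (\<lambda>x. g x ^ p)"
  by (induction p) (simp_all add: Ck_on_const[OF assms(1)] Ck_on_mult[OF assms])

lemma Ck_on_inverse:
  assumes "open U" "\<And>x. x \<in> U \<Longrightarrow> g x \<noteq> 0"
  shows "Ck_on k U g \<Longrightarrow> Ck_on k U (\<lambda>x. inverse (g x))"
proof (induction k)
  case (Suc k)
  \<comment> \<open>The derivative of an inverse contains the inverse again, so its order
    \<open>k\<close> must come from the induction hypothesis.\<close>
  have *: "Ck_on k U (\<lambda>x. inverse (g x))" using Suc Ck_on_Suc_lower by blast
  show ?case
  proof (rule Ck_on_SucI[OF assms(1), of _ "\<lambda>i x. - (inverse (g x) * partial i g x * inverse (g x))"])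
    show "continuous_on U (\<lambda>x. inverse (g x))"
      using assms Suc.prems by (auto intro!: continuous_intros)
    show "((\<lambda>t. inverse (g (x + t *\<^sub>R axis i 1))) has_real_derivative
        - (inverse (g x) * partial i g x * inverse (g x))) (at 0)" if "x \<in> U" for i x
      using DERIV_inverse'[OF Ck_on_has_partial[OF Suc.prems that], of i] assms(2)[OF that] by simp
    show "Ck_on k U (\<lambda>x. - (inverse (g x) * partial i g x * inverse (g x)))" for i
      using * Suc.prems by (auto intro!: Ck_on_minus Ck_on_mult assms(1))
  qed
qed (auto intro!: continuous_intros simp: assms(2))

lemma Ck_on_affine_rescale:
  assumes "open U"
  shows "Ck_on k U g \<Longrightarrow> Ck_on k {x. p + s *\<^sub>R x \<in> U} (\<lambda>x. g (p + s *\<^sub>R x))"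
proof (induction k arbitrary: g)
  case 0
  then show ?case by (auto intro!: continuous_on_compose2[of U g] continuous_intros)
next
  case (Suc k)
  let ?V = "{x. p + s *\<^sub>R x \<in> U}"
  have V: "open ?V"
  proof -
    have "open ((\<lambda>x. p + s *\<^sub>R x) -` U)"
      by (intro open_vimage assms continuous_intros)
    then show ?thesis by (simp add: vimage_def)
  qed
  show ?case
  proof (rule Ck_on_SucI[OF V, of _ "\<lambda>i x. s * partial i g (p + s *\<^sub>R x)"])
    show "continuous_on ?V (\<lambda>x. g (p + s *\<^sub>R x))"
      using Suc.prems by (auto intro!: continuous_on_compose2[of U g] continuous_intros)
    show "Ck_on k ?V (\<lambda>x. s * partial i g (p + s *\<^sub>R x))" for i
      using Suc by (intro Ck_on_mult V Ck_on_const Suc.IH) auto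
    show "((\<lambda>t. g (p + s *\<^sub>R (x + t *\<^sub>R axis i 1))) has_real_derivative s * partial i g (p + s *\<^sub>R x)) (at 0)"
      if "x \<in> ?V" for i x
    proof -
      have lin: "((\<lambda>t. s * t) has_real_derivative s) (at 0)"
        by (auto intro!: derivative_eq_intros)
      have "((\<lambda>t. g (p + s *\<^sub>R x + (s * t) *\<^sub>R axis i 1)) has_real_derivative partial i g (p + s *\<^sub>R x) * s) (at 0)"
        using DERIV_chain2[OF _ lin, of "\<lambda>t. g (p + s *\<^sub>R x + t *\<^sub>R axis i 1)"]
          Ck_on_has_partial_line[OF Suc.prems, of "p + s *\<^sub>R x" 0 i] that by simp
      then show ?thesis by (simp add: scaleR_add_right add.assoc mult.commute)
    qed
  qed
qed

text \<open>The increment is taken along a path that changes one coordinate at a time. On each edge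
  the mean value inequality compares with the partial derivative at \<open>x\<close>, and continuity
  of the partial derivatives makes the error small.\<close>

lemma C1_has_derivative:
  fixes g :: "real^'n::finite \<Rightarrow> real"
  assumes "open U" "Ck_on (Suc 0) U g" "x \<in> U"
  shows "(g has_derivative (\<lambda>h. \<Sum>i\<in>UNIV. h $ i * partial i g x)) (at x)"
  unfolding has_derivative_at_alt
proof (intro conjI allI impI)
  show "bounded_linear (\<lambda>h. \<Sum>i\<in>UNIV. h $ i * partial i g x)"
    by (intro bounded_linear_sum bounded_linear_mult_const bounded_linear_vec_nth)
next
  fix e :: real assume "e > 0"
  define e' where "e' = e / real CARD('n)"
  have e': "e' > 0" using \<open>e > 0\<close> by (simp add: e'_def)
  have "\<forall>\<^sub>F y in nhds x. \<bar>partial i g y - partial i g x\<bar> < e'" for i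
  proof -
    have "isCont (partial i g) x"
      using assms continuous_on_eq_continuous_at[OF assms(1), of "partial i g"] by auto
    then have "(partial i g \<longlongrightarrow> partial i g x) (nhds x)"
      unfolding isCont_def by (simp add: tendsto_at_iff_tendsto_nhds)
    from tendstoD[OF this e'] show ?thesis by (simp add: dist_real_def)
  qed
  then have "\<forall>\<^sub>F y in nhds x. y \<in> U \<and> (\<forall>i. \<bar>partial i g y - partial i g x\<bar> < e')"
    using eventually_nhds_in_open[OF assms(1,3)]
    by (auto simp: eventually_conj_iff intro!: eventually_all_finite)
  then obtain r where "r > 0"
    and r: "\<And>y. dist y x < r \<Longrightarrow> y \<in> U \<and> (\<forall>i. \<bar>partial i g y - partial i g x\<bar> < e')"
    unfolding eventually_nhds_metric by blast
  show "\<exists>d>0. \<forall>y. norm (y - x) < d \<longrightarrow>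
      norm (g y - g x - (\<Sum>i\<in>UNIV. (y - x) $ i * partial i g x)) \<le> e * norm (y - x)"
  proof (intro exI[of _ r] conjI allI impI \<open>r > 0\<close>)
    fix y assume y: "norm (y - x) < r"
    define h where "h = y - x"
    \<comment> \<open>\<open>P S\<close> is the corner of the path at which exactly the coordinates
      in \<open>S\<close> have moved. Componentwise comparison keeps every edge within
      \<open>norm h\<close> of \<open>x\<close>.\<close>
    define P where "P S = x + (\<chi> i. if i \<in> S then h $ i else 0)" for S
    have main: "\<bar>g (P S) - g x - (\<Sum>i\<in>S. h $ i * partial i g x)\<bar> \<le> (\<Sum>i\<in>S. e' * \<bar>h $ i\<bar>)" for S
    proof (induction S rule: infinite_finite_induct)
      case empty
      have "P {} = x" by (simp add: P_def vec_eq_iff)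
      then show ?case by simp
    next
      case (insert k S)
      have ins: "P (insert k S) = P S + (h $ k) *\<^sub>R axis k 1"
        using insert.hyps by (auto simp: P_def vec_eq_iff axis_def)
      have near: "dist (P S + t *\<^sub>R axis k 1) x < r" if t: "t \<in> closed_segment 0 (h $ k)" for t
      proof -
        have tk: "\<bar>t\<bar> \<le> \<bar>h $ k\<bar>" using t by (auto simp: closed_segment_eq_real_ivl split: if_splits)
        have "dist (P S + t *\<^sub>R axis k 1) x \<le> norm h"
          unfolding dist_norm
          by (rule norm_le_componentwise_cart) (use tk insert.hyps in \<open>auto simp: P_def axis_def\<close>)
        then show ?thesis using y by (simp add: h_def)
      qed
      define F where "F t = g (P S + t *\<^sub>R axis k 1) - t * partial k g x" for t
      have "norm (F (h $ k) - F 0) \<le> e' * norm (h $ k - 0)"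
      proof (rule field_differentiable_bound[where S="closed_segment 0 (h $ k)"])
        show "(F has_field_derivative partial k g (P S + t *\<^sub>R axis k 1) - partial k g x)
            (at t within closed_segment 0 (h $ k))" if "t \<in> closed_segment 0 (h $ k)" for t
          unfolding F_def
          by (rule has_field_derivative_at_within)
            (use Ck_on_has_partial_line[OF assms(2)] r[OF near[OF that]] in \<open>auto intro!: derivative_eq_intros\<close>)
        show "norm (partial k g (P S + t *\<^sub>R axis k 1) - partial k g x) \<le> e'"
          if "t \<in> closed_segment 0 (h $ k)" for t
          using r[OF near[OF that]] by (auto intro: less_imp_le)
      qed auto
      then have "\<bar>g (P (insert k S)) - g (P S) - h $ k * partial k g x\<bar> \<le> e' * \<bar>h $ k\<bar>"
        by (simp add: F_def ins algebra_simps)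
      then show ?case using insert by (simp add: algebra_simps abs_le_iff)
    qed simp
    have "(\<Sum>i\<in>UNIV. e' * \<bar>h $ i\<bar>) \<le> (\<Sum>i\<in>(UNIV::'n set). e' * norm h)"
      by (intro sum_mono mult_left_mono component_le_norm_cart) (use e' in auto)
    also have "\<dots> = e * norm h" by (simp add: e'_def)
    finally have "\<bar>g (P UNIV) - g x - (\<Sum>i\<in>UNIV. h $ i * partial i g x)\<bar> \<le> e * norm h"
      using main[of UNIV] by linarith
    moreover have "P UNIV = y" by (simp add: P_def h_def vec_eq_iff)
    ultimately show "norm (g y - g x - (\<Sum>i\<in>UNIV. (y - x) $ i * partial i g x)) \<le> e * norm (y - x)"
      by (simp add: h_def)
  qed
qed

text \<open>The double difference is symmetric in \<open>i\<close> and \<open>j\<close>, while two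
  applications of the mean value theorem express it by a mixed derivative in one prescribed order.
  Exchanging \<open>i\<close> and \<open>j\<close> therefore compares the two orders.\<close>

lemma second_difference_mean_value:
  fixes g :: "real^'n::finite \<Rightarrow> real"
  assumes "Ck_on 2 U g" "0 < s"
    and U: "\<And>a b. 0 \<le> a \<Longrightarrow> a \<le> s \<Longrightarrow> 0 \<le> b \<Longrightarrow> b \<le> s \<Longrightarrow> x + a *\<^sub>R axis i 1 + b *\<^sub>R axis j 1 \<in> U"
  shows "\<exists>a b. 0 \<le> a \<and> a \<le> s \<and> 0 \<le> b \<and> b \<le> s \<and>
    g (x + s *\<^sub>R axis i 1 + s *\<^sub>R axis j 1) - g (x + s *\<^sub>R axis i 1) - g (x + s *\<^sub>R axis j 1) + g x
      = s\<^sup>2 * partial j (partial i g) (x + a *\<^sub>R axis i 1 + b *\<^sub>R axis j 1)"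
proof -
  have C: "Ck_on (Suc (Suc 0)) U g" using assms(1) by (simp add: numeral_2_eq_2)
  have C': "Ck_on (Suc 0) U (partial i g)" using C by auto
  have d1: "((\<lambda>a. g (x + a *\<^sub>R axis i 1 + s *\<^sub>R axis j 1) - g (x + a *\<^sub>R axis i 1)) has_real_derivative
        partial i g (x + a *\<^sub>R axis i 1 + s *\<^sub>R axis j 1) - partial i g (x + a *\<^sub>R axis i 1)) (at a)"
    if "0 \<le> a" "a \<le> s" for a
  proof -
    have "((\<lambda>a. g (x + s *\<^sub>R axis j 1 + a *\<^sub>R axis i 1) - g (x + a *\<^sub>R axis i 1)) has_real_derivative
        partial i g (x + s *\<^sub>R axis j 1 + a *\<^sub>R axis i 1) - partial i g (x + a *\<^sub>R axis i 1)) (at a)"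
      using U[of a s] U[of a 0] that assms(2)
      by (intro DERIV_diff Ck_on_has_partial_line[OF C]) (auto simp: add_ac)
    then show ?thesis by (simp add: add_ac)
  qed
  obtain a where a: "0 < a" "a < s"
    and a': "(g (x + s *\<^sub>R axis i 1 + s *\<^sub>R axis j 1) - g (x + s *\<^sub>R axis i 1)) - (g (x + s *\<^sub>R axis j 1) - g x)
       = s * (partial i g (x + a *\<^sub>R axis i 1 + s *\<^sub>R axis j 1) - partial i g (x + a *\<^sub>R axis i 1))"
    using MVT2[OF assms(2) d1] by auto
  have d2: "((\<lambda>b. partial i g (x + a *\<^sub>R axis i 1 + b *\<^sub>R axis j 1)) has_real_derivative
        partial j (partial i g) (x + a *\<^sub>R axis i 1 + b *\<^sub>R axis j 1)) (at b)"
    if "0 \<le> b" "b \<le> s" for b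
    using U[of a b] that a by (intro Ck_on_has_partial_line[OF C']) auto
  obtain b where b: "0 < b" "b < s"
    and b': "partial i g (x + a *\<^sub>R axis i 1 + s *\<^sub>R axis j 1) - partial i g (x + a *\<^sub>R axis i 1)
       = s * partial j (partial i g) (x + a *\<^sub>R axis i 1 + b *\<^sub>R axis j 1)"
    using MVT2[OF assms(2) d2] by auto
  show ?thesis
    using a b a' b' by (intro exI[of _ a] exI[of _ b]) (auto simp: power2_eq_square algebra_simps)
qed

lemma partial_commute:
  fixes g :: "real^'n::finite \<Rightarrow> real"
  assumes "open U" "Ck_on 2 U g" "x \<in> U"
  shows "partial i (partial j g) x = partial j (partial i g) x"
proof (rule ccontr)
  let ?A = "partial i (partial j g)" and ?B = "partial j (partial i g)"
  assume ne: "?A x \<noteq> ?B x"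
  define e where "e = \<bar>?A x - ?B x\<bar> / 2"
  have e: "e > 0" using ne by (simp add: e_def)
  have "isCont ?A x" "isCont ?B x"
    using assms continuous_on_eq_continuous_at[OF assms(1)] by (auto simp: numeral_2_eq_2)
  then have "(?A \<longlongrightarrow> ?A x) (nhds x)" "(?B \<longlongrightarrow> ?B x) (nhds x)"
    unfolding isCont_def by (simp_all add: tendsto_at_iff_tendsto_nhds)
  from tendstoD[OF this(1) e] tendstoD[OF this(2) e]
  have "\<forall>\<^sub>F y in nhds x. y \<in> U \<and> \<bar>?A y - ?A x\<bar> < e \<and> \<bar>?B y - ?B x\<bar> < e"
    using eventually_nhds_in_open[OF assms(1,3)] by (auto simp: eventually_conj_iff dist_real_def)
  then obtain r where "r > 0"
    and r: "\<And>y. dist y x < r \<Longrightarrow> y \<in> U \<and> \<bar>?A y - ?A x\<bar> < e \<and> \<bar>?B y - ?B x\<bar> < e"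
    unfolding eventually_nhds_metric by blast
  \<comment> \<open>Points of the square of side \<open>s\<close> are at distance at most
    \<open>2 * s\<close> from \<open>x\<close>, which is less than \<open>r\<close>.\<close>
  define s where "s = r / 3"
  have s: "s > 0" using \<open>r > 0\<close> by (simp add: s_def)
  have near: "dist (x + a *\<^sub>R axis k 1 + b *\<^sub>R axis l 1) x < r"
    if "0 \<le> a" "a \<le> s" "0 \<le> b" "b \<le> s" for a b k l
  proof -
    have "norm (a *\<^sub>R axis k 1 + b *\<^sub>R axis l (1::real)) \<le> a + b"
      using norm_triangle_ineq[of "a *\<^sub>R axis k 1" "b *\<^sub>R axis l (1::real)"] that by (simp add: norm_axis_1)
    then show ?thesis using that \<open>r > 0\<close> by (simp add: dist_norm add.assoc s_def)
  qed
  obtain a b where ab: "0 \<le> a" "a \<le> s" "0 \<le> b" "b \<le> s" and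
    1: "g (x + s *\<^sub>R axis i 1 + s *\<^sub>R axis j 1) - g (x + s *\<^sub>R axis i 1) - g (x + s *\<^sub>R axis j 1) + g x
      = s\<^sup>2 * ?B (x + a *\<^sub>R axis i 1 + b *\<^sub>R axis j 1)"
    using second_difference_mean_value[OF assms(2) s, of x i j] near r by blast
  obtain a' b' where ab': "0 \<le> a'" "a' \<le> s" "0 \<le> b'" "b' \<le> s" and
    2: "g (x + s *\<^sub>R axis j 1 + s *\<^sub>R axis i 1) - g (x + s *\<^sub>R axis j 1) - g (x + s *\<^sub>R axis i 1) + g x
      = s\<^sup>2 * ?A (x + a' *\<^sub>R axis j 1 + b' *\<^sub>R axis i 1)"
    using second_difference_mean_value[OF assms(2) s, of x j i] near r by blast
  have "s\<^sup>2 * ?B (x + a *\<^sub>R axis i 1 + b *\<^sub>R axis j 1) = s\<^sup>2 * ?A (x + a' *\<^sub>R axis j 1 + b' *\<^sub>R axis i 1)"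
    unfolding 1[symmetric] 2[symmetric] by (simp add: add_ac)
  then have "?B (x + a *\<^sub>R axis i 1 + b *\<^sub>R axis j 1) = ?A (x + a' *\<^sub>R axis j 1 + b' *\<^sub>R axis i 1)"
    using s by simp
  then show False
    using r[OF near[OF ab]] r[OF near[OF ab']] unfolding e_def by (smt (verit) field_sum_of_halves)
qed

section \<open>Integrals over facets\<close>

lemma AE_lborel_not_in_hyperplane:
  fixes a :: "'a::euclidean_space"
  assumes "a \<noteq> 0 \<or> b \<noteq> 0"
  shows "AE x in lborel. a \<bullet> x \<noteq> b"
proof -
  have "{x. a \<bullet> x = b} \<in> null_sets lborel"
    using negligible_hyperplane[OF assms] closed_hyperplane[of a b]
    by (simp add: negligible_iff_null_sets null_sets_completion_iff)
  then show ?thesis by (auto dest: AE_not_in)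
qed

text \<open>The substituted map fixes the hyperplane \<open>n \<bullet> y + k = 0\<close> and
  multiplies \<open>n \<bullet> y + k\<close> by \<open>e\<close>. It moves points only along a
  coordinate vector, so Fubini in that coordinate leaves a one-dimensional affine
  substitution.\<close>

lemma nn_integral_lborel_stretch:
  fixes n b :: "'a::euclidean_space"
  assumes b: "b \<in> Basis" and nb: "n \<bullet> b \<noteq> 0" and e: "0 < e"
    and [measurable]: "f \<in> borel_measurable borel"
  shows "(\<integral>\<^sup>+x. f x \<partial>lborel) = ennreal e * (\<integral>\<^sup>+y. f (y + ((e - 1) * (n \<bullet> y + k) / (n \<bullet> b)) *\<^sub>R b) \<partial>lborel)"
proof -
  interpret product_sigma_finite "\<lambda>_::'a. lborel :: real measure"
    by (rule product_sigma_finite.intro) (rule sigma_finite_lborel)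
  define T where "T y = y + ((e - 1) * (n \<bullet> y + k) / (n \<bullet> b)) *\<^sub>R b" for y
  have [measurable]: "T \<in> borel_measurable borel"
    unfolding T_def using nb by (intro borel_measurable_continuous_onI continuous_intros) auto
  define B where "B = Basis - {b}"
  have B: "finite B" "b \<notin> B" "Basis = insert b B" using b by (auto simp: B_def)
  define S where "S p = (\<Sum>c\<in>Basis. p c *\<^sub>R c)" for p :: "'a \<Rightarrow> real"
  have [measurable]: "S \<in> (\<Pi>\<^sub>M c\<in>insert b B. lborel) \<rightarrow>\<^sub>M borel"
    unfolding S_def B(3)[symmetric] by measurable
  have lb: "lborel = distr (\<Pi>\<^sub>M c\<in>insert b B. lborel) borel S"
    unfolding S_def[abs_def] B(3)[symmetric] by (rule lborel_eq)
  have fub: "(\<integral>\<^sup>+x. g x \<partial>lborel) = (\<integral>\<^sup>+p. (\<integral>\<^sup>+t. g (S (p(b := t))) \<partial>lborel) \<partial>(\<Pi>\<^sub>M c\<in>B. lborel))"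
    if [measurable]: "g \<in> borel_measurable borel" for g
    by (subst lb, subst nn_integral_distr, simp_all add: product_nn_integral_insert[OF B(1,2)])
  have line: "S (p(b := t)) = S (p(b := 0)) + t *\<^sub>R b" for p t
    unfolding S_def B(3) using B(1,2) by (auto intro!: sum.cong)
  have inner: "(\<integral>\<^sup>+t. f (S (p(b := t))) \<partial>lborel) = (\<integral>\<^sup>+t. ennreal e * f (T (S (p(b := t)))) \<partial>lborel)" for p
  proof -
    define s where "s = S (p(b := 0))"
    have lp: "S (p(b := t)) = s + t *\<^sub>R b" for t
      unfolding s_def by (rule line)
    \<comment> \<open>On the line through \<open>s\<close> parallel to \<open>b\<close>, the stretch
      sends the parameter \<open>t\<close> to \<open>\<alpha> + e * t\<close>.\<close>
    define \<alpha> where "\<alpha> = (e - 1) * (n \<bullet> s + k) / (n \<bullet> b)"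
    have T: "T (s + t *\<^sub>R b) = s + (\<alpha> + e * t) *\<^sub>R b" for t
      using nb by (simp add: T_def \<alpha>_def inner_add_right field_simps scaleR_add_left[symmetric])
    have "(\<integral>\<^sup>+t. f (s + t *\<^sub>R b) \<partial>lborel) = ennreal e * (\<integral>\<^sup>+t. f (s + (\<alpha> + e * t) *\<^sub>R b) \<partial>lborel)"
      using nn_integral_real_affine[of "\<lambda>t. f (s + t *\<^sub>R b)" e \<alpha>] e by simp
    also have "\<dots> = (\<integral>\<^sup>+t. ennreal e * f (T (s + t *\<^sub>R b)) \<partial>lborel)"
      unfolding T by (rule nn_integral_cmult[symmetric]) simp
    finally show ?thesis by (simp only: lp)
  qed
  have "(\<integral>\<^sup>+x. f x \<partial>lborel) = (\<integral>\<^sup>+y. ennreal e * f (T y) \<partial>lborel)"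
    by (subst (1 2) fub) (simp_all add: inner)
  also have "\<dots> = ennreal e * (\<integral>\<^sup>+y. f (T y) \<partial>lborel)"
    by (rule nn_integral_cmult) simp
  finally show ?thesis unfolding T_def .
qed

text \<open>Applied to indicators, the nonnegative version identifies \<open>lborel\<close> with
  \<open>e\<close> times its image under the stretch. This equality of measures transfers to
  integrals of signed functions.\<close>

lemma integral_lborel_stretch:
  fixes n b :: "'a::euclidean_space" and f :: "'a \<Rightarrow> real"
  assumes b: "b \<in> Basis" and nb: "n \<bullet> b \<noteq> 0" and e: "0 < e"
    and [measurable]: "f \<in> borel_measurable borel"
  shows "(\<integral>x. f x \<partial>lborel) = e * (\<integral>y. f (y + ((e - 1) * (n \<bullet> y + k) / (n \<bullet> b)) *\<^sub>R b) \<partial>lborel)"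
proof -
  define T where "T y = y + ((e - 1) * (n \<bullet> y + k) / (n \<bullet> b)) *\<^sub>R b" for y
  have [measurable]: "T \<in> borel_measurable borel"
    unfolding T_def using nb by (intro borel_measurable_continuous_onI continuous_intros) auto
  have "lborel = density (distr lborel borel T) (\<lambda>_. ennreal e)"
  proof (rule measure_eqI)
    fix A :: "'a set" assume "A \<in> sets lborel"
    then have [measurable]: "A \<in> sets borel" by simp
    have "emeasure lborel A = ennreal e * (\<integral>\<^sup>+y. indicator A (T y) \<partial>lborel)"
      using nn_integral_lborel_stretch[OF b nb e, of "indicator A" k] by (simp add: T_def)
    also have "(\<integral>\<^sup>+y. indicator A (T y) \<partial>lborel) = (\<integral>\<^sup>+x. indicator A x \<partial>distr lborel borel T)"
      by (subst nn_integral_distr) auto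
    also have "ennreal e * \<dots> = (\<integral>\<^sup>+x. ennreal e * indicator A x \<partial>distr lborel borel T)"
      by (subst nn_integral_cmult) auto
    also have "\<dots> = emeasure (density (distr lborel borel T) (\<lambda>_. ennreal e)) A"
      by (subst emeasure_density) auto
    finally show "emeasure lborel A = emeasure (density (distr lborel borel T) (\<lambda>_. ennreal e)) A" .
  qed simp
  then have "(\<integral>x. f x \<partial>lborel) = (\<integral>x. f x \<partial>density (distr lborel borel T) (\<lambda>_. ennreal e))"
    by simp
  also have "\<dots> = (\<integral>x. e * f x \<partial>distr lborel borel T)"
    using e by (subst integral_density) auto
  also have "\<dots> = e * (\<integral>y. f (T y) \<partial>lborel)"
    by (subst integral_distr) auto
  finally show ?thesis unfolding T_def .
qed

lemma integrable_const_indicator_cball: "integrable lborel (\<lambda>y. M * indicator (cball x R) y :: real)"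
  using emeasure_lborel_cball_finite[of x R]
  by (intro integrable_mult_right integrable_real_indicator) simp_all

lemma dominated_convergence_at_right_0:
  fixes q :: "real \<Rightarrow> 'a \<Rightarrow> real"
  assumes f: "f \<in> borel_measurable M" and q: "\<And>e. 0 < e \<Longrightarrow> q e \<in> borel_measurable M"
    and w: "integrable M w"
    and lim: "AE x in M. ((\<lambda>e. q e x) \<longlongrightarrow> f x) (at_right 0)"
    and bnd: "\<And>e x. 0 < e \<Longrightarrow> e < 1 \<Longrightarrow> \<bar>q e x\<bar> \<le> w x"
  shows "((\<lambda>e. \<integral>x. q e x \<partial>M) \<longlongrightarrow> (\<integral>x. f x \<partial>M)) (at_right 0)"
proof (rule tendsto_at_right_sequentially[OF zero_less_one])
  fix s :: "nat \<Rightarrow> real" assume s: "\<And>n. 0 < s n" "\<And>n. s n < 1" "s \<longlonglongrightarrow> 0"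
  have "s n \<noteq> 0" for n using s(1)[of n] by simp
  then have s0: "filterlim s (at_right 0) sequentially"
    using s by (auto simp: filterlim_at)
  show "(\<lambda>n. \<integral>x. q (s n) x \<partial>M) \<longlonglongrightarrow> (\<integral>x. f x \<partial>M)"
  proof (rule integral_dominated_convergence[OF f q[OF s(1)] w])
    show "AE x in M. (\<lambda>n. q (s n) x) \<longlonglongrightarrow> f x"
      using lim by eventually_elim (rule filterlim_compose[OF _ s0])
    show "AE x in M. norm (q (s n) x) \<le> w x" for n
      using bnd[OF s(1,2)] by simp
  qed
qed

section \<open>Elementary geometry of the polytope\<close>

locale simple_polytope =
  fixes d :: nat and nrm :: "nat \<Rightarrow> real^'n::finite" and c :: "nat \<Rightarrow> real"
  assumes simple: "simple_labelled_polytope d nrm c"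
begin

abbreviation P :: "(real^'n) set" where "P \<equiv> polytope_of d nrm c"
abbreviation L :: "nat \<Rightarrow> real^'n \<Rightarrow> real" where "L \<equiv> Lfun nrm c"

lemma L_add: "L j (x + y) = L j x + nrm j \<bullet> y"
  by (simp add: Lfun_def inner_add_right)

lemma continuous_on_L [continuous_intros]: "continuous_on A g \<Longrightarrow> continuous_on A (\<lambda>x. L j (g x))"
  unfolding Lfun_def by (intro continuous_intros)

lemma tendsto_L [tendsto_intros]: "(g \<longlongrightarrow> x) F \<Longrightarrow> ((\<lambda>t. L j (g t)) \<longlongrightarrow> L j x) F"
  unfolding Lfun_def by (intro tendsto_intros)

lemma L_measurable [measurable]: "L j \<in> borel_measurable borel"
  by (intro borel_measurable_continuous_onI continuous_intros)

lemma closed_P: "closed P"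
proof -
  have "P = (\<Inter>j\<in>{..<d}. {x. 0 \<le> L j x})"
    by (auto simp: polytope_of_def)
  then show ?thesis
    by (auto intro!: closed_INT closed_Collect_le continuous_intros)
qed

lemma compact_P: "compact P"
  using closed_P simple by (simp add: simple_labelled_polytope_def compact_eq_bounded_closed)

lemma bounded_P: "bounded P"
  using compact_P compact_imp_bounded by blast

lemma P_sets [measurable]: "P \<in> sets borel"
  using closed_P by simp

lemma convex_P: "convex P"
proof -
  have *: "- c j \<le> nrm j \<bullet> x \<longleftrightarrow> 0 \<le> nrm j \<bullet> x + c j" for j x by linarith
  have "P = (\<Inter>j\<in>{..<d}. {x. nrm j \<bullet> x \<ge> - c j})"
    unfolding * by (auto simp: polytope_of_def Lfun_def)
  then show ?thesis
    by (auto intro!: convex_INT convex_halfspace_ge)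
qed

lemma facet_nonempty:
  assumes "j < d"
  obtains \<xi> where "\<xi> \<in> P" "L j \<xi> = 0"
proof -
  have "aff_dim (facet d nrm c j) \<ge> 0"
    using simple assms by (auto simp: simple_labelled_polytope_def)
  then have "facet d nrm c j \<noteq> {}" by auto
  then show ?thesis using that by (auto simp: facet_def)
qed

lemma active_independent:
  assumes "\<xi> \<in> P"
  shows "inj_on nrm {j. j < d \<and> L j \<xi> = 0}" "independent (nrm ` {j. j < d \<and> L j \<xi> = 0})"
  using simple assms by (auto simp: simple_labelled_polytope_def)

lemma nrm_nonzero:
  assumes "j < d"
  shows "nrm j \<noteq> 0"
proof -
  obtain \<xi> where "\<xi> \<in> P" "L j \<xi> = 0" using facet_nonempty[OF assms] .
  then show ?thesis
    using active_independent(2)[of \<xi>] assms dependent_zero[of "nrm ` {j. j < d \<and> L j \<xi> = 0}"] by force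
qed

lemma interior_P: "interior P = {x. \<forall>j<d. L j x > 0}"
proof
  have "open {x. \<forall>j<d. L j x > 0}"
  proof -
    have "{x. \<forall>j<d. L j x > 0} = (\<Inter>j\<in>{..<d}. {x. L j x > 0})" by auto
    then show ?thesis by (auto intro!: open_INT open_Collect_less continuous_intros)
  qed
  then show "{x. \<forall>j<d. L j x > 0} \<subseteq> interior P"
    by (intro interior_maximal) (auto simp: polytope_of_def less_imp_le)
  show "interior P \<subseteq> {x. \<forall>j<d. L j x > 0}"
  proof safe
    fix x j assume x: "x \<in> interior P" and j: "j < d"
    obtain e where "e > 0" and e: "cball x e \<subseteq> P"
      using x mem_interior_cball by blast
    \<comment> \<open>Moving \<open>x\<close> by \<open>e\<close> against the inward normal lowers
      \<open>L j\<close> by \<open>e * norm (nrm j)\<close> and must not leave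
      \<open>P\<close>.\<close>
    define y where "y = x + (- e / norm (nrm j)) *\<^sub>R nrm j"
    have "y \<in> cball x e"
      using \<open>e > 0\<close> nrm_nonzero[OF j] by (simp add: y_def dist_norm)
    then have "0 \<le> L j y" using e j by (auto simp: polytope_of_def)
    also have "L j y = L j x - e * norm (nrm j)"
      using nrm_nonzero[OF j] unfolding y_def L_add
      by (simp add: dot_square_norm power2_eq_square)
    finally show "L j x > 0"
      using \<open>e > 0\<close> nrm_nonzero[OF j] by (smt (verit) mult_pos_pos zero_less_norm_iff)
  qed
qed

lemma AE_L_nonzero:
  assumes "j < d"
  shows "AE x in lborel. L j x \<noteq> s"
  using AE_lborel_not_in_hyperplane[of "nrm j" "s - c j"] nrm_nonzero[OF assms]
  by (auto simp: Lfun_def)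

section \<open>The facet measure as Lebesgue measure on a cylinder over the facet\<close>

definition fdir :: "nat \<Rightarrow> real^'n" where
  "fdir j = (SOME b. b \<in> Basis \<and> nrm j \<bullet> b \<noteq> 0)"

text \<open>Along this vector \<open>L j\<close> grows at unit rate. It is a multiple of a
  coordinate vector, not of the normal, so that \<open>integral_lborel_stretch\<close> applies to
  motion along it.\<close>

definition fvec :: "nat \<Rightarrow> real^'n" where
  "fvec j = (1 / (nrm j \<bullet> fdir j)) *\<^sub>R fdir j"

definition fproj :: "nat \<Rightarrow> real^'n \<Rightarrow> real^'n" where
  "fproj j y = y - L j y *\<^sub>R fvec j"

text \<open>The cylinder of unit height over the part of the facet that lies on no other facet. The
  strict inequalities guarantee that points slightly above the base belong to
  \<open>P\<close>.\<close>

definition fcyl :: "nat \<Rightarrow> (real^'n) set" where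
  "fcyl j = {y. 0 < L j y \<and> L j y \<le> 1 \<and> (\<forall>k<d. k \<noteq> j \<longrightarrow> 0 < L k (fproj j y))}"

text \<open>Lebesgue measure on the cylinder is the product of \<open>d\<sigma>\<close> and
  \<open>dL_j\<close>, and \<open>L j\<close> runs through an interval of length 1; so this is the
  integral of \<open>H\<close> over the facet against \<open>d\<sigma>\<close>.\<close>

definition face_mean :: "nat \<Rightarrow> (real^'n \<Rightarrow> real) \<Rightarrow> real" where
  "face_mean j H = (LBINT y:fcyl j. H (fproj j y))"

lemma fdir:
  assumes "j < d"
  shows "fdir j \<in> Basis" "nrm j \<bullet> fdir j \<noteq> 0"
proof -
  have "\<exists>b. b \<in> Basis \<and> nrm j \<bullet> b \<noteq> 0"
    using nrm_nonzero[OF assms] euclidean_eqI[of "nrm j" 0] by (metis inner_zero_left)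
  from someI_ex[OF this] show "fdir j \<in> Basis" "nrm j \<bullet> fdir j \<noteq> 0"
    unfolding fdir_def by auto
qed

lemma nrm_fvec: "j < d \<Longrightarrow> nrm j \<bullet> fvec j = 1"
  using fdir(2) by (simp add: fvec_def)

lemma L_fproj: "j < d \<Longrightarrow> L j (fproj j y) = 0"
  using L_add[of j y "- (L j y *\<^sub>R fvec j)"] by (simp add: fproj_def nrm_fvec)

lemma continuous_on_fproj [continuous_intros]:
  "continuous_on A g \<Longrightarrow> continuous_on A (\<lambda>x. fproj j (g x))"
  unfolding fproj_def by (intro continuous_intros)

lemma fproj_measurable [measurable]: "fproj j \<in> borel_measurable borel"
  by (intro borel_measurable_continuous_onI continuous_intros)

lemma fcyl_sets [measurable]: "fcyl j \<in> sets borel"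
  unfolding fcyl_def by measurable

lemma fproj_in_P: "j < d \<Longrightarrow> y \<in> fcyl j \<Longrightarrow> fproj j y \<in> P"
  unfolding fcyl_def polytope_of_def using L_fproj by (force intro: less_imp_le)

lemma bounded_fcyl:
  assumes "j < d"
  shows "bounded (fcyl j)"
proof -
  obtain B where B: "\<And>x. x \<in> P \<Longrightarrow> norm x \<le> B"
    using bounded_P by (auto simp: bounded_iff)
  have "norm y \<le> B + norm (fvec j)" if y: "y \<in> fcyl j" for y
  proof -
    have "y = fproj j y + L j y *\<^sub>R fvec j" by (simp add: fproj_def)
    then have "norm y \<le> norm (fproj j y) + norm (L j y *\<^sub>R fvec j)"
      by (metis norm_triangle_ineq)
    moreover have "norm (L j y *\<^sub>R fvec j) \<le> 1 * norm (fvec j)"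
      unfolding norm_scaleR using y by (intro mult_right_mono) (auto simp: fcyl_def)
    ultimately show ?thesis using B[OF fproj_in_P[OF assms y]] by simp
  qed
  then show ?thesis by (auto simp: bounded_iff)
qed

text \<open>Simplicity rules out that two distinct facets lie in the same hyperplane.\<close>

lemma AE_L_fproj_nonzero:
  assumes j: "j < d" and k: "k < d" "k \<noteq> j"
  shows "AE y in lborel. L k (fproj j y) \<noteq> 0"
proof -
  \<comment> \<open>After projection \<open>L k\<close> becomes the affine function
    \<open>v \<bullet> y - b\<close>. If it vanished identically, \<open>nrm k\<close> would be a
    multiple of \<open>nrm j\<close> with both facets active at a common point, against
    independence.\<close>
  define v where "v = nrm k - (nrm k \<bullet> fvec j) *\<^sub>R nrm j"
  define b where "b = (nrm k \<bullet> fvec j) * c j - c k"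
  have eq: "L k (fproj j y) = v \<bullet> y - b" for y
    by (simp add: v_def b_def fproj_def Lfun_def algebra_simps inner_diff_right inner_diff_left)
  have "v \<noteq> 0 \<or> b \<noteq> 0"
  proof (rule ccontr)
    assume *: "\<not> (v \<noteq> 0 \<or> b \<noteq> 0)"
    obtain \<xi> where \<xi>: "\<xi> \<in> P" "L j \<xi> = 0" using facet_nonempty[OF j] .
    have "fproj j \<xi> = \<xi>" using \<xi> by (simp add: fproj_def)
    then have Lk: "L k \<xi> = 0" using eq[of \<xi>] * by simp
    let ?A = "{i. i < d \<and> L i \<xi> = 0}"
    have mem: "j \<in> ?A" "k \<in> ?A" using j k \<xi> Lk by auto
    have ne: "nrm k \<noteq> nrm j"
      using active_independent(1)[OF \<xi>(1)] mem k(2) by (auto dest: inj_onD)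
    have "nrm k = (nrm k \<bullet> fvec j) *\<^sub>R nrm j" using * by (simp add: v_def)
    then have "nrm k \<in> span {nrm j}"
      by (metis span_base span_mul singletonI)
    then have "nrm k \<in> span (nrm ` ?A - {nrm k})"
    proof -
      have "{nrm j} \<subseteq> nrm ` ?A - {nrm k}" using mem ne by auto
      then show ?thesis using \<open>nrm k \<in> span {nrm j}\<close> span_mono by blast
    qed
    then have "dependent (nrm ` ?A)"
      unfolding dependent_def using mem by blast
    then show False using active_independent(2)[OF \<xi>(1)] by blast
  qed
  from AE_lborel_not_in_hyperplane[OF this] show ?thesis by (auto simp: eq)
qed

text \<open>The stretch \<open>y \<mapsto> fproj j y + (e * L j y) *\<^sub>R fvec j\<close> has determinant \<open>e\<close> and carries the slab
  \<open>{0 \<le> L j \<le> 1}\<close> onto \<open>{0 \<le> L j \<le> e}\<close>, so that the rescaled slab integrals become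
  integrals over a fixed domain, to which dominated convergence applies.\<close>

lemma facet_limit:
  assumes j: "j < d"
    and meas: "\<And>e. 0 < e \<Longrightarrow> (\<lambda>x. indicator P x * h e x) \<in> borel_measurable borel"
    and bnd: "\<And>e x. 0 < e \<Longrightarrow> x \<in> P \<Longrightarrow> \<bar>h e x\<bar> \<le> M"
    and measH: "(\<lambda>x. indicator P x * H x) \<in> borel_measurable borel"
    and lim: "\<And>\<xi> \<tau>. \<xi> \<in> P \<Longrightarrow> L j \<xi> = 0 \<Longrightarrow> (\<And>k. k < d \<Longrightarrow> k \<noteq> j \<Longrightarrow> 0 < L k \<xi>) \<Longrightarrow> 0 < \<tau> \<Longrightarrow>
        ((\<lambda>e. h e (\<xi> + (e * \<tau>) *\<^sub>R fvec j)) \<longlongrightarrow> H \<xi>) (at_right 0)"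
  shows "((\<lambda>e. (1 / e) * (LBINT x:{x \<in> P. L j x \<le> e}. h e x)) \<longlongrightarrow> face_mean j H) (at_right 0)"
proof -
  define T where "T e y = fproj j y + (e * L j y) *\<^sub>R fvec j" for e y
  define q where "q e y = indicator {x \<in> P. L j x \<le> e} (T e y) * h e (T e y)" for e y
  have LT: "L j (T e y) = e * L j y" for e y
    by (simp add: T_def L_add L_fproj[OF j] nrm_fvec[OF j])
  have Tm [measurable]: "T e \<in> borel_measurable borel" for e
    unfolding T_def by (intro borel_measurable_continuous_onI continuous_intros)
  have slab: "(\<lambda>x. indicator {x \<in> P. L j x \<le> e} x * h e x) \<in> borel_measurable borel" if "0 < e" for e
  proof -
    note meas[OF that, measurable]
    have "(\<lambda>x. indicator {x. L j x \<le> e} x * (indicator P x * h e x)) \<in> borel_measurable borel"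
      by measurable
    also have "(\<lambda>x. indicator {x. L j x \<le> e} x * (indicator P x * h e x)) =
        (\<lambda>x. indicator {x \<in> P. L j x \<le> e} x * h e x)"
      by (auto simp: indicator_def)
    finally show ?thesis .
  qed
  \<comment> \<open>The determinant \<open>e\<close> of the stretch cancels the factor
    \<open>1 / e\<close> of the slab average.\<close>
  have resc: "(1 / e) * (LBINT x:{x \<in> P. L j x \<le> e}. h e x) = (\<integral>y. q e y \<partial>lborel)" if e: "0 < e" for e
  proof -
    have Teq: "y + ((e - 1) * (nrm j \<bullet> y + c j) / (nrm j \<bullet> fdir j)) *\<^sub>R fdir j = T e y" for y
      by (simp add: T_def fproj_def fvec_def Lfun_def algebra_simps diff_divide_distrib add_divide_distrib
        scaleR_diff_left scaleR_add_left)
    show ?thesis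
      using integral_lborel_stretch[OF fdir[OF j] e slab[OF e], of "c j"] e
      unfolding Teq q_def set_lebesgue_integral_def by simp
  qed
  obtain B where B: "\<And>x. x \<in> P \<Longrightarrow> norm x \<le> B"
    using bounded_P by (auto simp: bounded_iff)
  define R where "R = B + norm (fvec j)"
  have "M \<ge> 0"
  proof -
    obtain \<xi> where "\<xi> \<in> P" using facet_nonempty[OF j] by blast
    from bnd[OF zero_less_one this] show ?thesis by linarith
  qed
  \<comment> \<open>If \<open>T e y\<close> lies in the slab, then \<open>L j y\<close> lies in
    [0, 1], so \<open>y\<close> stays in a ball that does not depend on \<open>e\<close>.\<close>
  have qb: "\<bar>q e y\<bar> \<le> M * indicator (cball 0 R) y" if e: "0 < e" "e < 1" for e y
  proof (cases "T e y \<in> P \<and> L j (T e y) \<le> e")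
    case True
    then have Ly: "0 \<le> L j y" "L j y \<le> 1"
      using e j unfolding LT by (auto simp: polytope_of_def LT zero_le_mult_iff)
    have "y = T e y + ((1 - e) * L j y) *\<^sub>R fvec j"
      by (simp add: T_def fproj_def algebra_simps)
    then have "norm y \<le> norm (T e y) + norm (((1 - e) * L j y) *\<^sub>R fvec j)"
      by (metis norm_triangle_ineq)
    moreover have "norm (((1 - e) * L j y) *\<^sub>R fvec j) \<le> 1 * norm (fvec j)"
      unfolding norm_scaleR using Ly e by (intro mult_right_mono) (auto simp: abs_mult intro: mult_le_one)
    ultimately have "norm y \<le> R" using B True by (fastforce simp: R_def)
    then show ?thesis using True bnd[OF e(1), of "T e y"] by (simp add: q_def)
  next
    case False
    then show ?thesis using \<open>M \<ge> 0\<close> by (auto simp: q_def indicator_def)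
  qed
  have AE: "AE y in lborel. L j y \<noteq> 0 \<and> (\<forall>k\<in>{..<d} - {j}. L k (fproj j y) \<noteq> 0)"
    using AE_L_nonzero[OF j, of 0] AE_L_fproj_nonzero[OF j]
    by (auto simp: AE_finite_all intro!: AE_conjI)
  \<comment> \<open>Off the exceptional null set three cases remain. If \<open>L j y\<close> is
    outside (0, 1], the integrand is 0. If some other \<open>L k\<close> is negative at the
    projection, \<open>T e y\<close> leaves \<open>P\<close> for small \<open>e\<close>. Otherwise
    \<open>y\<close> is in the cylinder, \<open>T e y\<close> enters the slab, and
    \<open>lim\<close> applies with \<tau> the height of \<open>y\<close>.\<close>
  have lim_q: "((\<lambda>e. q e y) \<longlongrightarrow> indicator (fcyl j) y * H (fproj j y)) (at_right 0)"
    if y: "L j y \<noteq> 0" "\<forall>k\<in>{..<d} - {j}. L k (fproj j y) \<noteq> 0" for y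
  proof (cases "0 < L j y \<and> L j y \<le> 1")
    case False
    have "\<forall>\<^sub>F e in at_right 0. q e y = 0"
      unfolding eventually_at_right_field
    proof (intro exI[of _ 1] conjI allI impI)
      fix e :: real assume e: "0 < e"
      show "q e y = 0"
      proof (rule ccontr)
        assume "q e y \<noteq> 0"
        then have "T e y \<in> P" "L j (T e y) \<le> e" by (auto simp: q_def indicator_def split: if_splits)
        then have "0 \<le> e * L j y" "e * L j y \<le> e" using j by (auto simp: polytope_of_def LT)
        then show False using False y(1) e by (auto simp: zero_le_mult_iff)
      qed
    qed simp
    moreover have "y \<notin> fcyl j" using False by (auto simp: fcyl_def)
    ultimately show ?thesis by (auto simp: tendsto_eventually)
  next
    case True
    have Tlim: "((\<lambda>e. L k (T e y)) \<longlongrightarrow> L k (fproj j y)) (at_right 0)" for k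
      unfolding T_def by (rule tendsto_eq_intros refl | simp)+
    show ?thesis
    proof (cases "\<forall>k\<in>{..<d} - {j}. L k (fproj j y) > 0")
      case pos: True
      have "\<forall>\<^sub>F e in at_right 0. \<forall>k\<in>{..<d} - {j}. L k (T e y) > 0"
        using pos order_tendstoD(1)[OF Tlim] by (auto simp: eventually_ball_finite_distrib)
      moreover have "\<forall>\<^sub>F e in at_right (0::real). e > 0"
        by (rule eventually_at_right_less)
      ultimately have ev: "\<forall>\<^sub>F e in at_right 0. q e y = h e (T e y)"
      proof eventually_elim
        case (elim e)
        have "0 \<le> L j (T e y)" "L j (T e y) \<le> e" using True elim by (auto simp: LT)
        then have "T e y \<in> P" "L j (T e y) \<le> e"
          unfolding polytope_of_def using elim(1) by (force intro: less_imp_le)+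
        then show ?case by (simp add: q_def)
      qed
      have cyl: "y \<in> fcyl j" using True pos by (auto simp: fcyl_def)
      have "((\<lambda>e. h e (fproj j y + (e * L j y) *\<^sub>R fvec j)) \<longlongrightarrow> H (fproj j y)) (at_right 0)"
        using True pos by (intro lim fproj_in_P[OF j cyl] L_fproj[OF j]) auto
      then show ?thesis
        using tendsto_cong[OF ev] cyl by (simp add: T_def)
    next
      case False
      then obtain k where k: "k < d" "k \<noteq> j" "L k (fproj j y) < 0"
        using y(2) by (force simp: not_less)
      have "\<forall>\<^sub>F e in at_right 0. L k (T e y) < 0"
        using order_tendstoD(2)[OF Tlim k(3)] .
      then have "\<forall>\<^sub>F e in at_right 0. q e y = 0"
        by eventually_elim (use k in \<open>auto simp: q_def polytope_of_def indicator_def not_le\<close>)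
      moreover have "y \<notin> fcyl j" using k by (auto simp: fcyl_def)
      ultimately show ?thesis by (auto simp: tendsto_eventually)
    qed
  qed
  have "((\<lambda>e. \<integral>y. q e y \<partial>lborel) \<longlongrightarrow> (\<integral>y. indicator (fcyl j) y * H (fproj j y) \<partial>lborel)) (at_right 0)"
  proof (rule dominated_convergence_at_right_0[where w="\<lambda>y. M * indicator (cball 0 R) y"])
    note measH[measurable]
    have "(\<lambda>y. indicator (fcyl j) y * (indicator P (fproj j y) * H (fproj j y))) \<in> borel_measurable borel"
      by measurable
    also have "(\<lambda>y. indicator (fcyl j) y * (indicator P (fproj j y) * H (fproj j y))) =
        (\<lambda>y. indicator (fcyl j) y * H (fproj j y))"
      using fproj_in_P[OF j] by (auto simp: indicator_def)
    finally show "(\<lambda>y. indicator (fcyl j) y * H (fproj j y)) \<in> borel_measurable lborel" by simp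
    show "q e \<in> borel_measurable lborel" if "0 < e" for e
      using measurable_compose[OF Tm slab[OF that]] unfolding q_def[abs_def] by simp
    show "AE y in lborel. ((\<lambda>e. q e y) \<longlongrightarrow> indicator (fcyl j) y * H (fproj j y)) (at_right 0)"
      using AE by eventually_elim (use lim_q in blast)
  qed (rule integrable_const_indicator_cball, rule qb)
  moreover have "\<forall>\<^sub>F e in at_right 0. (1 / e) * (LBINT x:{x \<in> P. L j x \<le> e}. h e x) = (\<integral>y. q e y \<partial>lborel)"
    using eventually_at_right_less[of "0::real"] by eventually_elim (rule resc)
  ultimately show ?thesis
    unfolding face_mean_def set_lebesgue_integral_def using tendsto_cong by force
qed

end

section \<open>The divergence theorem on a simple polytope\<close>

lemma integral_lborel_translate:
  fixes g :: "'a::euclidean_space \<Rightarrow> real"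
  assumes [measurable]: "g \<in> borel_measurable borel"
  shows "(\<integral>x. g (x + a) \<partial>lborel) = (\<integral>x. g x \<partial>lborel)"
proof -
  have "(\<integral>x. g x \<partial>lborel) = (\<integral>x. g x \<partial>distr lborel borel ((+) a))"
    by (simp add: lborel_distr_plus)
  also have "\<dots> = (\<integral>x. g (a + x) \<partial>lborel)"
    by (subst integral_distr) auto
  finally show ?thesis by (simp add: add.commute)
qed

text \<open>The difference quotients have integral zero by translation invariance; no Fubini is needed.\<close>

lemma integral_directional_derivative_eq_0:
  fixes g D :: "'a::euclidean_space \<Rightarrow> real"
  assumes g [measurable]: "g \<in> borel_measurable borel" and D: "D \<in> borel_measurable borel"
    and supp: "\<And>x. R < norm x \<Longrightarrow> g x = 0" and bnd: "\<And>x. \<bar>g x\<bar> \<le> M"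
    and lip: "\<And>x t. \<bar>g (x + t *\<^sub>R e) - g x\<bar> \<le> C * \<bar>t\<bar>"
    and deriv: "AE x in lborel. ((\<lambda>t. g (x + t *\<^sub>R e)) has_real_derivative D x) (at 0)"
  shows "(\<integral>x. D x \<partial>lborel) = 0"
proof -
  define q where "q t x = (g (x + t *\<^sub>R e) - g x) / t" for t x
  have "M \<ge> 0" using bnd[of 0] by linarith
  have int: "integrable lborel g"
    by (rule Bochner_Integration.integrable_bound[OF integrable_const_indicator_cball[of M 0 R]])
      (use bnd supp \<open>M \<ge> 0\<close> in \<open>auto simp: indicator_def not_le\<close>)
  have int': "integrable lborel (\<lambda>x. g (x + a))" for a
  proof (rule Bochner_Integration.integrable_bound[OF integrable_const_indicator_cball[of M "- a" R]])
    show "AE x in lborel. norm (g (x + a)) \<le> norm (M * indicator (cball (- a) R) x)"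
      using bnd supp \<open>M \<ge> 0\<close> by (auto simp: indicator_def not_le dist_norm norm_minus_commute add.commute)
  qed simp
  have zero: "(\<integral>x. q t x \<partial>lborel) = 0" for t
    unfolding q_def using int int' by (simp add: integral_lborel_translate[OF g])
  have "((\<lambda>t. \<integral>x. q t x \<partial>lborel) \<longlongrightarrow> (\<integral>x. D x \<partial>lborel)) (at_right 0)"
  proof (rule dominated_convergence_at_right_0)
    show "D \<in> borel_measurable lborel" using D by simp
    show "q t \<in> borel_measurable lborel" for t unfolding q_def by measurable
    show "integrable lborel (\<lambda>x. C * indicator (cball 0 (R + norm e)) x :: real)"
      by (rule integrable_const_indicator_cball)
    show "AE x in lborel. ((\<lambda>t. q t x) \<longlongrightarrow> D x) (at_right 0)"
      using deriv
    proof eventually_elim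
      case (elim x)
      then have "((\<lambda>t. q t x) \<longlongrightarrow> D x) (at 0)"
        by (simp add: DERIV_def q_def)
      then show ?case by (simp add: filterlim_at_split)
    qed
    \<comment> \<open>Inside the enlarged ball the Lipschitz bound applies; outside it both points
      of the quotient are beyond radius \<open>R\<close>, because \<open>t < 1\<close>.\<close>
    show "\<bar>q t x\<bar> \<le> C * indicator (cball 0 (R + norm e)) x" if t: "0 < t" "t < 1" for t x
    proof (cases "norm x \<le> R + norm e")
      case True
      then show ?thesis using lip[of x t] t by (simp add: q_def abs_divide divide_le_eq)
    next
      case False
      have "norm x \<le> norm (x + t *\<^sub>R e) + norm (t *\<^sub>R e)"
        by (metis add_diff_cancel_right' norm_triangle_sub norm_minus_commute norm_triangle_ineq4)
      moreover have "norm (t *\<^sub>R e) \<le> norm e" using t by (simp add: mult_left_le_one_le)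
      ultimately have "R < norm (x + t *\<^sub>R e)" using False by linarith
      moreover have "R < norm x" using False norm_ge_zero[of e] by linarith
      ultimately show ?thesis using False supp by (simp add: q_def)
    qed
  qed
  then have "((\<lambda>t. 0) \<longlongrightarrow> (\<integral>x. D x \<partial>lborel)) (at_right (0::real))" by (simp add: zero)
  then show ?thesis by (simp add: tendsto_const_iff)
qed

lemma set_lebesgue_integral_sum:
  fixes f :: "'i \<Rightarrow> 'a \<Rightarrow> real"
  assumes "\<And>i. i \<in> I \<Longrightarrow> set_integrable M A (f i)"
  shows "(LINT x:A|M. (\<Sum>i\<in>I. f i x)) = (\<Sum>i\<in>I. LINT x:A|M. f i x)"
  using assms unfolding set_lebesgue_integral_def set_integrable_def
  by (simp add: scaleR_sum_right sum_distrib_left)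

text \<open>Piecewise linear and not smooth: away from two points its derivative is an indicator
  function. Differentiating the cutoff therefore produces exact slab averages, whose limits are
  facet integrals.\<close>

definition ramp :: "real \<Rightarrow> real" where "ramp t = min 1 (max 0 t)"

lemma ramp_bounds: "0 \<le> ramp t" "ramp t \<le> 1"
  by (auto simp: ramp_def)

lemma ramp_eq_1: "0 < e \<Longrightarrow> e < t \<Longrightarrow> ramp (t / e) = 1"
  by (simp add: ramp_def min_def)

lemma ramp_lipschitz: "\<bar>ramp s - ramp t\<bar> \<le> \<bar>s - t\<bar>"
  by (auto simp: ramp_def min_def max_def)

lemma continuous_on_ramp [continuous_intros]: "continuous_on A g \<Longrightarrow> continuous_on A (\<lambda>x. ramp (g x))"
  unfolding ramp_def by (intro continuous_intros)

lemma ramp_measurable [measurable]: "ramp \<in> borel_measurable borel"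
  by (intro borel_measurable_continuous_onI continuous_intros)

lemma ramp_has_derivative:
  assumes "t \<noteq> 0" "t \<noteq> 1"
  shows "(ramp has_real_derivative indicator {0..1} t) (at t)"
proof -
  consider "t < 0" | "0 < t" "t < 1" | "1 < t" using assms by linarith
  then show ?thesis
  proof cases
    case 1
    have "(ramp has_real_derivative 0) (at t)"
      by (rule has_field_derivative_transform_within_open[of "\<lambda>_. 0" _ _ "{..<0}"])
        (use 1 in \<open>auto simp: ramp_def\<close>)
    then show ?thesis using 1 by simp
  next
    case 2
    have "(ramp has_real_derivative 1) (at t)"
      by (rule has_field_derivative_transform_within_open[of "\<lambda>s. s" _ _ "{0<..<1}"])
        (use 2 in \<open>auto simp: ramp_def\<close>)
    then show ?thesis using 2 by simp
  next
    case 3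
    have "(ramp has_real_derivative 0) (at t)"
      by (rule has_field_derivative_transform_within_open[of "\<lambda>_. 1" _ _ "{1<..}"])
        (use 3 in \<open>auto simp: ramp_def\<close>)
    then show ?thesis using 3 by simp
  qed
qed

context simple_polytope
begin

section \<open>Continuous functions on the polytope and their facet integrals\<close>

lemma measurable_P_continuous:
  fixes g :: "real^'n \<Rightarrow> real"
  assumes "continuous_on P g"
  shows "(\<lambda>x. indicator P x * g x) \<in> borel_measurable borel"
  using borel_measurable_continuous_on_indicator[OF P_sets assms] by simp

lemma bounded_P_continuous:
  fixes g :: "real^'n \<Rightarrow> real"
  assumes "continuous_on P g"
  obtains M where "0 \<le> M" "\<And>x. x \<in> P \<Longrightarrow> \<bar>g x\<bar> \<le> M"
proof -
  have "bounded (g ` P)"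
    using compact_continuous_image[OF assms compact_P] compact_imp_bounded by blast
  then obtain M where "\<And>x. x \<in> P \<Longrightarrow> \<bar>g x\<bar> \<le> M" by (auto simp: bounded_iff)
  then show ?thesis using that[of "max 0 M"] by (metis max.cobounded1 max.coboundedI2)
qed

lemma set_integrable_P:
  fixes g :: "real^'n \<Rightarrow> real"
  assumes "continuous_on P g"
  shows "set_integrable lborel P g"
  unfolding set_integrable_def by (rule borel_integrable_compact[OF compact_P assms])

lemma set_integrable_fcyl:
  fixes g :: "real^'n \<Rightarrow> real"
  assumes j: "j < d" and g: "continuous_on P g"
  shows "set_integrable lborel (fcyl j) (\<lambda>y. g (fproj j y))"
proof -
  obtain M where M: "0 \<le> M" "\<And>x. x \<in> P \<Longrightarrow> \<bar>g x\<bar> \<le> M" using bounded_P_continuous[OF g] by blast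
  obtain R where R: "\<And>y. y \<in> fcyl j \<Longrightarrow> norm y \<le> R" using bounded_fcyl[OF j] by (auto simp: bounded_iff)
  note measurable_P_continuous[OF g, measurable]
  have "(\<lambda>y. indicator (fcyl j) y * (indicator P (fproj j y) * g (fproj j y))) \<in> borel_measurable borel"
    by measurable
  also have "(\<lambda>y. indicator (fcyl j) y * (indicator P (fproj j y) * g (fproj j y))) =
      (\<lambda>y. indicator (fcyl j) y * g (fproj j y))"
    using fproj_in_P[OF j] by (auto simp: indicator_def)
  finally show ?thesis
    unfolding set_integrable_def
    by (intro Bochner_Integration.integrable_bound[OF integrable_const_indicator_cball[of M 0 R]])
      (use M R fproj_in_P[OF j] in \<open>auto simp: indicator_def\<close>)
qed

lemma eventually_P_near_facet:
  assumes j: "j < d" and \<xi>: "L j \<xi> = 0" "\<And>k. k < d \<Longrightarrow> k \<noteq> j \<Longrightarrow> 0 < L k \<xi>" and \<tau>: "0 < \<tau>"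
  shows "\<forall>\<^sub>F e in at_right 0. \<xi> + (e * \<tau>) *\<^sub>R fvec j \<in> P"
proof -
  have "((\<lambda>e. L k (\<xi> + (e * \<tau>) *\<^sub>R fvec j)) \<longlongrightarrow> L k \<xi>) (at_right 0)" for k
    by (rule tendsto_eq_intros refl | simp)+
  then have "\<forall>\<^sub>F e in at_right 0. \<forall>k\<in>{..<d} - {j}. 0 < L k (\<xi> + (e * \<tau>) *\<^sub>R fvec j)"
    using \<xi>(2) order_tendstoD(1) by (fastforce simp: eventually_ball_finite_distrib)
  then show ?thesis
    using eventually_at_right_less[of "0::real"]
  proof eventually_elim
    case (elim e)
    have "L j (\<xi> + (e * \<tau>) *\<^sub>R fvec j) \<ge> 0"
      using elim \<tau> by (simp add: L_add \<xi>(1) nrm_fvec[OF j])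
    then show ?case unfolding polytope_of_def using elim(1) by (force intro: less_imp_le)
  qed
qed

lemma tendsto_near_facet:
  fixes g :: "real^'n \<Rightarrow> real"
  assumes j: "j < d" and \<xi>: "\<xi> \<in> P" "L j \<xi> = 0" "\<And>k. k < d \<Longrightarrow> k \<noteq> j \<Longrightarrow> 0 < L k \<xi>" and \<tau>: "0 < \<tau>"
    and g: "continuous_on P g"
  shows "((\<lambda>e. g (\<xi> + (e * \<tau>) *\<^sub>R fvec j)) \<longlongrightarrow> g \<xi>) (at_right 0)"
proof (rule continuous_on_tendsto_compose[OF g _ \<xi>(1) eventually_P_near_facet[OF j \<xi>(2,3) \<tau>]])
  show "((\<lambda>e. \<xi> + (e * \<tau>) *\<^sub>R fvec j) \<longlongrightarrow> \<xi>) (at_right 0)"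
    by (rule tendsto_eq_intros refl | simp)+
qed

text \<open>\<open>Lim\<close> has an unspecified value when there is no limit. For continuous
  integrands the limit exists, and this lemma replaces it by an ordinary integral.\<close>

lemma facet_integral_eq:
  assumes j: "j < d" and g: "continuous_on P g"
  shows "facet_integral d nrm c j g = face_mean j g"
proof -
  obtain M where M: "\<And>x. x \<in> P \<Longrightarrow> \<bar>g x\<bar> \<le> M" using bounded_P_continuous[OF g] by blast
  have "((\<lambda>e. (1 / e) * (LBINT x:{x \<in> P. L j x \<le> e}. g x)) \<longlongrightarrow> face_mean j g) (at_right 0)"
    by (rule facet_limit[OF j]) (use measurable_P_continuous[OF g] M tendsto_near_facet[OF j _ _ _ _ g] in auto)
  then show ?thesis
    unfolding facet_integral_def by (intro tendsto_Lim) (auto simp: trivial_limit_at_right_real)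
qed

lemma boundary_integral_eq:
  assumes "continuous_on P g"
  shows "boundary_integral d nrm c g = (\<Sum>j<d. face_mean j g)"
  unfolding boundary_integral_def by (rule sum.cong) (auto simp: facet_integral_eq assms)

text \<open>The cylinder projects only to facet points off all other facets. There the boundary is
  locally a hyperplane, so boundary identities can be derived by differentiating along the
  facet.\<close>

lemma face_mean_cong:
  assumes j: "j < d"
    and "\<And>\<xi>. \<xi> \<in> P \<Longrightarrow> L j \<xi> = 0 \<Longrightarrow> (\<And>k. k < d \<Longrightarrow> k \<noteq> j \<Longrightarrow> 0 < L k \<xi>) \<Longrightarrow> g \<xi> = h \<xi>"
  shows "face_mean j g = face_mean j h"
  unfolding face_mean_def
proof (rule set_lebesgue_integral_cong, simp, intro allI impI)
  fix y assume y: "y \<in> fcyl j"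
  then show "g (fproj j y) = h (fproj j y)"
    using fproj_in_P[OF j y] L_fproj[OF j] by (intro assms(2)) (auto simp: fcyl_def)
qed

lemma face_mean_mono:
  assumes j: "j < d" and g: "continuous_on P g" and h: "continuous_on P h"
    and "\<And>\<xi>. \<xi> \<in> P \<Longrightarrow> L j \<xi> = 0 \<Longrightarrow> g \<xi> \<le> h \<xi>"
  shows "face_mean j g \<le> face_mean j h"
  unfolding face_mean_def
  by (rule set_integral_mono[OF set_integrable_fcyl[OF j g] set_integrable_fcyl[OF j h]])
    (use assms(4) fproj_in_P[OF j] L_fproj[OF j] in blast)

lemma face_mean_cmult: "face_mean j (\<lambda>x. a * g x) = a * face_mean j g"
  unfolding face_mean_def by simp

text \<open>The divergence theorem: integrate against the cutoff \<open>\<Prod>j. ramp (L j / e)\<close>, whose gradient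
  concentrates on the facets as \<open>e\<close> tends to 0.\<close>

definition cutoff :: "real \<Rightarrow> real^'n \<Rightarrow> real" where
  "cutoff e x = (\<Prod>j<d. ramp (L j x / e))"

lemma cutoff_bounds: "0 \<le> cutoff e x" "cutoff e x \<le> 1"
  unfolding cutoff_def by (auto intro!: prod_nonneg prod_le_1 simp: ramp_bounds)

lemma cutoff_outside:
  assumes "0 < e" "x \<notin> P"
  shows "cutoff e x = 0"
proof -
  obtain j where "j < d" "L j x < 0" using assms(2) by (auto simp: polytope_of_def not_le)
  then have "ramp (L j x / e) = 0" using assms(1) by (simp add: ramp_def divide_neg_pos less_imp_le)
  then show ?thesis unfolding cutoff_def using \<open>j < d\<close> by (intro prod_zero) auto
qed

lemma cutoff_lipschitz:
  assumes "0 < e"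
  shows "\<bar>cutoff e (x + v) - cutoff e x\<bar> \<le> (\<Sum>j<d. \<bar>nrm j \<bullet> v\<bar> / e)"
proof -
  have "\<bar>cutoff e (x + v) - cutoff e x\<bar> \<le> (\<Sum>j<d. \<bar>ramp (L j (x + v) / e) - ramp (L j x / e)\<bar>)"
    using norm_prod_diff[of "{..<d}" "\<lambda>j. ramp (L j (x + v) / e)" "\<lambda>j. ramp (L j x / e)"]
    by (simp add: cutoff_def ramp_bounds)
  also have "\<dots> \<le> (\<Sum>j<d. \<bar>nrm j \<bullet> v\<bar> / e)"
  proof (rule sum_mono)
    fix j
    show "\<bar>ramp (L j (x + v) / e) - ramp (L j x / e)\<bar> \<le> \<bar>nrm j \<bullet> v\<bar> / e"
      using ramp_lipschitz[of "L j (x + v) / e" "L j x / e"] assms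
      by (simp add: L_add add_divide_distrib)
  qed
  finally show ?thesis .
qed

text \<open>The factor that the product rule leaves when the \<open>j\<close>-th ramp is
  differentiated.\<close>

definition cutoff_rest :: "real \<Rightarrow> nat \<Rightarrow> real^'n \<Rightarrow> real" where
  "cutoff_rest e j x = (\<Prod>k\<in>{..<d} - {j}. ramp (L k x / e))"

lemma cutoff_rest_bounds: "0 \<le> cutoff_rest e j x" "cutoff_rest e j x \<le> 1"
  unfolding cutoff_rest_def by (auto intro!: prod_nonneg prod_le_1 simp: ramp_bounds)

lemma continuous_on_cutoff: "0 < e \<Longrightarrow> continuous_on A (cutoff e)"
  unfolding cutoff_def by (intro continuous_intros) auto

lemma continuous_on_cutoff_rest: "0 < e \<Longrightarrow> continuous_on A (cutoff_rest e j)"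
  unfolding cutoff_rest_def by (intro continuous_intros) auto

lemma cutoff_has_derivative:
  assumes e: "0 < e" and x: "\<And>j. j < d \<Longrightarrow> L j x \<noteq> 0" "\<And>j. j < d \<Longrightarrow> L j x \<noteq> e"
  shows "((\<lambda>t. cutoff e (x + t *\<^sub>R v)) has_real_derivative
    (\<Sum>j<d. (nrm j \<bullet> v) / e * indicator {0..e} (L j x) * cutoff_rest e j x)) (at 0)"
proof -
  have "((\<lambda>t. ramp (L j (x + t *\<^sub>R v) / e)) has_real_derivative
      (nrm j \<bullet> v) / e * indicator {0..e} (L j x)) (at 0)" if j: "j < d" for j
  proof -
    have lin: "((\<lambda>t. L j (x + t *\<^sub>R v) / e) has_real_derivative (nrm j \<bullet> v) / e) (at 0)"
      using e by (auto simp: L_add intro!: derivative_eq_intros)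
    have "(ramp has_real_derivative indicator {0..1} (L j x / e)) (at (L j (x + 0 *\<^sub>R v) / e))"
      using ramp_has_derivative[of "L j x / e"] x[OF j] e by (simp add: divide_eq_1_iff)
    from DERIV_chain2[OF this lin] show ?thesis
      using e by (auto simp: indicator_def divide_le_eq zero_le_divide_iff split: if_splits)
  qed
  from has_field_derivative_prod[of "{..<d}", OF this] show ?thesis
    by (simp add: cutoff_def cutoff_rest_def)
qed

lemma interior_P_iff: "x \<in> interior P \<longleftrightarrow> (\<forall>j<d. 0 < L j x)"
  by (simp add: interior_P)

lemma interior_PI:
  assumes "x \<in> P" "\<And>j. j < d \<Longrightarrow> L j x \<noteq> 0"
  shows "x \<in> interior P"
  unfolding interior_P_iff
proof (intro allI impI)
  fix j assume j: "j < d"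
  have "0 \<le> L j x" using assms(1) j by (simp add: polytope_of_def)
  then show "0 < L j x" using assms(2)[OF j] by linarith
qed

lemma AE_L_avoids:
  assumes "finite A"
  shows "AE x in lborel. \<forall>j<d. L j x \<notin> A"
proof -
  have "AE x in lborel. \<forall>j\<in>{..<d}. \<forall>s\<in>A. L j x \<noteq> s"
    using assms AE_L_nonzero by (auto simp: AE_finite_all)
  then show ?thesis by eventually_elim auto
qed

lemma AE_P_interior: "AE x in lborel. x \<in> P \<longrightarrow> x \<in> interior P"
proof -
  have "AE x in lborel. \<forall>j<d. L j x \<notin> {0}" by (rule AE_L_avoids) simp
  then show ?thesis
    by eventually_elim (auto intro: interior_PI)
qed

text \<open>The cutoff vanishes outside \<open>P\<close>, so \<open>Y * cutoff e\<close> extended by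
  zero is Lipschitz with bounded support, and its directional derivative integrates to 0. The two
  summands are the two halves of the product rule.\<close>

lemma integral_partial_cutoff:
  assumes U: "open U" "P \<subseteq> U" and Y: "Ck_on (Suc 0) U Y" and e: "0 < e"
  shows "(LBINT x:P. partial i Y x * cutoff e x) +
    (\<Sum>j<d. (1 / e) * (LBINT x:{x \<in> P. L j x \<le> e}. nrm j $ i * Y x * cutoff_rest e j x)) = 0"
proof -
  define v :: "real^'n" where "v = axis i 1"
  have nv: "nrm j \<bullet> v = nrm j $ i" for j by (simp add: v_def inner_axis)
  define g where "g x = indicator P x * (Y x * cutoff e x)" for x
  define D1 where "D1 x = indicator P x *\<^sub>R (partial i Y x * cutoff e x)" for x
  define D2 where "D2 j x = indicator {x \<in> P. L j x \<le> e} x *\<^sub>R (nrm j $ i * Y x * cutoff_rest e j x)" for j x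
  define D where "D x = D1 x + (\<Sum>j<d. (1 / e) * D2 j x)" for x
  have contY: "continuous_on P Y" and contY': "continuous_on P (partial i Y)"
    using Y U(2) by (auto intro: continuous_on_subset)
  obtain M where M: "0 \<le> M" "\<And>x. x \<in> P \<Longrightarrow> \<bar>Y x\<bar> \<le> M"
    using bounded_P_continuous[OF contY] by blast
  obtain M' where M': "0 \<le> M'" "\<And>x. x \<in> P \<Longrightarrow> \<bar>partial i Y x\<bar> \<le> M'"
    using bounded_P_continuous[OF contY'] by blast
  obtain R where R: "\<And>x. x \<in> P \<Longrightarrow> norm x \<le> R"
    using bounded_P by (auto simp: bounded_iff)
  have int1: "integrable lborel D1"
    unfolding D1_def using e
    by (intro borel_integrable_compact[OF compact_P] continuous_intros contY' continuous_on_cutoff)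
  have int2: "integrable lborel (D2 j)" for j
  proof -
    have "closed {x. L j x \<le> e}" by (intro closed_Collect_le continuous_intros)
    then have "compact {x \<in> P. L j x \<le> e}"
    proof -
      have "{x \<in> P. L j x \<le> e} = P \<inter> {x. L j x \<le> e}" by blast
      then show ?thesis using compact_Int_closed[OF compact_P \<open>closed {x. L j x \<le> e}\<close>] by simp
    qed
    then show ?thesis
      unfolding D2_def[abs_def] using e
      by (intro borel_integrable_compact continuous_intros continuous_on_cutoff_rest
          continuous_on_subset[OF contY]) auto
  qed
  have "(\<integral>x. D x \<partial>lborel) = 0"
  proof (rule integral_directional_derivative_eq_0[where g=g and e=v and R=R and M=M])
    show "g \<in> borel_measurable borel"
      unfolding g_def[abs_def] using e
      by (intro measurable_P_continuous continuous_intros contY continuous_on_cutoff)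
    show "D \<in> borel_measurable borel"
      using borel_measurable_integrable[OF int1] borel_measurable_integrable[OF int2]
      unfolding D_def[abs_def] by simp
    show "g x = 0" if "R < norm x" for x
      using R that by (force simp: g_def indicator_def)
    show "\<bar>g x\<bar> \<le> M" for x
    proof (cases "x \<in> P")
      case True
      have "\<bar>Y x * cutoff e x\<bar> \<le> M * 1"
        unfolding abs_mult using M True cutoff_bounds[of e x] by (intro mult_mono) auto
      then show ?thesis using True by (simp add: g_def)
    qed (use M in \<open>simp add: g_def\<close>)
    define K where "K = (\<Sum>j<d. \<bar>nrm j $ i\<bar> / e)"
    have "0 \<le> K" using e by (auto simp: K_def intro!: sum_nonneg)
    have cut: "\<bar>cutoff e (x + t *\<^sub>R v) - cutoff e x\<bar> \<le> K * \<bar>t\<bar>" for x t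
      using cutoff_lipschitz[OF e, of x "t *\<^sub>R v"]
      by (simp add: K_def nv sum_distrib_left abs_mult mult_ac)
    show "\<bar>g (x + t *\<^sub>R v) - g x\<bar> \<le> (M' + M * K) * \<bar>t\<bar>" for x t
    proof -
      let ?y = "x + t *\<^sub>R v"
      have nn: "0 \<le> M' * \<bar>t\<bar>" using M' by simp
      \<comment> \<open>If one point is outside \<open>P\<close>, the cutoff is 0 there and the
        increment is that of the cutoff alone. Only the first case estimates \<open>Y\<close> along
        a segment, which lies in \<open>P\<close> by convexity.\<close>
      consider "x \<in> P" "?y \<in> P" | "x \<notin> P" "?y \<notin> P" | "x \<in> P" "?y \<notin> P" | "x \<notin> P" "?y \<in> P" by blast
      then show ?thesis
      proof cases
        case 1
        have seg: "x + s *\<^sub>R v \<in> P" if s: "s \<in> closed_segment 0 t" for s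
        proof -
          obtain u where u: "0 \<le> u" "u \<le> 1" "s = u * t"
            using s by (auto simp: in_segment)
          then have "x + s *\<^sub>R v = (1 - u) *\<^sub>R x + u *\<^sub>R ?y" by (simp add: algebra_simps)
          then have "x + s *\<^sub>R v \<in> closed_segment x ?y" using u unfolding in_segment by blast
          then show ?thesis using convex_contains_segment[of P] convex_P 1 by blast
        qed
        have "norm (Y (x + t *\<^sub>R v) - Y (x + 0 *\<^sub>R v)) \<le> M' * norm (t - 0)"
        proof (rule field_differentiable_bound[where S="closed_segment 0 t"])
          show "((\<lambda>s. Y (x + s *\<^sub>R v)) has_field_derivative partial i Y (x + s *\<^sub>R v)) (at s within closed_segment 0 t)"
            if "s \<in> closed_segment 0 t" for s
            unfolding v_def
            by (rule has_field_derivative_at_within, rule Ck_on_has_partial_line[OF Y])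
              (use seg[OF that] U in \<open>auto simp: v_def\<close>)
        qed (use seg M' in auto)
        then have Ylip: "\<bar>Y ?y - Y x\<bar> \<le> M' * \<bar>t\<bar>" by simp
        have "g ?y - g x = (Y ?y - Y x) * cutoff e ?y + Y x * (cutoff e ?y - cutoff e x)"
          using 1 by (simp add: g_def algebra_simps)
        moreover have "\<bar>(Y ?y - Y x) * cutoff e ?y\<bar> \<le> (M' * \<bar>t\<bar>) * 1"
          unfolding abs_mult using Ylip cutoff_bounds[of e ?y] nn by (intro mult_mono) auto
        moreover have "\<bar>Y x * (cutoff e ?y - cutoff e x)\<bar> \<le> M * (K * \<bar>t\<bar>)"
          unfolding abs_mult using 1 M cut by (intro mult_mono) auto
        ultimately show ?thesis by (simp add: algebra_simps)
      next
        case 2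
        then show ?thesis using M M' \<open>0 \<le> K\<close> by (simp add: g_def)
      next
        case 3
        then have "\<bar>g ?y - g x\<bar> = \<bar>Y x * (cutoff e ?y - cutoff e x)\<bar>"
          using cutoff_outside[OF e] by (simp add: g_def)
        also have "\<dots> \<le> M * (K * \<bar>t\<bar>)"
          unfolding abs_mult using 3 M cut by (intro mult_mono) auto
        finally show ?thesis using nn by (simp add: algebra_simps)
      next
        case 4
        then have "\<bar>g ?y - g x\<bar> = \<bar>Y ?y * (cutoff e ?y - cutoff e x)\<bar>"
          using cutoff_outside[OF e] by (simp add: g_def)
        also have "\<dots> \<le> M * (K * \<bar>t\<bar>)"
          unfolding abs_mult using 4 M cut by (intro mult_mono) auto
        finally show ?thesis using nn by (simp add: algebra_simps)
      qed
    qed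
    \<comment> \<open>The values 0 and \<open>e\<close> of the \<open>L j\<close> are the kinks of
      the ramps; excluding 0 also discards the boundary of \<open>P\<close>, where the function is
      pieced together.\<close>
    show "AE x in lborel. ((\<lambda>t. g (x + t *\<^sub>R v)) has_real_derivative D x) (at 0)"
      using AE_L_avoids[of "{0, e}", simplified]
    proof eventually_elim
      case (elim x)
      show ?case
      proof (cases "x \<in> P")
        case True
        then have int: "x \<in> interior P"
          using elim by (auto intro: interior_PI)
        have ev: "\<forall>\<^sub>F t in nhds 0. g (x + t *\<^sub>R v) = Y (x + t *\<^sub>R v) * cutoff e (x + t *\<^sub>R v)"
          using eventually_line_in_open[OF open_interior, of x 0 v P] int
          by (auto elim!: eventually_mono simp: g_def dest: subsetD[OF interior_subset])
        have "((\<lambda>t. Y (x + t *\<^sub>R v) * cutoff e (x + t *\<^sub>R v)) has_real_derivative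
            partial i Y x * cutoff e (x + 0 *\<^sub>R v) +
            (\<Sum>j<d. (nrm j \<bullet> v) / e * indicator {0..e} (L j x) * cutoff_rest e j x) * Y (x + 0 *\<^sub>R v)) (at 0)"
          unfolding v_def using elim True U e
          by (intro DERIV_mult Ck_on_has_partial[OF Y] cutoff_has_derivative) auto
        also have "partial i Y x * cutoff e (x + 0 *\<^sub>R v) +
            (\<Sum>j<d. (nrm j \<bullet> v) / e * indicator {0..e} (L j x) * cutoff_rest e j x) * Y (x + 0 *\<^sub>R v) = D x"
        proof -
          have "(nrm j \<bullet> v) / e * indicator {0..e} (L j x) * cutoff_rest e j x * Y x = (1 / e) * D2 j x"
            if "j < d" for j
            using True that by (auto simp: D2_def nv indicator_def polytope_of_def)
          then have "(\<Sum>j<d. (nrm j \<bullet> v) / e * indicator {0..e} (L j x) * cutoff_rest e j x) * Y x =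
              (\<Sum>j<d. (1 / e) * D2 j x)"
            unfolding sum_distrib_right by (intro sum.cong refl) blast
          then show ?thesis
            using True by (simp add: D_def D1_def)
        qed
        finally show ?thesis
          using DERIV_cong_ev[OF refl ev refl] by simp
      next
        case False
        have ev: "\<forall>\<^sub>F t in nhds 0. g (x + t *\<^sub>R v) = 0"
          using eventually_line_in_open[of "- P" x 0 v] False closed_P
          by (auto elim!: eventually_mono simp: g_def open_Compl)
        have "D x = 0" using False by (simp add: D_def D1_def D2_def)
        then show ?thesis using DERIV_cong_ev[OF refl ev refl] by simp
      qed
    qed
  qed
  then show ?thesis
    unfolding D_def using int1 int2
    by (simp add: set_lebesgue_integral_def D1_def[abs_def] D2_def[abs_def])
qed

lemma tendsto_cutoff:
  assumes "x \<in> interior P"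
  shows "((\<lambda>e. cutoff e x) \<longlongrightarrow> 1) (at_right 0)"
proof -
  have "\<forall>\<^sub>F e in at_right 0. \<forall>j\<in>{..<d}. e < L j x"
    using assms eventually_at_right_less
    by (intro eventually_ball_finite) (auto simp: interior_P_iff intro!: eventually_at_rightI[of 0 "L _ x"])
  then have "\<forall>\<^sub>F e in at_right 0. cutoff e x = 1"
    using eventually_at_right_less[of "0::real"]
    by eventually_elim (auto simp: cutoff_def ramp_eq_1 intro!: prod.neutral)
  then show ?thesis by (rule tendsto_eventually)
qed

lemma tendsto_cutoff_rest:
  assumes j: "j < d" and \<xi>: "\<xi> \<in> P" "L j \<xi> = 0" "\<And>k. k < d \<Longrightarrow> k \<noteq> j \<Longrightarrow> 0 < L k \<xi>" and \<tau>: "0 < \<tau>"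
  shows "((\<lambda>e. cutoff_rest e j (\<xi> + (e * \<tau>) *\<^sub>R fvec j)) \<longlongrightarrow> 1) (at_right 0)"
proof -
  have "((\<lambda>e. L k (\<xi> + (e * \<tau>) *\<^sub>R fvec j) - e) \<longlongrightarrow> L k \<xi>) (at_right 0)" for k
    by (rule tendsto_eq_intros refl | simp)+
  then have "\<forall>\<^sub>F e in at_right 0. \<forall>k\<in>{..<d} - {j}. 0 < L k (\<xi> + (e * \<tau>) *\<^sub>R fvec j) - e"
    using \<xi>(3) order_tendstoD(1) by (fastforce simp: eventually_ball_finite_distrib)
  then have "\<forall>\<^sub>F e in at_right 0. cutoff_rest e j (\<xi> + (e * \<tau>) *\<^sub>R fvec j) = 1"
    using eventually_at_right_less[of "0::real"]
    by eventually_elim (auto simp: cutoff_rest_def ramp_eq_1 intro!: prod.neutral)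
  then show ?thesis by (rule tendsto_eventually)
qed

text \<open>The minus sign is there because the \<open>nrm j\<close> point inward. They are not
  normalised; their lengths are compensated by \<open>d\<sigma>\<close>, which is surface measure
  divided by \<open>norm (nrm j)\<close>.\<close>

theorem divergence_theorem:
  assumes U: "open U" "P \<subseteq> U" and X: "\<And>i. Ck_on (Suc 0) U (X i)"
  shows "(LBINT x:P. (\<Sum>i\<in>UNIV. partial i (X i) x)) =
    - (\<Sum>j<d. face_mean j (\<lambda>x. \<Sum>i\<in>UNIV. nrm j $ i * X i x))"
proof -
  define divX where "divX x = (\<Sum>i\<in>UNIV. partial i (X i) x)" for x
  define N where "N j x = (\<Sum>i\<in>UNIV. nrm j $ i * X i x)" for j x
  have contX: "continuous_on P (X i)" and contX': "continuous_on P (partial i (X i))" for i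
    using X U(2) by (auto intro: continuous_on_subset)
  have contD: "continuous_on P divX"
    unfolding divX_def by (intro continuous_intros contX')
  have contN: "continuous_on P (N j)" for j
    unfolding N_def by (intro continuous_intros contX)
  obtain M where M: "0 \<le> M" "\<And>x. x \<in> P \<Longrightarrow> \<bar>divX x\<bar> \<le> M"
    using bounded_P_continuous[OF contD] by blast
  obtain R where R: "\<And>x. x \<in> P \<Longrightarrow> norm x \<le> R"
    using bounded_P by (auto simp: bounded_iff)
  let ?A = "\<lambda>e. LBINT x:P. divX x * cutoff e x"
  let ?B = "\<lambda>j e. (1 / e) * (LBINT x:{x \<in> P. L j x \<le> e}. N j x * cutoff_rest e j x)"
  have limA: "(?A \<longlongrightarrow> (LBINT x:P. divX x)) (at_right 0)"
    unfolding set_lebesgue_integral_def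
  proof (rule dominated_convergence_at_right_0[where w="\<lambda>x. M * indicator (cball 0 R) x"])
    show "(\<lambda>x. indicator P x *\<^sub>R divX x) \<in> borel_measurable lborel"
      using measurable_P_continuous[OF contD] by simp
    show "(\<lambda>x. indicator P x *\<^sub>R (divX x * cutoff e x)) \<in> borel_measurable lborel" if "0 < e" for e
      using measurable_P_continuous[OF continuous_on_mult[OF contD continuous_on_cutoff[OF that]]] by simp
    show "AE x in lborel. ((\<lambda>e. indicator P x *\<^sub>R (divX x * cutoff e x)) \<longlongrightarrow> indicator P x *\<^sub>R divX x) (at_right 0)"
      using AE_P_interior
    proof eventually_elim
      case (elim x)
      show ?case
      proof (cases "x \<in> P")
        case True
        from tendsto_mult_left[OF tendsto_cutoff, of x "divX x"] show ?thesis using elim True by simp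
      qed simp
    qed
    show "\<bar>indicator P x *\<^sub>R (divX x * cutoff e x)\<bar> \<le> M * indicator (cball 0 R) x" if "0 < e" "e < 1" for e x
    proof (cases "x \<in> P")
      case True
      have "\<bar>divX x * cutoff e x\<bar> \<le> M * 1"
        unfolding abs_mult using M True cutoff_bounds[of e x] by (intro mult_mono) auto
      then show ?thesis using True R by (simp add: indicator_def)
    qed (use M in simp)
  qed (rule integrable_const_indicator_cball)
  have limB: "(?B j \<longlongrightarrow> face_mean j (N j)) (at_right 0)" if j: "j < d" for j
  proof -
    obtain M where M: "0 \<le> M" "\<And>x. x \<in> P \<Longrightarrow> \<bar>N j x\<bar> \<le> M"
      using bounded_P_continuous[OF contN] by blast
    show ?thesis
    proof (rule facet_limit[OF j])
      show "(\<lambda>x. indicator P x * (N j x * cutoff_rest e j x)) \<in> borel_measurable borel" if "0 < e" for e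
        by (rule measurable_P_continuous[OF continuous_on_mult[OF contN continuous_on_cutoff_rest[OF that]]])
      show "(\<lambda>x. indicator P x * N j x) \<in> borel_measurable borel"
        by (rule measurable_P_continuous[OF contN])
      show "\<bar>N j x * cutoff_rest e j x\<bar> \<le> M" if "x \<in> P" for e x
      proof -
        have "\<bar>N j x * cutoff_rest e j x\<bar> \<le> M * 1"
          unfolding abs_mult using M that cutoff_rest_bounds[of e j x] by (intro mult_mono) auto
        then show ?thesis by simp
      qed
      show "((\<lambda>e. N j (\<xi> + (e * \<tau>) *\<^sub>R fvec j) * cutoff_rest e j (\<xi> + (e * \<tau>) *\<^sub>R fvec j)) \<longlongrightarrow> N j \<xi>) (at_right 0)"
        if "\<xi> \<in> P" "L j \<xi> = 0" "\<And>k. k < d \<Longrightarrow> k \<noteq> j \<Longrightarrow> 0 < L k \<xi>" "0 < \<tau>" for \<xi> \<tau>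
        using tendsto_mult[OF tendsto_near_facet[OF j that contN] tendsto_cutoff_rest[OF j that]] by simp
    qed
  qed
  have zero: "?A e + (\<Sum>j<d. ?B j e) = 0" if e: "0 < e" for e
  proof -
    have A: "?A e = (\<Sum>i\<in>UNIV. LBINT x:P. partial i (X i) x * cutoff e x)"
      unfolding divX_def sum_distrib_right using e contX'
      by (intro set_lebesgue_integral_sum set_integrable_P continuous_intros continuous_on_cutoff) auto
    have "(LBINT x:{x \<in> P. L j x \<le> e}. N j x * cutoff_rest e j x) =
        (\<Sum>i\<in>UNIV. LINT x:{x \<in> P. L j x \<le> e}|lborel. nrm j $ i * X i x * cutoff_rest e j x)" for j
    proof -
      have "set_integrable lborel {x \<in> P. L j x \<le> e} (\<lambda>x. nrm j $ i * X i x * cutoff_rest e j x)" for i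
        by (rule set_integrable_subset[OF set_integrable_P])
          (use e contX in \<open>auto intro!: continuous_intros continuous_on_cutoff_rest\<close>)
      then show ?thesis
        unfolding N_def sum_distrib_right by (intro set_lebesgue_integral_sum) auto
    qed
    then have "(\<Sum>j<d. ?B j e) = (\<Sum>i\<in>UNIV. \<Sum>j<d. (1 / e) *
        (LBINT x:{x \<in> P. L j x \<le> e}. nrm j $ i * X i x * cutoff_rest e j x))"
      by (subst sum.swap) (simp add: sum_distrib_left)
    then have "?A e + (\<Sum>j<d. ?B j e) = (\<Sum>i\<in>UNIV. (LBINT x:P. partial i (X i) x * cutoff e x) +
        (\<Sum>j<d. (1 / e) * (LBINT x:{x \<in> P. L j x \<le> e}. nrm j $ i * X i x * cutoff_rest e j x)))"
      by (simp add: A sum.distrib)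
    then show ?thesis
      using integral_partial_cutoff[OF U X e] by simp
  qed
  have "((\<lambda>e. ?A e + (\<Sum>j<d. ?B j e)) \<longlongrightarrow> (LBINT x:P. divX x) + (\<Sum>j<d. face_mean j (N j))) (at_right 0)"
    using limB by (intro tendsto_add limA tendsto_sum) auto
  moreover have "\<forall>\<^sub>F e in at_right 0. ?A e + (\<Sum>j<d. ?B j e) = 0"
    using eventually_at_right_less[of "0::real"] by eventually_elim (rule zero)
  ultimately have "((\<lambda>e. 0) \<longlongrightarrow> (LBINT x:P. divX x) + (\<Sum>j<d. face_mean j (N j))) (at_right (0::real))"
    using tendsto_cong by force
  then have "(LBINT x:P. divX x) + (\<Sum>j<d. face_mean j (N j)) = 0"
    by (simp add: tendsto_const_iff)
  then show ?thesis unfolding divX_def N_def by simp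
qed

end

section \<open>Convexity and positive semidefinite matrices\<close>

text \<open>Induction on the size of the support of \<open>B\<close>: subtracting the rank-one matrix built from a column
  with nonzero diagonal entry (one step of the Cholesky decomposition) clears that row and column.\<close>

lemma sum_prod_psd_nonneg:
  fixes A B :: "real^'n::finite^'n"
  assumes A: "\<And>x. 0 \<le> x \<bullet> (A *v x)" and B: "\<And>x. 0 \<le> x \<bullet> (B *v x)" and sym: "\<And>i j. B $ i $ j = B $ j $ i"
  shows "0 \<le> (\<Sum>i\<in>UNIV. \<Sum>j\<in>UNIV. A $ i $ j * B $ i $ j)"
proof -
  have "0 \<le> (\<Sum>i\<in>UNIV. \<Sum>j\<in>UNIV. A $ i $ j * B $ i $ j)"
    if "finite S" "\<And>x. 0 \<le> x \<bullet> (B *v x)" "\<And>i j. B $ i $ j = B $ j $ i"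
      "\<And>i j. i \<notin> S \<Longrightarrow> B $ i $ j = 0" for S and B :: "real^'n^'n"
    using that
  proof (induction S arbitrary: B rule: finite_induct)
    case empty
    then show ?case by simp
  next
    case (insert k S)
    define b where "b = column k B"
    have bi: "b $ i = B $ i $ k" "b $ i = B $ k $ i" for i
      using insert.prems(2) by (simp_all add: b_def column_def)
    have Bax: "B *v axis k 1 = b" by (simp add: b_def matrix_vector_mult_basis)
    have quad: "(x - s *\<^sub>R axis k 1) \<bullet> (B *v (x - s *\<^sub>R axis k 1)) = x \<bullet> (B *v x) - 2 * s * (b \<bullet> x) + s\<^sup>2 * (B $ k $ k)"
      for x s
    proof -
      have 1: "axis k 1 \<bullet> (B *v x) = b \<bullet> x"
        unfolding inner_axis' by (simp add: matrix_vector_mult_def inner_vec_def bi(2))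
      have 2: "axis k 1 \<bullet> b = B $ k $ k" by (simp add: inner_axis' bi)
      show ?thesis
        by (simp add: matrix_vector_mult_diff_distrib matrix_vector_mult_scaleR Bax
            inner_diff_left inner_diff_right 1 2 inner_commute[of x b] power2_eq_square algebra_simps)
    qed
    have Bkk: "0 \<le> B $ k $ k"
      using insert.prems(1)[of "0 - (-1) *\<^sub>R axis k 1"] unfolding quad by simp
    show ?case
    proof (cases "B $ k $ k = 0")
      case True
      have b0: "b $ i = 0" for i
      proof (rule ccontr)
        assume ne: "b $ i \<noteq> 0"
        \<comment> \<open>With this \<open>s\<close> the quadratic form at
          \<open>axis i 1 - s *\<^sub>R axis k 1\<close> would equal -1.\<close>
        define s where "s = (B $ i $ i + 1) / (2 * b $ i)"
        have "axis i 1 \<bullet> (B *v axis i 1) = B $ i $ i"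
          by (simp add: matrix_vector_mult_basis inner_axis' column_def)
        moreover have "b \<bullet> axis i 1 = b $ i" by (simp add: inner_axis)
        ultimately have "0 \<le> B $ i $ i - 2 * s * b $ i"
          using insert.prems(1)[of "axis i 1 - s *\<^sub>R axis k 1"] unfolding quad by (simp add: True)
        also have "2 * s * b $ i = B $ i $ i + 1" using ne by (simp add: s_def)
        finally show False by simp
      qed
      have "B $ i $ j = 0" if "i \<notin> S" for i j
        using that insert.prems(3)[of i j] b0[of j] bi(2)[of j] by (cases "i = k") auto
      then show ?thesis using insert.IH insert.prems(1,2) by blast
    next
      case False
      then have pos: "0 < B $ k $ k" using Bkk by simp
      \<comment> \<open>The Schur complement of the entry \<open>B $ k $ k\<close>.\<close>
      define B' where "B' = (\<chi> i j. B $ i $ j - b $ i * b $ j / B $ k $ k)"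
      have B'x: "x \<bullet> (B' *v x) = x \<bullet> (B *v x) - (b \<bullet> x)\<^sup>2 / B $ k $ k" for x
      proof -
        have "B' *v x = B *v x - ((b \<bullet> x) / B $ k $ k) *\<^sub>R b"
          by (simp add: B'_def vec_eq_iff matrix_vector_mult_def inner_vec_def algebra_simps sum_subtractf
              sum_distrib_left sum_divide_distrib)
        then show ?thesis
          by (simp add: inner_diff_right inner_commute[of x b] power2_eq_square)
      qed
      have IH: "0 \<le> (\<Sum>i\<in>UNIV. \<Sum>j\<in>UNIV. A $ i $ j * B' $ i $ j)"
      proof (rule insert.IH)
        show "0 \<le> x \<bullet> (B' *v x)" for x
        proof -
          \<comment> \<open>The form of \<open>B'\<close> at \<open>x\<close> is the minimum of the
            form of \<open>B\<close> over the line through \<open>x\<close> in direction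
            \<open>axis k 1\<close>; this is the minimising point.\<close>
          have "x \<bullet> (B' *v x) = (x - ((b \<bullet> x) / B $ k $ k) *\<^sub>R axis k 1) \<bullet>
              (B *v (x - ((b \<bullet> x) / B $ k $ k) *\<^sub>R axis k 1))"
            unfolding quad B'x using pos by (simp add: power2_eq_square field_simps)
          then show ?thesis using insert.prems(1) by simp
        qed
        show "B' $ i $ j = B' $ j $ i" for i j
          using insert.prems(2)[of i j] by (simp add: B'_def)
        show "B' $ i $ j = 0" if "i \<notin> S" for i j
        proof (cases "i = k")
          case True
          then show ?thesis using pos by (simp add: B'_def bi(2)[symmetric])
        next
          case False
          then show ?thesis using that insert.prems(3)[of i] by (simp add: B'_def bi(1))
        qed
      qed
      have "(\<Sum>i\<in>UNIV. \<Sum>j\<in>UNIV. A $ i $ j * B $ i $ j) =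
          (\<Sum>i\<in>UNIV. \<Sum>j\<in>UNIV. A $ i $ j * B' $ i $ j) + (b \<bullet> (A *v b)) / B $ k $ k"
        by (simp add: B'_def inner_vec_def matrix_vector_mult_def sum_distrib_left sum_divide_distrib
            algebra_simps sum.distrib[symmetric])
      then show ?thesis using IH A[of b] pos by simp
    qed
  qed
  from this[of UNIV B] show ?thesis using B sym by simp
qed

text \<open>Eigenvalues are avoided: the matrix \<open>(norm h)\<^sup>2\<close> times the identity
  minus the rank-one matrix of \<open>h\<close> is positive semidefinite by Cauchy-Schwarz, and its
  product sum with \<open>B\<close> is the difference of the two sides.\<close>

lemma psd_quadratic_form_le_trace:
  fixes B :: "real^'n::finite^'n"
  assumes B: "\<And>x. 0 \<le> x \<bullet> (B *v x)" and sym: "\<And>i j. B $ i $ j = B $ j $ i"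
  shows "h \<bullet> (B *v h) \<le> (norm h)\<^sup>2 * (\<Sum>i\<in>UNIV. B $ i $ i)"
proof -
  define A where "A = (\<chi> i j. (if i = j then (norm h)\<^sup>2 else 0) - h $ i * h $ j)"
  have "0 \<le> x \<bullet> (A *v x)" for x
  proof -
    have "A *v x = (norm h)\<^sup>2 *\<^sub>R x - (h \<bullet> x) *\<^sub>R h"
    proof (rule vec_eq_iff[THEN iffD2], rule allI)
      fix i
      have "(A *v x) $ i = (\<Sum>j\<in>UNIV. (if i = j then (norm h)\<^sup>2 * x $ j else 0) - h $ i * (h $ j * x $ j))"
        unfolding A_def matrix_vector_mult_def by (auto intro!: sum.cong simp: algebra_simps)
      also have "\<dots> = (norm h)\<^sup>2 * x $ i - h $ i * (h \<bullet> x)"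
        by (simp add: sum_subtractf inner_vec_def sum_distrib_left)
      finally show "(A *v x) $ i = ((norm h)\<^sup>2 *\<^sub>R x - (h \<bullet> x) *\<^sub>R h) $ i" by simp
    qed
    then have "x \<bullet> (A *v x) = (norm h)\<^sup>2 * (norm x)\<^sup>2 - (h \<bullet> x)\<^sup>2"
      by (simp add: inner_diff_right inner_commute[of x h] power2_eq_square dot_square_norm[unfolded power2_eq_square])
    moreover have "(h \<bullet> x)\<^sup>2 \<le> (norm h)\<^sup>2 * (norm x)\<^sup>2"
      using Cauchy_Schwarz_ineq[of h x] by (simp add: power2_norm_eq_inner)
    ultimately show ?thesis by simp
  qed
  from sum_prod_psd_nonneg[OF this B sym]
  have "0 \<le> (\<Sum>i\<in>UNIV. \<Sum>j\<in>UNIV. A $ i $ j * B $ i $ j)" .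
  also have "\<dots> = (norm h)\<^sup>2 * (\<Sum>i\<in>UNIV. B $ i $ i) - h \<bullet> (B *v h)"
  proof -
    have "A $ i $ j * B $ i $ j = (if i = j then (norm h)\<^sup>2 * B $ j $ j else 0) - h $ i * (B $ i $ j * h $ j)" for i j
      by (simp add: A_def algebra_simps)
    then show ?thesis
      by (simp add: sum_subtractf inner_vec_def matrix_vector_mult_def sum_distrib_left)
  qed
  finally show ?thesis by simp
qed

text \<open>Positivity of the product sum, applied to \<open>A\<close> minus \<open>a\<close> times
  the identity.\<close>

lemma trace_prod_psd_ge:
  fixes A B :: "real^'n::finite^'n"
  assumes A: "\<And>x. a * (x \<bullet> x) \<le> x \<bullet> (A *v x)"
    and B: "\<And>x. 0 \<le> x \<bullet> (B *v x)" and sym: "\<And>i j. B $ i $ j = B $ j $ i"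
  shows "a * (\<Sum>i\<in>UNIV. B $ i $ i) \<le> (\<Sum>i\<in>UNIV. \<Sum>j\<in>UNIV. A $ i $ j * B $ i $ j)"
proof -
  define A' where "A' = A - mat a"
  have "mat a *v x = a *\<^sub>R x" for x :: "real^'n"
    by (simp add: vec_eq_iff matrix_vector_mult_def mat_def if_distrib[of "\<lambda>a. a * _"] cong: if_cong)
  then have "0 \<le> x \<bullet> (A' *v x)" for x
    using A[of x] by (simp add: A'_def matrix_vector_mult_diff_rdistrib inner_diff_right)
  from sum_prod_psd_nonneg[OF this B sym]
  have "0 \<le> (\<Sum>i\<in>UNIV. \<Sum>j\<in>UNIV. A' $ i $ j * B $ i $ j)" .
  also have "\<dots> = (\<Sum>i\<in>UNIV. \<Sum>j\<in>UNIV. A $ i $ j * B $ i $ j) - a * (\<Sum>i\<in>UNIV. B $ i $ i)"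
    by (simp add: A'_def mat_def left_diff_distrib sum_subtractf if_distrib[of "\<lambda>a. a * _"] sum_distrib_left
        cong: if_cong)
  finally show ?thesis by simp
qed

section \<open>Derivatives along lines; gradient and Hessian of convex functions\<close>

lemma C1_line_derivative:
  fixes g :: "real^'n::finite \<Rightarrow> real"
  assumes "open U" "Ck_on (Suc 0) U g" "x + s *\<^sub>R h \<in> U"
  shows "((\<lambda>t. g (x + t *\<^sub>R h)) has_real_derivative (\<Sum>i\<in>UNIV. h $ i * partial i g (x + s *\<^sub>R h))) (at s)"
proof -
  have 1: "((\<lambda>t. x + t *\<^sub>R h) has_derivative (\<lambda>t. t *\<^sub>R h)) (at s)"
    by (auto intro!: derivative_eq_intros)
  have "((\<lambda>t. g (x + t *\<^sub>R h)) has_derivative (\<lambda>t. \<Sum>i\<in>UNIV. (t *\<^sub>R h) $ i * partial i g (x + s *\<^sub>R h))) (at s)"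
    by (rule has_derivative_compose[OF 1 C1_has_derivative[OF assms]])
  also have "(\<lambda>t. \<Sum>i\<in>UNIV. (t *\<^sub>R h) $ i * partial i g (x + s *\<^sub>R h)) =
      (*) (\<Sum>i\<in>UNIV. h $ i * partial i g (x + s *\<^sub>R h))"
    by (simp add: fun_eq_iff sum_distrib_left sum_distrib_right mult_ac)
  finally show ?thesis unfolding has_field_derivative_def .
qed

abbreviation (input) laplacian :: "(real^'n::finite \<Rightarrow> real) \<Rightarrow> real^'n \<Rightarrow> real" where
  "laplacian u x \<equiv> \<Sum>i\<in>UNIV. hessian u x $ i $ i"

abbreviation (input) div2 :: "('n::finite \<Rightarrow> 'n \<Rightarrow> real^'n \<Rightarrow> real) \<Rightarrow> real^'n \<Rightarrow> real" where
  "div2 A x \<equiv> \<Sum>i\<in>UNIV. \<Sum>k\<in>UNIV. partial i (partial k (A i k)) x"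

abbreviation (input) energy :: "('n::finite \<Rightarrow> 'n \<Rightarrow> real^'n \<Rightarrow> real) \<Rightarrow> (real^'n \<Rightarrow> real) \<Rightarrow> real^'n \<Rightarrow> real" where
  "energy A u x \<equiv> \<Sum>i\<in>UNIV. \<Sum>k\<in>UNIV. A i k x * hessian u x $ i $ k"

lemma hessian_nth: "hessian u x $ i $ j = partial i (partial j u) x"
  by (simp add: hessian_def)

lemma hessian_symmetric:
  assumes "open U" "Ck_on 2 U u" "x \<in> U"
  shows "hessian u x $ i $ j = hessian u x $ j $ i"
  unfolding hessian_nth by (rule partial_commute[OF assms])

lemma C2_line_derivative2:
  fixes g :: "real^'n::finite \<Rightarrow> real"
  assumes "open U" "Ck_on 2 U g" "x + s *\<^sub>R h \<in> U"
  shows "((\<lambda>t. \<Sum>i\<in>UNIV. h $ i * partial i g (x + t *\<^sub>R h)) has_real_derivative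
    h \<bullet> (hessian g (x + s *\<^sub>R h) *v h)) (at s)"
proof -
  have "Ck_on (Suc 0) U (partial i g)" for i using assms(2) by (simp add: numeral_2_eq_2)
  then have "((\<lambda>t. \<Sum>i\<in>UNIV. h $ i * partial i g (x + t *\<^sub>R h)) has_real_derivative
      (\<Sum>i\<in>UNIV. h $ i * (\<Sum>j\<in>UNIV. h $ j * partial j (partial i g) (x + s *\<^sub>R h)))) (at s)"
    by (intro DERIV_sum DERIV_cmult C1_line_derivative[OF assms(1) _ assms(3)])
  also have "(\<Sum>i\<in>UNIV. h $ i * (\<Sum>j\<in>UNIV. h $ j * partial j (partial i g) (x + s *\<^sub>R h))) =
      h \<bullet> (hessian g (x + s *\<^sub>R h) *v h)"
    using partial_commute[OF assms]
    by (simp add: inner_vec_def matrix_vector_mult_def hessian_nth mult_ac)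
  finally show ?thesis .
qed

text \<open>Chord slopes from \<open>x\<close> are at most \<open>u y - u x\<close>, and the
  derivative is their limit. The inequality is used up to the boundary of \<open>P\<close>, hence a
  convex set \<open>S\<close> inside the open set \<open>U\<close> on which \<open>u\<close> is
  differentiable.\<close>

lemma convex_gradient_inequality:
  fixes u :: "real^'n::finite \<Rightarrow> real"
  assumes U: "open U" "Ck_on (Suc 0) U u" and S: "convex_on S u" "S \<subseteq> U" and xy: "x \<in> S" "y \<in> S"
  shows "u x + (\<Sum>i\<in>UNIV. (y - x) $ i * partial i u x) \<le> u y"
proof -
  let ?D = "\<Sum>i\<in>UNIV. (y - x) $ i * partial i u x"
  have "((\<lambda>t. u (x + t *\<^sub>R (y - x))) has_real_derivative ?D) (at 0)"
    using C1_line_derivative[OF U, of x 0 "y - x"] S xy by auto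
  then have "((\<lambda>t. (u (x + t *\<^sub>R (y - x)) - u x) / t) \<longlongrightarrow> ?D) (at 0)"
    by (simp add: DERIV_def)
  then have "((\<lambda>t. (u (x + t *\<^sub>R (y - x)) - u x) / t) \<longlongrightarrow> ?D) (at_right 0)"
    by (simp add: filterlim_at_split)
  moreover have "\<forall>\<^sub>F t in at_right 0. (u (x + t *\<^sub>R (y - x)) - u x) / t \<le> u y - u x"
    unfolding eventually_at_right_field
  proof (intro exI[of _ 1] conjI allI impI)
    fix t :: real assume t: "0 < t" "t < 1"
    have "u (x + t *\<^sub>R (y - x)) \<le> (1 - t) * u x + t * u y"
      using convex_onD[OF S(1), of t x y] t xy by (simp add: algebra_simps)
    then have "u (x + t *\<^sub>R (y - x)) - u x \<le> (u y - u x) * t" by (simp add: algebra_simps)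
    then show "(u (x + t *\<^sub>R (y - x)) - u x) / t \<le> u y - u x"
      using t by (simp only: pos_divide_le_eq)
  qed simp
  ultimately have "?D \<le> u y - u x"
    by (rule tendsto_upperbound) simp
  then show ?thesis by simp
qed

text \<open>Adding the gradient inequalities at the two ends of a segment shows that the directional
  derivative is nondecreasing; the Hessian form is its derivative.\<close>

lemma convex_hessian_psd:
  fixes u :: "real^'n::finite \<Rightarrow> real"
  assumes U: "open U" "Ck_on 2 U u" and S: "convex_on S u" "S \<subseteq> U" and x: "x \<in> interior S"
  shows "0 \<le> h \<bullet> (hessian u x *v h)"
proof -
  have C1: "Ck_on (Suc 0) U u" using U(2) by (simp add: numeral_2_eq_2)
  have xS: "x \<in> S" using x interior_subset by blast
  define \<phi> where "\<phi> t = (\<Sum>i\<in>UNIV. h $ i * partial i u (x + t *\<^sub>R h))" for t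
  have "(\<phi> has_real_derivative h \<bullet> (hessian u x *v h)) (at 0)"
    using C2_line_derivative2[OF U, of x 0 h] xS S unfolding \<phi>_def[abs_def] by auto
  then have "((\<lambda>t. (\<phi> t - \<phi> 0) / t) \<longlongrightarrow> h \<bullet> (hessian u x *v h)) (at 0)"
    by (simp add: DERIV_def)
  then have "((\<lambda>t. (\<phi> t - \<phi> 0) / t) \<longlongrightarrow> h \<bullet> (hessian u x *v h)) (at_right 0)"
    by (simp add: filterlim_at_split)
  moreover have "\<forall>\<^sub>F t in at_right 0. 0 \<le> (\<phi> t - \<phi> 0) / t"
  proof -
    have "\<forall>\<^sub>F t in at_right 0. x + t *\<^sub>R h \<in> interior S"
      using eventually_line_in_open[OF open_interior, of x 0 h S] x
      by (simp add: eventually_at_filter) (auto elim: eventually_mono)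
    then show ?thesis
      using eventually_at_right_less[of "0::real"]
    proof eventually_elim
      case (elim t)
      then have yS: "x + t *\<^sub>R h \<in> S" using interior_subset by blast
      have "u x + t * \<phi> 0 \<le> u (x + t *\<^sub>R h)"
        using convex_gradient_inequality[OF U(1) C1 S xS yS]
        by (simp add: \<phi>_def sum_distrib_left mult_ac)
      moreover have "u (x + t *\<^sub>R h) - t * \<phi> t \<le> u x"
        using convex_gradient_inequality[OF U(1) C1 S yS xS]
        by (simp add: \<phi>_def sum_distrib_left sum_negf mult_ac)
      ultimately have "t * \<phi> 0 \<le> t * \<phi> t" by linarith
      then show ?case using elim by simp
    qed
  qed
  ultimately show ?thesis by (rule tendsto_lowerbound) simp
qed

text \<open>The second derivative in \<open>t\<close> of the mean of \<open>u\<close> over the cube \<open>x + t *\<^sub>R h + Q\<close> is at most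
  \<open>(norm h)\<^sup>2 * E\<close>.\<close>

lemma cube_mean_second_difference:
  fixes u :: "real^'n::finite \<Rightarrow> real"
  assumes U: "open U" "Ck_on 2 U u" and K: "compact K" "K \<subseteq> U"
    and psd: "\<And>y h. y \<in> K \<Longrightarrow> 0 \<le> h \<bullet> (hessian u y *v h)"
    and xh: "\<And>z t. z \<in> cbox a b \<Longrightarrow> \<bar>t\<bar> < 2 \<Longrightarrow> x + z + t *\<^sub>R h \<in> K"
  defines "V \<equiv> \<lambda>x. integral (cbox a b) (\<lambda>z. u (x + z))"
    and "E \<equiv> integral K (laplacian u)"
  shows "V (x + h) + V (x - h) \<le> 2 * V x + (norm h)\<^sup>2 * E"
proof -
  \<comment> \<open>An open interval around [-1, 1], so that \<open>F\<close> is twice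
    differentiable at the points -1, 0, 1 of the second difference.\<close>
  let ?I = "{-2<..<2::real}" and ?Q = "cbox a b"
  have C1: "Ck_on (Suc 0) U u" using U(2) by (simp add: numeral_2_eq_2)
  have cont: "continuous_on U u" "continuous_on U (partial i u)" "continuous_on U (partial i (partial j u))" for i j
    using U(2) by (auto simp: numeral_2_eq_2)
  have inU: "x + z + t *\<^sub>R h \<in> U" if "z \<in> ?Q" "t \<in> ?I" for z t
    using xh[OF that(1), of t] that K by (auto simp: abs_less_iff)
  have contH: "continuous_on U (\<lambda>y. h \<bullet> (hessian u y *v h))"
    unfolding inner_vec_def matrix_vector_mult_def hessian_def
    by (simp, intro continuous_intros cont)
  define F where "F t = integral ?Q (\<lambda>z. u (x + z + t *\<^sub>R h))" for t
  define F1 where "F1 t = integral ?Q (\<lambda>z. \<Sum>i\<in>UNIV. h $ i * partial i u (x + z + t *\<^sub>R h))" for t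
  define F2 where "F2 t = integral ?Q (\<lambda>z. h \<bullet> (hessian u (x + z + t *\<^sub>R h) *v h))" for t
  have comp: "continuous_on ?Q (\<lambda>z. g (x + z + t *\<^sub>R h))" if "continuous_on U g" "t \<in> ?I" for g :: "real^'n \<Rightarrow> real" and t
    by (rule continuous_on_compose2[OF that(1)]) (use inU that in \<open>auto intro!: continuous_intros\<close>)
  have comp2: "continuous_on (?I \<times> ?Q) (\<lambda>(t, z). g (x + z + t *\<^sub>R h))" if "continuous_on U g" for g :: "real^'n \<Rightarrow> real"
    unfolding split_beta
    by (rule continuous_on_compose2[OF that]) (use inU in \<open>auto intro!: continuous_intros\<close>)
  have dF: "(F has_real_derivative F1 t) (at t)" if t: "t \<in> ?I" for t
  proof -
    have "(F has_real_derivative F1 t) (at t within ?I)"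
      unfolding F_def[abs_def] F1_def
    proof (rule leibniz_rule_field_derivative)
      show "((\<lambda>t. u (x + z + t *\<^sub>R h)) has_real_derivative (\<Sum>i\<in>UNIV. h $ i * partial i u (x + z + t *\<^sub>R h))) (at t within ?I)"
        if "t \<in> ?I" "z \<in> ?Q" for t z
        by (rule has_field_derivative_at_within, rule C1_line_derivative[OF U(1) C1 inU[OF that(2,1)]])
      show "(\<lambda>z. u (x + z + t *\<^sub>R h)) integrable_on ?Q" if "t \<in> ?I" for t
        by (rule integrable_continuous[OF comp[OF cont(1) that]])
      show "continuous_on (?I \<times> ?Q) (\<lambda>(t, z). \<Sum>i\<in>UNIV. h $ i * partial i u (x + z + t *\<^sub>R h))"
        by (rule comp2) (intro continuous_intros cont)
    qed (use t in auto)
    then show ?thesis using at_within_open[OF t] by simp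
  qed
  have dF1: "(F1 has_real_derivative F2 t) (at t)" if t: "t \<in> ?I" for t
  proof -
    have "(F1 has_real_derivative F2 t) (at t within ?I)"
      unfolding F1_def[abs_def] F2_def
    proof (rule leibniz_rule_field_derivative)
      show "((\<lambda>t. \<Sum>i\<in>UNIV. h $ i * partial i u (x + z + t *\<^sub>R h)) has_real_derivative
          h \<bullet> (hessian u (x + z + t *\<^sub>R h) *v h)) (at t within ?I)"
        if "t \<in> ?I" "z \<in> ?Q" for t z
        by (rule has_field_derivative_at_within, rule C2_line_derivative2[OF U inU[OF that(2,1)]])
      show "(\<lambda>z. \<Sum>i\<in>UNIV. h $ i * partial i u (x + z + t *\<^sub>R h)) integrable_on ?Q" if "t \<in> ?I" for t
        by (rule integrable_continuous, rule comp[OF _ that]) (intro continuous_intros cont)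
      show "continuous_on (?I \<times> ?Q) (\<lambda>(t, z). h \<bullet> (hessian u (x + z + t *\<^sub>R h) *v h))"
        by (rule comp2[OF contH])
    qed (use t in auto)
    then show ?thesis using at_within_open[OF t] by simp
  qed
  define lap where "lap y = (\<Sum>i\<in>UNIV. hessian u y $ i $ i)" for y
  have contL: "continuous_on U lap"
    unfolding lap_def hessian_nth by (intro continuous_intros cont)
  have lap0: "0 \<le> lap y" if "y \<in> K" for y
    unfolding lap_def
  proof (rule sum_nonneg)
    fix i
    show "0 \<le> hessian u y $ i $ i"
      using psd[OF that, of "axis i 1"] by (simp add: matrix_vector_mult_basis inner_axis' column_def)
  qed
  \<comment> \<open>The Hessian form is at most \<open>(norm h)\<^sup>2\<close> times the Laplacian,
    and the translated cube lies in \<open>K\<close>, where the Laplacian is nonnegative.\<close>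
  have F2: "F2 t \<le> (norm h)\<^sup>2 * E" if t: "t \<in> ?I" for t
  proof -
    have "F2 t \<le> integral ?Q (\<lambda>z. (norm h)\<^sup>2 * lap (x + z + t *\<^sub>R h))"
      unfolding F2_def
    proof (rule integral_le)
      show "(\<lambda>z. h \<bullet> (hessian u (x + z + t *\<^sub>R h) *v h)) integrable_on ?Q"
        by (rule integrable_continuous[OF comp[OF contH t]])
      show "(\<lambda>z. (norm h)\<^sup>2 * lap (x + z + t *\<^sub>R h)) integrable_on ?Q"
        by (rule integrable_continuous) (intro continuous_intros comp[OF contL t])
      show "h \<bullet> (hessian u (x + z + t *\<^sub>R h) *v h) \<le> (norm h)\<^sup>2 * lap (x + z + t *\<^sub>R h)" if "z \<in> ?Q" for z
        unfolding lap_def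
        using psd_quadratic_form_le_trace[OF psd hessian_symmetric[OF U]] xh[OF that, of t] inU[OF that t] t
        by (auto simp: abs_less_iff)
    qed
    also have "\<dots> = (norm h)\<^sup>2 * integral ?Q (lap \<circ> (+) (x + t *\<^sub>R h))"
      by (simp add: o_def add_ac)
    also have "\<dots> = (norm h)\<^sup>2 * integral (cbox (a + (x + t *\<^sub>R h)) (b + (x + t *\<^sub>R h))) lap"
      by (simp add: integral_shift_cbox_plus)
    also have "\<dots> \<le> (norm h)\<^sup>2 * E"
    proof (rule mult_left_mono)
      have sub: "cbox (a + (x + t *\<^sub>R h)) (b + (x + t *\<^sub>R h)) \<subseteq> K"
      proof
        fix y assume "y \<in> cbox (a + (x + t *\<^sub>R h)) (b + (x + t *\<^sub>R h))"
        then have "y - (x + t *\<^sub>R h) \<in> ?Q"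
          by (simp add: mem_box inner_diff_left inner_add_left algebra_simps)
        from xh[OF this, of t] show "y \<in> K" using t by (auto simp: abs_less_iff)
      qed
      have intK: "lap integrable_on K"
        using set_borel_integral_eq_integral(1)[of K lap] borel_integrable_compact[OF K(1), of lap]
          continuous_on_subset[OF contL K(2)] by (simp add: set_integrable_def)
      show "integral (cbox (a + (x + t *\<^sub>R h)) (b + (x + t *\<^sub>R h))) lap \<le> E"
        unfolding E_def lap_def[symmetric]
        by (rule integral_subset_le[OF sub integrable_continuous intK])
          (use sub K contL lap0 in \<open>auto intro: continuous_on_subset\<close>)
    qed simp
    finally show ?thesis .
  qed
  \<comment> \<open>The bound on the second derivative of \<open>F\<close> makes this difference
    convex; midpoint convexity between -1 and 1 is the claim.\<close>
  have "convex_on ?I (\<lambda>t. t\<^sup>2 / 2 * ((norm h)\<^sup>2 * E) - F t)"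
  proof (rule f''_ge0_imp_convex)
    show "((\<lambda>t. t\<^sup>2 / 2 * ((norm h)\<^sup>2 * E) - F t) has_real_derivative (t * ((norm h)\<^sup>2 * E) - F1 t)) (at t)"
      if "t \<in> ?I" for t
      by (rule derivative_eq_intros dF[OF that] refl | simp)+
    show "((\<lambda>t. t * ((norm h)\<^sup>2 * E) - F1 t) has_real_derivative ((norm h)\<^sup>2 * E - F2 t)) (at t)"
      if "t \<in> ?I" for t
      by (rule derivative_eq_intros dF1[OF that] refl | simp)+
  qed (use F2 in auto)
  from convex_onD[OF this, of "1/2" "-1" 1]
  have "- F 0 \<le> ((norm h)\<^sup>2 * E / 2 - F (- 1)) / 2 + ((norm h)\<^sup>2 * E / 2 - F 1) / 2" by simp
  moreover have "f1 + f2 \<le> 2 * f0 + w" if "- f0 \<le> (w / 2 - f2) / 2 + (w / 2 - f1) / 2" for f0 f1 f2 w :: real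
    using that by argo
  ultimately have "F 1 + F (-1) \<le> 2 * F 0 + (norm h)\<^sup>2 * E" by blast
  moreover have "F 1 = V (x + h)" "F (-1) = V (x - h)" "F 0 = V x"
    by (simp_all add: F_def V_def algebra_simps)
  ultimately show ?thesis by simp
qed

section \<open>The interior estimate\<close>

context simple_polytope
begin

text \<open>For positive \<kappa> these are compact subsets of the interior, exhausting it as
  \<kappa> tends to 0.\<close>

definition core :: "real \<Rightarrow> (real^'n) set" where
  "core \<kappa> = {x. \<forall>j<d. \<kappa> \<le> L j x}"

lemma core_subset_interior: "0 < \<kappa> \<Longrightarrow> core \<kappa> \<subseteq> interior P"
  by (force simp: core_def interior_P_iff)

lemma core_subset_P: "0 < \<kappa> \<Longrightarrow> core \<kappa> \<subseteq> P"
  using core_subset_interior interior_subset by blast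

lemma compact_core:
  assumes "0 < \<kappa>"
  shows "compact (core \<kappa>)"
proof -
  have "core \<kappa> = (\<Inter>j\<in>{..<d}. {x. \<kappa> \<le> L j x})" by (auto simp: core_def)
  then have "closed (core \<kappa>)" by (auto intro!: closed_INT closed_Collect_le continuous_intros)
  moreover have "core \<kappa> = P \<inter> core \<kappa>" using core_subset_P[OF assms] by blast
  ultimately show ?thesis using compact_Int_closed[OF compact_P] by metis
qed

lemma L_convex_combination: "L j ((1 - t) *\<^sub>R x + t *\<^sub>R y) = (1 - t) * L j x + t * L j y"
  by (simp add: Lfun_def inner_add_right algebra_simps)

lemma L_line: "L j (x + t *\<^sub>R (y - x)) = (1 - t) * L j x + t * L j y"
  by (simp add: L_add inner_diff_right algebra_simps) (simp add: Lfun_def algebra_simps)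

lemma laplacian_nonneg:
  assumes "open U" "P \<subseteq> U" "Ck_on 2 U u" "convex_on P u" "x \<in> interior P"
  shows "0 \<le> laplacian u x"
proof (rule sum_nonneg)
  fix i
  show "0 \<le> hessian u x $ i $ i"
    using convex_hessian_psd[OF assms(1,3,4,2,5), of "axis i 1"]
    by (simp add: matrix_vector_mult_basis inner_axis' column_def)
qed

lemma uniform_positive_L:
  assumes "x0 \<in> interior P"
  obtains l where "0 < l" "\<And>j. j < d \<Longrightarrow> l \<le> L j x0"
proof
  let ?l = "Min (insert 1 ((\<lambda>j. L j x0) ` {..<d}))"
  show "0 < ?l" using assms by (auto simp: interior_P_iff)
  show "?l \<le> L j x0" if "j < d" for j using that by (intro Min_le) auto
qed

text \<open>Means of \<open>u\<close> over small cubes are almost affine, with error controlled by the integral of the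
  Laplacian. Comparing the cube at \<open>x0\<close> with its dilation by the factor 4 bounds the mean at \<open>x0\<close>,
  because \<open>u\<close> vanishes there; this bound is then propagated along a chain of small steps.\<close>

lemma interior_estimate:
  assumes x0: "x0 \<in> interior P" and \<delta>: "0 < \<delta>" "\<delta> < 1"
  obtains \<kappa> C where "0 < \<kappa>" "0 \<le> C"
    "\<And>u U x. \<lbrakk>open U; P \<subseteq> U; Ck_on 2 U u; convex_on P u; u x0 = 0; \<And>x. x \<in> P \<Longrightarrow> 0 \<le> u x; x \<in> P\<rbrakk> \<Longrightarrow>
      u (x0 + (1 - \<delta>) *\<^sub>R (x - x0)) \<le> C * integral (core \<kappa>) (laplacian u)"
proof -
  have x0P: "x0 \<in> P" using x0 interior_subset by blast
  obtain l where l: "0 < l" "\<And>j. j < d \<Longrightarrow> l \<le> L j x0" using uniform_positive_L[OF x0] by blast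
  \<comment> \<open>Dilation towards \<open>x0\<close> by the factor \<open>1 - \<delta>\<close>
    retains the share \<delta> of \<open>L j x0\<close>, so all points to be estimated lie in
    \<open>core \<kappa>0\<close>. The smaller \<open>core \<kappa>\<close> leaves room around
    them.\<close>
  define \<kappa>0 where "\<kappa>0 = \<delta> * l"
  define \<kappa> where "\<kappa> = \<kappa>0 / 2"
  have \<kappa>: "0 < \<kappa>0" "0 < \<kappa>" using \<delta> l by (simp_all add: \<kappa>0_def \<kappa>_def)
  define B where "B = 1 + (\<Sum>j<d. norm (nrm j))"
  have B: "0 < B" "\<And>j. j < d \<Longrightarrow> norm (nrm j) \<le> B"
  proof -
    show "0 < B" unfolding B_def by (intro add_pos_nonneg sum_nonneg) auto
    show "norm (nrm j) \<le> B" if "j < d" for j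
      using member_le_sum[of j "{..<d}" "\<lambda>j. norm (nrm j)"] that by (auto simp: B_def)
  qed
  \<comment> \<open>A displacement of length \<open>3 * r\<close> changes each \<open>L j\<close> by
    at most \<open>\<kappa>0 / 2\<close>. The length 3 covers a point of the cube, at most
    \<open>r / 4\<close>, plus twice a step of length \<open>r\<close>.\<close>
  define r where "r = \<kappa>0 / (6 * B)"
  have r: "0 < r" using \<kappa> B by (simp add: r_def)
  have shift: "x + w \<in> core \<kappa>" if x: "x \<in> core \<kappa>0" and w: "norm w \<le> 3 * r" for x w
    unfolding core_def
  proof (intro CollectI allI impI)
    fix j assume j: "j < d"
    have "\<bar>nrm j \<bullet> w\<bar> \<le> norm (nrm j) * norm w" by (rule Cauchy_Schwarz_ineq2)
    also have "\<dots> \<le> B * (3 * r)" using B j w by (intro mult_mono) auto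
    also have "\<dots> = \<kappa>0 / 2" using B by (simp add: r_def)
    finally show "\<kappa> \<le> L j (x + w)" using x j by (auto simp: core_def L_add \<kappa>_def)
  qed
  have x0core: "x0 \<in> core \<kappa>0"
    unfolding core_def
  proof (intro CollectI allI impI)
    fix j assume "j < d"
    have "\<delta> * l \<le> 1 * l" using \<delta> l by (intro mult_right_mono) auto
    then show "\<kappa>0 \<le> L j x0" using l(2)[OF \<open>j < d\<close>] by (simp add: \<kappa>0_def)
  qed
  \<comment> \<open>The half side makes every point \<open>z\<close> of the cube satisfy
    \<open>norm z \<le> r / 4\<close>, so that \<open>4 *\<^sub>R z\<close> is an admissible
    step.\<close>
  define b where "b = (\<chi> i. r / (4 * real CARD('n)) :: real^'n)"
  let ?Q = "cbox (- b) b"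
  have Q: "norm z \<le> r / 4" if "z \<in> ?Q" for z
  proof -
    have "norm z \<le> (\<Sum>i\<in>UNIV. \<bar>z $ i\<bar>)" by (rule norm_le_l1_cart)
    also have "\<dots> \<le> (\<Sum>i\<in>(UNIV::'n set). r / (4 * real CARD('n)))"
    proof (rule sum_mono)
      fix i
      have "- b $ i \<le> z $ i" "z $ i \<le> b $ i" using that by (auto simp: mem_box_cart)
      then show "\<bar>z $ i\<bar> \<le> r / (4 * real CARD('n))" by (simp add: b_def abs_le_iff)
    qed
    also have "\<dots> = r / 4" by simp
    finally show ?thesis .
  qed
  define v where "v = measure lborel ?Q"
  have v: "0 < v"
  proof -
    have "box (- b) b \<noteq> {}"
      using r unfolding interval_ne_empty_cart by (auto simp: b_def)
    then show ?thesis unfolding v_def content_pos_lt_eq by (simp only: box_ne_empty)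
  qed
  obtain D where D: "\<And>x. x \<in> P \<Longrightarrow> norm (x - x0) \<le> D"
  proof -
    obtain R where R: "\<And>x. x \<in> P \<Longrightarrow> norm x \<le> R" using bounded_P by (auto simp: bounded_iff)
    have "norm (x - x0) \<le> R + R" if "x \<in> P" for x
      using norm_triangle_ineq4[of x x0] R[OF that] R[OF x0P] by linarith
    then show thesis using that by blast
  qed
  have "0 \<le> D" using D[OF x0P] by simp
  obtain N0 :: nat where "D / r < real N0" using reals_Archimedean2 by blast
  then obtain N :: nat where N: "0 < N" "D \<le> r * real N"
    using r \<open>0 \<le> D\<close> by (metis divide_nonneg_pos le_less_trans less_imp_le mult.commute of_nat_0_less_iff pos_divide_less_eq)
  \<comment> \<open>The power of 2 comes from the recursion over \<open>N\<close> steps; the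
    division by \<open>v\<close> is there because \<open>V\<close> is an integral over the cube and
    not a mean.\<close>
  define C where "C = 2 ^ (N + 1) * r\<^sup>2 / v"
  show thesis
  proof (rule that[OF \<kappa>(2)])
    show "0 \<le> C" using v by (simp add: C_def)
    fix u :: "real^'n \<Rightarrow> real" and U x
    assume U: "open U" "P \<subseteq> U" "Ck_on 2 U u" and conv: "convex_on P u" and u0: "u x0 = 0"
      and upos: "\<And>x. x \<in> P \<Longrightarrow> 0 \<le> u x" and x: "x \<in> P"
    define E where "E = integral (core \<kappa>) (laplacian u)"
    have coreU: "core \<kappa> \<subseteq> U" using core_subset_P[OF \<kappa>(2)] U(2) by blast
    have contu: "continuous_on P u" using Ck_on_continuous[OF U(3)] U(2) continuous_on_subset by blast
    \<comment> \<open>In the nonintegrable case \<open>integral\<close> has the default value 0, so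
      no integrability has to be shown.\<close>
    have "0 \<le> E"
      unfolding E_def
    proof (cases "(laplacian u) integrable_on core \<kappa>")
      case True
      then show "0 \<le> integral (core \<kappa>) (laplacian u)"
        using laplacian_nonneg[OF U conv] core_subset_interior[OF \<kappa>(2)]
        by (intro integral_nonneg) auto
    qed (simp add: not_integrable_integral)
    define V where "V x = integral ?Q (\<lambda>z. u (x + z))" for x
    have shiftP: "x + w \<in> P" if "x \<in> core \<kappa>0" "norm w \<le> 3 * r" for x w
      using shift[OF that] core_subset_P[OF \<kappa>(2)] by blast
    have int: "(\<lambda>z. u (y + z)) integrable_on ?Q" if "\<And>z. z \<in> ?Q \<Longrightarrow> y + z \<in> P" for y
      by (rule integrable_continuous, rule continuous_on_compose2[OF contu])
        (use that in \<open>auto intro!: continuous_intros\<close>)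
    have Vnn: "0 \<le> V y" if "\<And>z. z \<in> ?Q \<Longrightarrow> y + z \<in> P" for y
      unfolding V_def by (rule integral_nonneg[OF int[OF that]]) (use that upos in auto)
    have diff2: "V (y + h) + V (y - h) \<le> 2 * V y + r\<^sup>2 * E" if y: "y \<in> core \<kappa>0" and h: "norm h \<le> r" for y h
    proof -
      have "V (y + h) + V (y - h) \<le> 2 * V y + (norm h)\<^sup>2 * E"
        unfolding V_def E_def
      proof (rule cube_mean_second_difference[OF U(1,3) compact_core[OF \<kappa>(2)] coreU])
        show "0 \<le> h \<bullet> (hessian u y *v h)" if "y \<in> core \<kappa>" for y h
          using convex_hessian_psd[OF U(1,3) conv U(2)] core_subset_interior[OF \<kappa>(2)] that by blast
        fix z and t :: real assume z: "z \<in> ?Q" and t: "\<bar>t\<bar> < 2"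
        have "norm (t *\<^sub>R h) \<le> 2 * r" unfolding norm_scaleR using t h r by (intro mult_mono) auto
        then have "norm (z + t *\<^sub>R h) \<le> 3 * r"
          using norm_triangle_ineq[of z "t *\<^sub>R h"] Q[OF z] r by linarith
        then show "y + z + t *\<^sub>R h \<in> core \<kappa>" using shift[OF y] by (simp add: add.assoc)
      qed
      moreover have "(norm h)\<^sup>2 * E \<le> r\<^sup>2 * E"
        using h \<open>0 \<le> E\<close> by (intro mult_right_mono power_mono) auto
      ultimately show ?thesis by linarith
    qed
    \<comment> \<open>The cube is symmetric, so midpoint convexity for the pair
      \<open>y + z\<close>, \<open>y - z\<close> can be integrated over it.\<close>
    have jensen: "v * u y \<le> V y" if y: "\<And>w. norm w \<le> r \<Longrightarrow> y + w \<in> P" for y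
    proof -
      have yz: "y + z \<in> P" "y + - z \<in> P" if "z \<in> ?Q" for z
        using Q[OF that] r by (auto intro!: y simp del: add_uminus_conv_diff)
      have refl: "((\<lambda>z. u (y + - z)) has_integral V y) ?Q"
        using has_integral_reflect_lemma[OF integrable_integral[OF int[OF yz(1)]]] by (simp add: V_def)
      have "((\<lambda>z. u (y + z) + u (y + - z)) has_integral V y + V y) ?Q"
        by (intro has_integral_add refl) (use integrable_integral[OF int[OF yz(1)]] in \<open>simp add: V_def\<close>)
      moreover have "((\<lambda>z. 2 * u y) has_integral v * (2 * u y)) ?Q"
        using has_integral_const[of "2 * u y" "- b" b] by (simp add: v_def)
      moreover have "2 * u y \<le> u (y + z) + u (y + - z)" if "z \<in> ?Q" for z
        using convex_onD[OF conv, of "1/2" "y + z" "y + - z"] yz[OF that]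
        by (simp add: scaleR_add_right[symmetric] scaleR_2[symmetric])
      ultimately have "v * (2 * u y) \<le> V y + V y"
        using has_integral_le by blast
      then show ?thesis by simp
    qed
    \<comment> \<open>Convexity and \<open>u x0 = 0\<close> give
      \<open>u (x0 + z) \<le> u (x0 + 4 *\<^sub>R z) / 4\<close>. The second difference bounds the
      larger value by \<open>(2 * V x0 + r\<^sup>2 * E) / v\<close>. After integration
      \<open>V x0\<close> returns with coefficient 2/4, less than 1, and is absorbed.\<close>
    have V0: "V x0 \<le> r\<^sup>2 * E"
    proof -
      have zQ: "u (x0 + z) \<le> (2 * V x0 + r\<^sup>2 * E) / (4 * v)" if z: "z \<in> ?Q" for z
      proof -
        have z4: "norm (4 *\<^sub>R z) \<le> r" using Q[OF z] by simp
        have in4: "x0 + 4 *\<^sub>R z + w \<in> P" if "norm w \<le> r" for w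
          using shiftP[OF x0core, of "4 *\<^sub>R z + w"] norm_triangle_ineq[of "4 *\<^sub>R z" w] that z4 r
          by (simp add: add.assoc)
        have in4': "x0 - 4 *\<^sub>R z + w \<in> P" if "w \<in> ?Q" for w
          using shiftP[OF x0core, of "w - 4 *\<^sub>R z"] norm_triangle_ineq4[of w "4 *\<^sub>R z"] Q[OF that] z4 r
          by (simp add: algebra_simps)
        have "v * u (x0 + 4 *\<^sub>R z) \<le> V (x0 + 4 *\<^sub>R z)" by (rule jensen[OF in4])
        also have "\<dots> \<le> 2 * V x0 + r\<^sup>2 * E"
          using diff2[OF x0core z4] Vnn[OF in4'] by linarith
        finally have *: "u (x0 + 4 *\<^sub>R z) / 4 \<le> (2 * V x0 + r\<^sup>2 * E) / (4 * v)"
          using v by (simp add: field_simps)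
        have "(1 - 1/4) *\<^sub>R x0 + (1/4) *\<^sub>R (x0 + 4 *\<^sub>R z) = x0 + z"
          by (simp add: algebra_simps flip: scaleR_add_left)
        then have "u (x0 + z) \<le> u (x0 + 4 *\<^sub>R z) / 4"
          using convex_onD[OF conv, of "1/4" x0 "x0 + 4 *\<^sub>R z"] x0P in4[of 0] r u0 by simp
        with * show ?thesis by linarith
      qed
      have "V x0 \<le> integral ?Q (\<lambda>z. (2 * V x0 + r\<^sup>2 * E) / (4 * v))"
        unfolding V_def
      proof (rule integral_le)
        show "(\<lambda>z. u (x0 + z)) integrable_on ?Q"
          by (rule int, rule shiftP[OF x0core]) (use Q r in fastforce)
      qed (use zQ in \<open>auto simp: V_def\<close>)
      also have "\<dots> = (2 * V x0 + r\<^sup>2 * E) / 4"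
        using v by (simp add: v_def)
      finally show ?thesis using \<open>0 \<le> E\<close> by (simp add: field_simps) (smt (verit) mult_nonneg_nonneg zero_le_power2)
    qed
    define y where "y = x0 + (1 - \<delta>) *\<^sub>R (x - x0)"
    have ycore: "y \<in> core \<kappa>0"
      unfolding core_def y_def
    proof (intro CollectI allI impI)
      fix j assume j: "j < d"
      have "\<delta> * l \<le> \<delta> * L j x0" using l(2)[OF j] \<delta> by simp
      moreover have "0 \<le> (1 - \<delta>) * L j x" using x j \<delta> by (auto simp: polytope_of_def)
      ultimately show "\<kappa>0 \<le> L j (x0 + (1 - \<delta>) *\<^sub>R (x - x0))" unfolding L_line \<kappa>0_def by simp
    qed
    define h where "h = (1 / real N) *\<^sub>R (y - x0)"
    have h: "norm h \<le> r"
    proof -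
      have "norm (y - x0) \<le> 1 * norm (x - x0)"
        unfolding y_def using \<delta> by (simp add: mult_left_le_one_le)
      also have "\<dots> \<le> r * real N" using D[OF x] N by simp
      finally show ?thesis using N by (simp add: h_def divide_le_eq)
    qed
    have path: "x0 + real k *\<^sub>R h \<in> core \<kappa>0" if "k \<le> N" for k
      unfolding core_def
    proof (intro CollectI allI impI)
      fix j assume j: "j < d"
      define t where "t = real k / real N"
      have t: "0 \<le> t" "t \<le> 1" using that N by (auto simp: t_def divide_le_eq)
      have "L j (x0 + real k *\<^sub>R h) = (1 - t) * L j x0 + t * L j y"
        using L_line[of j x0 t y] by (simp add: h_def t_def)
      moreover have "(1 - t) * \<kappa>0 \<le> (1 - t) * L j x0" "t * \<kappa>0 \<le> t * L j y"
        using t x0core ycore j by (auto simp: core_def intro!: mult_left_mono)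
      ultimately show "\<kappa>0 \<le> L j (x0 + real k *\<^sub>R h)" by (simp add: algebra_simps)
    qed
    have inP: "x0 + real k *\<^sub>R h + z \<in> P" if "k \<le> N" "z \<in> ?Q" for k z
      using shiftP[OF path[OF that(1)], of z] Q[OF that(2)] r by simp
    \<comment> \<open>Discarding the nonnegative \<open>V (?p - h)\<close>, each step doubles the
      bound and adds \<open>r\<^sup>2 * E\<close>; starting from 1 this recursion has the solution
      \<open>2 ^ (k + 1) - 1\<close>.\<close>
    have chain: "V (x0 + real k *\<^sub>R h) \<le> (2 ^ (k + 1) - 1) * (r\<^sup>2 * E)" if "k \<le> N" for k
      using that
    proof (induction k)
      case 0
      then show ?case using V0 by simp
    next
      case (Suc k)
      let ?p = "x0 + real k *\<^sub>R h"
      have nonneg: "0 \<le> V (?p - h)"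
      proof (rule Vnn)
        fix z assume "z \<in> ?Q"
        then have "norm (z - h) \<le> 3 * r" using Q[of z] h r norm_triangle_ineq4[of z h] by linarith
        then show "?p - h + z \<in> P" using shiftP[OF path, of k "z - h"] Suc by (simp add: algebra_simps)
      qed
      have "V (?p + h) \<le> 2 * V ?p + r\<^sup>2 * E"
        using diff2[OF path h, of k] nonneg Suc by simp
      also have "\<dots> \<le> 2 * ((2 ^ (k + 1) - 1) * (r\<^sup>2 * E)) + r\<^sup>2 * E" using Suc by simp
      also have "\<dots> = (2 ^ (Suc k + 1) - 1) * (r\<^sup>2 * E)" by (simp add: algebra_simps)
      finally show ?case by (simp add: algebra_simps)
    qed
    have "x0 + real N *\<^sub>R h = y" using N by (simp add: h_def)
    then have "V y \<le> (2 ^ (N + 1) - 1) * (r\<^sup>2 * E)" using chain[of N] by simp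
    also have "\<dots> \<le> 2 ^ (N + 1) * (r\<^sup>2 * E)" using \<open>0 \<le> E\<close> by (intro mult_right_mono) auto
    finally have "V y \<le> 2 ^ (N + 1) * (r\<^sup>2 * E)" .
    moreover have "v * u y \<le> V y"
      by (rule jensen, rule shiftP[OF ycore]) (use r in linarith)
    ultimately have "u y * v \<le> 2 ^ (N + 1) * r\<^sup>2 * E" by (simp add: mult_ac)
    then show "u (x0 + (1 - \<delta>) *\<^sub>R (x - x0)) \<le> C * integral (core \<kappa>) (laplacian u)"
      unfolding C_def E_def[symmetric] y_def[symmetric] using v by (simp add: pos_le_divide_eq)
  qed
qed

end

section \<open>The energy identity\<close>

lemma partial_mult:
  assumes "Ck_on (Suc k) U g" "Ck_on (Suc k) U h" "x \<in> U"
  shows "partial i (\<lambda>x. g x * h x) x = partial i g x * h x + partial i h x * g x"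
  using DERIV_mult[OF Ck_on_has_partial[OF assms(1,3)] Ck_on_has_partial[OF assms(2,3)], of i i]
  by (intro partialI(2)) simp

lemma partial_diff:
  assumes "Ck_on (Suc k) U g" "Ck_on (Suc k) U h" "x \<in> U"
  shows "partial i (\<lambda>x. g x - h x) x = partial i g x - partial i h x"
  using DERIV_diff[OF Ck_on_has_partial[OF assms(1,3)] Ck_on_has_partial[OF assms(2,3)], of i i]
  by (intro partialI(2))

lemma partial_sum:
  assumes "\<And>k. k \<in> I \<Longrightarrow> Ck_on (Suc m) U (g k)" "x \<in> U"
  shows "partial i (\<lambda>x. \<Sum>k\<in>I. g k x) x = (\<Sum>k\<in>I. partial i (g k) x)"
  using assms by (intro partialI(2) DERIV_sum Ck_on_has_partial)

lemma partial_affine: "partial i (\<lambda>x. a \<bullet> x + b) x = a $ i"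
proof (rule partialI(2))
  show "((\<lambda>t. a \<bullet> (x + t *\<^sub>R axis i 1) + b) has_real_derivative a $ i) (at 0)"
    by (simp only: inner_add_right inner_scaleR_right inner_axis) (auto intro!: derivative_eq_intros)
qed

lemma partial_const: "partial i (\<lambda>x. b) x = 0"
  by (rule partialI(2)) simp

lemma hessian_affine: "hessian (\<lambda>x. a \<bullet> x + b) x $ i $ j = 0"
proof -
  have "partial j (\<lambda>x. a \<bullet> x + b) = (\<lambda>x. a $ j)" by (rule ext) (rule partial_affine)
  then show ?thesis by (simp add: hessian_nth partial_const)
qed

context simple_polytope
begin

text \<open>The boundary of \<open>P\<close> is a null set. Identities available only in the
  interior, such as the Abreu equation, thereby pass to integrals over \<open>P\<close>.\<close>

lemma integral_P_cong:
  fixes f g :: "real^'n \<Rightarrow> real"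
  assumes "continuous_on P f" "continuous_on P g" "\<And>x. x \<in> interior P \<Longrightarrow> f x = g x"
  shows "(LBINT x:P. f x) = (LBINT x:P. g x)"
  unfolding set_lebesgue_integral_def
proof (rule integral_cong_AE)
  show "AE x in lborel. indicator P x *\<^sub>R f x = indicator P x *\<^sub>R g x"
    using AE_P_interior by eventually_elim (auto simp: indicator_def assms(3))
qed (use measurable_P_continuous assms in auto)

lemma integral_P_mono:
  fixes f g :: "real^'n \<Rightarrow> real"
  assumes "continuous_on P f" "continuous_on P g" "\<And>x. x \<in> interior P \<Longrightarrow> f x \<le> g x"
  shows "(LBINT x:P. f x) \<le> (LBINT x:P. g x)"
  unfolding set_lebesgue_integral_def
proof (rule integral_mono_AE)
  show "AE x in lborel. indicator P x *\<^sub>R f x \<le> indicator P x *\<^sub>R g x"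
    using AE_P_interior by eventually_elim (auto simp: indicator_def assms(3))
qed (use set_integrable_P assms in \<open>auto simp: set_integrable_def\<close>)

abbreviation (input) bdry_mean :: "(real^'n \<Rightarrow> real) \<Rightarrow> (real^'n \<Rightarrow> real) \<Rightarrow> real" where
  "bdry_mean w u \<equiv> \<Sum>j<d. face_mean j (\<lambda>x. w x * u x)"

text \<open>Off the other facets, short moves orthogonal to \<open>nrm j\<close> stay on the facet,
  so all tangential derivatives of \<open>g\<close> are 0.\<close>

lemma facet_gradient_normal:
  assumes U: "open U" "P \<subseteq> U" and g: "Ck_on (Suc 0) U g" and j: "j < d"
    and \<xi>: "\<xi> \<in> P" "L j \<xi> = 0" "\<And>k. k < d \<Longrightarrow> k \<noteq> j \<Longrightarrow> 0 < L k \<xi>"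
    and zero: "\<And>\<eta>. \<eta> \<in> P \<Longrightarrow> L j \<eta> = 0 \<Longrightarrow> g \<eta> = 0"
  obtains \<beta> where "\<And>i. partial i g \<xi> = \<beta> * nrm j $ i"
proof -
  define \<gamma> where "\<gamma> = (\<chi> i. partial i g \<xi>)"
  have tangential: "\<gamma> \<bullet> h = 0" if h: "nrm j \<bullet> h = 0" for h
  proof -
    have "open {x. \<forall>k\<in>{..<d} - {j}. L k x > 0}"
    proof -
      have "{x. \<forall>k\<in>{..<d} - {j}. L k x > 0} = (\<Inter>k\<in>{..<d} - {j}. {x. L k x > 0})" by auto
      then show ?thesis by (auto intro!: open_INT open_Collect_less continuous_intros)
    qed
    from eventually_line_in_open[OF this, of \<xi> 0 h]
    have "\<forall>\<^sub>F t in nhds 0. \<forall>k\<in>{..<d} - {j}. L k (\<xi> + t *\<^sub>R h) > 0" using \<xi>(3) by simp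
    then have ev: "\<forall>\<^sub>F t in nhds 0. g (\<xi> + t *\<^sub>R h) = 0"
    proof eventually_elim
      case (elim t)
      have Lj: "L j (\<xi> + t *\<^sub>R h) = 0" using \<xi>(2) h by (simp add: L_add)
      have "\<xi> + t *\<^sub>R h \<in> P"
        unfolding polytope_of_def
      proof (intro CollectI allI impI)
        fix k assume "k < d"
        then show "0 \<le> L k (\<xi> + t *\<^sub>R h)" using elim Lj by (cases "k = j") (auto intro: less_imp_le)
      qed
      then show ?case using zero Lj by blast
    qed
    have "((\<lambda>t. g (\<xi> + t *\<^sub>R h)) has_real_derivative (\<Sum>i\<in>UNIV. h $ i * partial i g (\<xi> + 0 *\<^sub>R h))) (at 0)"
      using U \<xi>(1) by (intro C1_line_derivative[OF U(1) g]) auto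
    moreover have "((\<lambda>t. g (\<xi> + t *\<^sub>R h)) has_real_derivative 0) (at 0)"
      using DERIV_cong_ev[OF refl ev refl] by simp
    ultimately have "(\<Sum>i\<in>UNIV. h $ i * partial i g (\<xi> + 0 *\<^sub>R h)) = 0" by (rule DERIV_unique)
    then show ?thesis by (simp add: \<gamma>_def inner_vec_def mult.commute)
  qed
  define \<beta> where "\<beta> = (\<gamma> \<bullet> nrm j) / (nrm j \<bullet> nrm j)"
  \<comment> \<open>The tangential part of the gradient \<gamma>. It is orthogonal to
    \<open>nrm j\<close> by construction and to \<gamma> by the previous step, hence to
    itself.\<close>
  define h where "h = \<gamma> - \<beta> *\<^sub>R nrm j"
  have nh: "nrm j \<bullet> h = 0"
    using nrm_nonzero[OF j] by (simp add: h_def \<beta>_def inner_diff_right inner_commute)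
  have "h \<bullet> h = \<gamma> \<bullet> h - \<beta> * (nrm j \<bullet> h)" by (simp add: h_def inner_diff_left)
  then have "h = 0" using tangential[OF nh] nh by simp
  then have "\<gamma> = \<beta> *\<^sub>R nrm j" by (simp add: h_def)
  then have "\<gamma> $ i = \<beta> * nrm j $ i" for i by simp
  then show thesis using that[of \<beta>] by (simp add: \<gamma>_def)
qed

text \<open>On a facet the first derivatives of the rows of \<open>A\<close> contracted with the normal are themselves
  normal, so the divergence is determined by the single normal derivative.\<close>

lemma facet_flux:
  assumes U: "open U" "P \<subseteq> U" and A: "\<And>i k. Ck_on (Suc 0) U (A i k)" and j: "j < d"
    and \<xi>: "\<xi> \<in> P" "L j \<xi> = 0" "\<And>k. k < d \<Longrightarrow> k \<noteq> j \<Longrightarrow> 0 < L k \<xi>"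
    and zero: "\<And>\<eta> k. \<eta> \<in> P \<Longrightarrow> L j \<eta> = 0 \<Longrightarrow> (\<Sum>i\<in>UNIV. nrm j $ i * A i k \<eta>) = 0"
    and normal: "((\<lambda>t. \<Sum>k\<in>UNIV. nrm j $ k * (\<Sum>i\<in>UNIV. nrm j $ i * A i k (\<xi> + t *\<^sub>R nrm j)))
      has_real_derivative 2 * a * (nrm j \<bullet> nrm j)) (at 0)"
  shows "(\<Sum>i\<in>UNIV. \<Sum>k\<in>UNIV. nrm j $ i * partial k (A i k) \<xi>) = 2 * a"
proof -
  define p where "p k x = (\<Sum>i\<in>UNIV. nrm j $ i * A i k x)" for k x
  have p: "Ck_on (Suc 0) U (p k)" for k
    unfolding p_def by (intro Ck_on_sum Ck_on_mult Ck_on_const A U)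
  have "\<exists>\<beta>. \<forall>i. partial i (p k) \<xi> = \<beta> * nrm j $ i" for k
  proof (rule facet_gradient_normal[OF U p j \<xi>])
    show "p k \<eta> = 0" if "\<eta> \<in> P" "L j \<eta> = 0" for \<eta>
      unfolding p_def by (rule zero[OF that])
  qed blast+
  then obtain \<beta> where \<beta>: "\<And>k i. partial i (p k) \<xi> = \<beta> k * nrm j $ i" by metis
  have \<xi>U: "\<xi> \<in> U" using U \<xi> by blast
  have dp: "partial l (p k) \<xi> = (\<Sum>i\<in>UNIV. nrm j $ i * partial l (A i k) \<xi>)" for l k
    unfolding p_def
    by (subst partial_sum[OF Ck_on_mult[OF U(1) Ck_on_const[OF U(1)] A] \<xi>U])
      (simp add: partial_mult[OF Ck_on_const[OF U(1)] A \<xi>U] partial_const, simp add: mult.commute)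
  have "((\<lambda>t. \<Sum>k\<in>UNIV. nrm j $ k * p k (\<xi> + t *\<^sub>R nrm j)) has_real_derivative
      (\<Sum>k\<in>UNIV. nrm j $ k * (\<Sum>i\<in>UNIV. nrm j $ i * partial i (p k) (\<xi> + 0 *\<^sub>R nrm j)))) (at 0)"
    using \<xi>U by (intro DERIV_sum DERIV_cmult C1_line_derivative[OF U(1) p]) simp
  from DERIV_unique[OF this normal[folded p_def]]
  have "(\<Sum>k\<in>UNIV. nrm j $ k * (\<Sum>i\<in>UNIV. nrm j $ i * partial i (p k) \<xi>)) = 2 * a * (nrm j \<bullet> nrm j)"
    by simp
  also have "(\<Sum>k\<in>UNIV. nrm j $ k * (\<Sum>i\<in>UNIV. nrm j $ i * partial i (p k) \<xi>)) =
      (\<Sum>k\<in>UNIV. nrm j $ k * \<beta> k) * (nrm j \<bullet> nrm j)"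
  proof -
    have "(\<Sum>i\<in>UNIV. nrm j $ i * partial i (p k) \<xi>) = \<beta> k * (nrm j \<bullet> nrm j)" for k
      by (simp add: \<beta> inner_vec_def sum_distrib_left mult_ac)
    then show ?thesis by (simp add: sum_distrib_right mult.assoc)
  qed
  \<comment> \<open>The gradient of \<open>p k\<close> being \<open>\<beta> k\<close> times the
    normal, this sum is both the divergence of \<open>p\<close> and the normal derivative divided by
    \<open>nrm j \<bullet> nrm j\<close>.\<close>
  finally have "(\<Sum>k\<in>UNIV. nrm j $ k * \<beta> k) = 2 * a" using nrm_nonzero[OF j] by simp
  moreover have "(\<Sum>i\<in>UNIV. \<Sum>k\<in>UNIV. nrm j $ i * partial k (A i k) \<xi>) = (\<Sum>k\<in>UNIV. partial k (p k) \<xi>)"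
    unfolding dp by (rule sum.swap)
  ultimately show ?thesis by (simp add: \<beta> mult.commute)
qed

text \<open>Green's second identity. The field \<open>X\<close> has divergence
  \<open>energy A u - div2 A * u\<close>, as the first order terms cancel by symmetry of
  \<open>A\<close>. On a facet, \<open>zero\<close> removes the term with the gradient of
  \<open>u\<close>, and \<open>facet_flux\<close> evaluates the other one to
  \<open>- 2 * w * u\<close>.\<close>

lemma energy_identity:
  assumes U: "open U" "P \<subseteq> U" and A: "\<And>i k. Ck_on 2 U (A i k)" and u: "Ck_on 2 U u"
    and sym: "\<And>x i k. x \<in> P \<Longrightarrow> A i k x = A k i x"
    and w: "continuous_on P w"
    and zero: "\<And>j \<eta> k. j < d \<Longrightarrow> \<eta> \<in> P \<Longrightarrow> L j \<eta> = 0 \<Longrightarrow> (\<Sum>i\<in>UNIV. nrm j $ i * A i k \<eta>) = 0"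
    and normal: "\<And>j \<xi>. j < d \<Longrightarrow> \<xi> \<in> P \<Longrightarrow> L j \<xi> = 0 \<Longrightarrow>
      ((\<lambda>t. \<Sum>k\<in>UNIV. nrm j $ k * (\<Sum>i\<in>UNIV. nrm j $ i * A i k (\<xi> + t *\<^sub>R nrm j)))
        has_real_derivative 2 * w \<xi> * (nrm j \<bullet> nrm j)) (at 0)"
  shows "(LBINT x:P. energy A u x) =
    2 * bdry_mean w u +
    (LBINT x:P. div2 A x * u x)"
proof -
  have A1: "Ck_on (Suc 0) U (A i k)" and A1': "Ck_on (Suc 0) U (partial l (A i k))" for i k l
    using A[of i k] by (auto simp: numeral_2_eq_2)
  have u1: "Ck_on (Suc 0) U u" and u1': "Ck_on (Suc 0) U (partial l u)" for l
    using u by (auto simp: numeral_2_eq_2)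
  define X where "X i x = (\<Sum>k\<in>UNIV. A i k x * partial k u x - partial k (A i k) x * u x)" for i x
  have X: "Ck_on (Suc 0) U (X i)" for i
    unfolding X_def by (intro Ck_on_sum Ck_on_diff Ck_on_mult A1 A1' u1 u1' U)
  have cont: "continuous_on P (A i k)" "continuous_on P (partial l (partial k u))"
    "continuous_on P u" "continuous_on P (partial l (partial m (A i k)))" "continuous_on P (partial i (X i))" for i k l m
  proof -
    have "continuous_on U (A i k)" "continuous_on U (partial l (partial k u))"
      "continuous_on U u" "continuous_on U (partial l (partial m (A i k)))" "continuous_on U (partial i (X i))"
      using A1[of i k] u1 u1'[of k] A1'[of m i k] X[of i] by auto
    then show "continuous_on P (A i k)" "continuous_on P (partial l (partial k u))"
      "continuous_on P u" "continuous_on P (partial l (partial m (A i k)))" "continuous_on P (partial i (X i))"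
      using U(2) continuous_on_subset by blast+
  qed
  let ?Q = "\<lambda>x. energy A u x"
  let ?R = "\<lambda>x. div2 A x * u x"
  have contQ: "continuous_on P ?Q" unfolding hessian_nth by (intro continuous_intros cont)
  have contR: "continuous_on P ?R" by (intro continuous_intros cont)
  have div: "(\<Sum>i\<in>UNIV. partial i (X i) x) = ?Q x - ?R x" if x: "x \<in> interior P" for x
  proof -
    have xU: "x \<in> U" using x interior_subset U(2) by blast
    \<comment> \<open>Symmetry is known on \<open>P\<close> only; differentiating it requires the
      open interior.\<close>
    have symd: "partial k (A k i) x = partial k (A i k) x" for i k
      using partial_cong(1)[OF open_interior x, of "A k i" "A i k"] sym interior_subset by blast
    have "(\<Sum>i\<in>UNIV. \<Sum>k\<in>UNIV. partial i (A i k) x * partial k u x) =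
        (\<Sum>k\<in>UNIV. \<Sum>i\<in>UNIV. partial i (A i k) x * partial k u x)"
      by (rule sum.swap)
    also have "\<dots> = (\<Sum>i\<in>UNIV. \<Sum>k\<in>UNIV. partial k (A i k) x * partial i u x)"
      by (simp add: symd)
    finally have swap: "(\<Sum>i\<in>UNIV. \<Sum>k\<in>UNIV. partial i (A i k) x * partial k u x) =
        (\<Sum>i\<in>UNIV. \<Sum>k\<in>UNIV. partial k (A i k) x * partial i u x)" .
    have "partial i (X i) x = (\<Sum>k\<in>UNIV. partial i (A i k) x * partial k u x + partial i (partial k u) x * A i k x
        - (partial i (partial k (A i k)) x * u x + partial i u x * partial k (A i k) x))" for i
    proof -
      have 1: "Ck_on (Suc 0) U (\<lambda>x. A i k x * partial k u x)" "Ck_on (Suc 0) U (\<lambda>x. partial k (A i k) x * u x)" for k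
        by (intro Ck_on_mult A1 A1' u1 u1' U)+
      show ?thesis
        unfolding X_def
        by (subst partial_sum[OF Ck_on_diff[OF U(1) 1] xU])
          (simp add: partial_diff[OF 1 xU] partial_mult[OF A1 u1' xU] partial_mult[OF A1' u1 xU])
    qed
    then have "(\<Sum>i\<in>UNIV. partial i (X i) x) =
        (\<Sum>i\<in>UNIV. \<Sum>k\<in>UNIV. partial i (A i k) x * partial k u x) + ?Q x - ?R x
        - (\<Sum>i\<in>UNIV. \<Sum>k\<in>UNIV. partial k (A i k) x * partial i u x)"
      by (simp add: hessian_nth sum.distrib sum_subtractf sum_distrib_right sum_distrib_left mult_ac)
    then show ?thesis using swap by simp
  qed
  have "(LBINT x:P. \<Sum>i\<in>UNIV. partial i (X i) x) = (LBINT x:P. ?Q x - ?R x)"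
    by (rule integral_P_cong) (use div in \<open>auto intro!: continuous_intros cont contQ contR simp del: sum_subtractf\<close>)
  also have "\<dots> = (LBINT x:P. ?Q x) - (LBINT x:P. ?R x)"
    by (rule set_integral_diff(2)[OF set_integrable_P[OF contQ] set_integrable_P[OF contR]])
  finally have 1: "(LBINT x:P. ?Q x) - (LBINT x:P. ?R x) =
      - (\<Sum>j<d. face_mean j (\<lambda>x. \<Sum>i\<in>UNIV. nrm j $ i * X i x))"
    using divergence_theorem[OF U X] by simp
  have "face_mean j (\<lambda>x. \<Sum>i\<in>UNIV. nrm j $ i * X i x) = face_mean j (\<lambda>x. (- 2) * (w x * u x))" if j: "j < d" for j
  proof (rule face_mean_cong[OF j])
    fix \<xi> assume \<xi>: "\<xi> \<in> P" "L j \<xi> = 0" "\<And>k. k < d \<Longrightarrow> k \<noteq> j \<Longrightarrow> 0 < L k \<xi>"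
    have "(\<Sum>i\<in>UNIV. nrm j $ i * X i \<xi>) =
        (\<Sum>i\<in>UNIV. \<Sum>k\<in>UNIV. nrm j $ i * A i k \<xi> * partial k u \<xi>)
        - (\<Sum>i\<in>UNIV. \<Sum>k\<in>UNIV. nrm j $ i * partial k (A i k) \<xi>) * u \<xi>"
      by (simp add: X_def sum_distrib_left sum_distrib_right sum_subtractf right_diff_distrib mult_ac)
    also have "(\<Sum>i\<in>UNIV. \<Sum>k\<in>UNIV. nrm j $ i * A i k \<xi> * partial k u \<xi>) =
        (\<Sum>k\<in>UNIV. (\<Sum>i\<in>UNIV. nrm j $ i * A i k \<xi>) * partial k u \<xi>)"
      unfolding sum_distrib_right by (rule sum.swap)
    also have "\<dots> = 0" using zero[OF j \<xi>(1,2)] by simp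
    also have "(\<Sum>i\<in>UNIV. \<Sum>k\<in>UNIV. nrm j $ i * partial k (A i k) \<xi>) = 2 * w \<xi>"
      by (rule facet_flux[OF U A1 j \<xi>]) (use zero[OF j] normal[OF j \<xi>(1,2)] in auto)
    finally show "(\<Sum>i\<in>UNIV. nrm j $ i * X i \<xi>) = (- 2) * (w \<xi> * u \<xi>)" by simp
  qed
  then have "(\<Sum>j<d. face_mean j (\<lambda>x. \<Sum>i\<in>UNIV. nrm j $ i * X i x)) = (\<Sum>j<d. (- 2) * face_mean j (\<lambda>x. w x * u x))"
    by (simp only: face_mean_cmult cong: sum.cong) (auto intro!: sum.cong)
  with 1 show ?thesis by (simp add: sum_distrib_left sum_negf)
qed

text \<open>The divergence theorem for \<open>u\<close> times the radial field
  \<open>x - x0\<close>. On the facet \<open>L j = 0\<close> the flux of the radial field is the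
  constant \<open>- L j x0\<close>.\<close>

lemma radial_identity:
  assumes U: "open U" "P \<subseteq> U" and u: "Ck_on (Suc 0) U u"
  shows "(LBINT x:P. real CARD('n) * u x + (\<Sum>i\<in>UNIV. (x - x0) $ i * partial i u x)) =
    (\<Sum>j<d. L j x0 * face_mean j u)"
proof -
  \<comment> \<open>The coordinate \<open>(x - x0) $ i\<close> is written in the shape to which
    \<open>Ck_on_affine\<close> and \<open>partial_affine\<close> apply.\<close>
  define X where "X i x = (axis i 1 \<bullet> x + - x0 $ i) * u x" for i x
  have aff: "Ck_on (Suc 0) U (\<lambda>x. axis i 1 \<bullet> x + - x0 $ i)" for i by (rule Ck_on_affine[OF U(1)])
  have X: "Ck_on (Suc 0) U (X i)" for i
    unfolding X_def by (rule Ck_on_mult[OF U(1) aff u])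
  have ev: "axis i 1 \<bullet> x = x $ i" for x :: "real^'n" and i by (simp add: inner_axis')
  have div: "(\<Sum>i\<in>UNIV. partial i (X i) x) = real CARD('n) * u x + (\<Sum>i\<in>UNIV. (x - x0) $ i * partial i u x)"
    if "x \<in> P" for x
  proof -
    have "partial i (X i) x = u x + (x - x0) $ i * partial i u x" for i
    proof -
      have "partial i (X i) x = partial i (\<lambda>x. axis i 1 \<bullet> x + - x0 $ i) x * u x
          + partial i u x * (axis i 1 \<bullet> x + - x0 $ i)"
        unfolding X_def using that U(2) by (intro partial_mult[OF aff u]) auto
      also have "\<dots> = u x + (x - x0) $ i * partial i u x"
        by (simp only: partial_affine) (simp add: ev algebra_simps)
      finally show ?thesis .
    qed
    then show ?thesis by (simp add: sum.distrib)
  qed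
  have "(LBINT x:P. real CARD('n) * u x + (\<Sum>i\<in>UNIV. (x - x0) $ i * partial i u x)) =
      (LBINT x:P. \<Sum>i\<in>UNIV. partial i (X i) x)"
    by (rule set_lebesgue_integral_cong) (auto simp: div)
  also have "\<dots> = - (\<Sum>j<d. face_mean j (\<lambda>x. \<Sum>i\<in>UNIV. nrm j $ i * X i x))"
    by (rule divergence_theorem[OF U X])
  also have "(\<Sum>j<d. face_mean j (\<lambda>x. \<Sum>i\<in>UNIV. nrm j $ i * X i x)) = (\<Sum>j<d. (- L j x0) * face_mean j u)"
  proof (rule sum.cong)
    fix j assume "j \<in> {..<d}"
    then have j: "j < d" by simp
    have "face_mean j (\<lambda>x. \<Sum>i\<in>UNIV. nrm j $ i * X i x) = face_mean j (\<lambda>x. (- L j x0) * u x)"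
    proof (rule face_mean_cong[OF j])
      fix \<xi> assume "L j \<xi> = 0"
      have "(\<Sum>i\<in>UNIV. nrm j $ i * X i \<xi>) = (nrm j \<bullet> (\<xi> - x0)) * u \<xi>"
      proof -
        have "X i \<xi> = (\<xi> - x0) $ i * u \<xi>" for i by (simp add: X_def ev)
        then show ?thesis by (simp add: inner_vec_def sum_distrib_right mult.assoc)
      qed
      also have "nrm j \<bullet> (\<xi> - x0) = L j \<xi> - L j x0" by (simp add: Lfun_def inner_diff_right)
      finally show "(\<Sum>i\<in>UNIV. nrm j $ i * X i \<xi>) = (- L j x0) * u \<xi>" using \<open>L j \<xi> = 0\<close> by simp
    qed
    then show "face_mean j (\<lambda>x. \<Sum>i\<in>UNIV. nrm j $ i * X i x) = (- L j x0) * face_mean j u"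
      by (simp only: face_mean_cmult)
  qed simp
  finally show ?thesis by (simp add: sum_negf)
qed


section \<open>The affine function with prescribed moments\<close>

lemma continuous_nonneg_integral_P_eq_0:
  fixes h :: "real^'n \<Rightarrow> real"
  assumes h: "continuous_on P h" "\<And>x. x \<in> P \<Longrightarrow> 0 \<le> h x" and 0: "(LBINT x:P. h x) = 0"
    and x: "x \<in> interior P"
  shows "h x = 0"
proof -
  obtain a b where "cbox a b \<subseteq> interior P" and ab1: "x \<in> box a b"
    by (rule open_contains_cbox[OF open_interior x])
  then have ab: "x \<in> box a b" "cbox a b \<subseteq> P" using interior_subset by auto
  have intP: "h integrable_on P" and eq: "integral P h = 0"
    using set_borel_integral_eq_integral[OF set_integrable_P[OF h(1)]] 0 by auto
  have contQ: "continuous_on (cbox a b) h" using h(1) ab(2) continuous_on_subset by blast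
  have nonneg: "0 \<le> h y" if "y \<in> cbox a b" for y using h(2) ab(2) that by blast
  have "integral (cbox a b) h \<le> integral P h"
    by (rule integral_subset_le[OF ab(2) integrable_continuous[OF contQ] intP]) (use h(2) in auto)
  moreover have "0 \<le> integral (cbox a b) h"
    by (rule integral_nonneg[OF integrable_continuous[OF contQ] nonneg])
  ultimately have "integral (cbox a b) h = 0" using eq by simp
  moreover have "box a b \<noteq> {}" using ab(1) by blast
  ultimately have "\<forall>y\<in>cbox a b. h y = 0" using integral_cbox_eq_0_iff[OF contQ] nonneg by blast
  then show ?thesis using ab(1) box_subset_cbox by blast
qed

lemma interior_P_nonempty: "interior P \<noteq> {}"
  using simple by (simp add: simple_labelled_polytope_def)

text \<open>A short move from an interior point in the direction \<open>a\<close> stays in the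
  interior and changes the value by \<open>t * (a \<bullet> a)\<close>.\<close>

lemma affine_zero_on_interior:
  assumes "\<And>x. x \<in> interior P \<Longrightarrow> a \<bullet> x + b = 0"
  shows "a = 0" "b = 0"
proof -
  obtain y where y: "y \<in> interior P" using interior_P_nonempty by blast
  have "\<forall>\<^sub>F t in at_right 0. y + t *\<^sub>R a \<in> interior P"
    using eventually_line_in_open[OF open_interior, of y 0 a P] y
    by (simp add: eventually_at_filter) (auto elim: eventually_mono)
  then have "\<forall>\<^sub>F t in at_right (0::real). 0 < t \<and> y + t *\<^sub>R a \<in> interior P"
    using eventually_at_right_less[of "0::real"] by eventually_elim simp
  then obtain t :: real where t: "0 < t" "y + t *\<^sub>R a \<in> interior P"
    using eventually_happens'[OF trivial_limit_at_right_real] by blast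
  have "a \<bullet> y + t * (a \<bullet> a) + b = 0" using assms[OF t(2)] by (simp add: inner_add_right)
  then have "t * (a \<bullet> a) = 0" using assms[OF y] by linarith
  then show "a = 0" using t by simp
  then show "b = 0" using assms[OF y] by simp
qed

lemma integral_P_affine_expand:
  fixes k :: "real^'n \<Rightarrow> real"
  assumes k: "continuous_on P k"
  shows "(LBINT x:P. k x * (a \<bullet> x + b)) = (\<Sum>i\<in>UNIV. a $ i * (LBINT x:P. k x * x $ i)) + b * (LBINT x:P. k x)"
proof -
  have c: "continuous_on P (\<lambda>x. k x * x $ i)" for i by (intro continuous_intros k)
  have "(LBINT x:P. k x * (a \<bullet> x + b)) = (LBINT x:P. (\<Sum>i\<in>UNIV. a $ i * (k x * x $ i)) + b * k x)"
    by (simp add: inner_vec_def sum_distrib_left algebra_simps)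
  also have "\<dots> = (LBINT x:P. (\<Sum>i\<in>UNIV. a $ i * (k x * x $ i))) + (LBINT x:P. b * k x)"
    by (intro set_integral_add(2) set_integrable_P continuous_intros c k)
  also have "(LBINT x:P. (\<Sum>i\<in>UNIV. a $ i * (k x * x $ i))) = (\<Sum>i\<in>UNIV. LBINT x:P. a $ i * (k x * x $ i))"
    by (intro set_lebesgue_integral_sum set_integrable_P continuous_intros c)
  finally show ?thesis by simp
qed

text \<open>The moments of order at most 1 of \<open>s * g\<close> depend linearly and injectively on the affine function
  \<open>s\<close>, hence surjectively.\<close>

lemma ex1_affine_representative:
  assumes g: "continuous_on P g" "\<And>x. x \<in> P \<Longrightarrow> 0 < g x" and r: "continuous_on P r"
  shows "\<exists>!s. affine_fun s \<and> (\<forall>\<phi>. affine_fun \<phi> \<longrightarrow>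
    (LBINT x:P. r x * \<phi> x) = (LBINT x:P. s x * \<phi> x * g x))"
proof -
  \<comment> \<open>The pair \<open>p\<close> encodes the affine function
    \<open>fst p \<bullet> x + snd p\<close>, and \<open>M\<close> records its first and zeroth
    moments against \<open>g\<close>.\<close>
  define M :: "(real^'n) \<times> real \<Rightarrow> (real^'n) \<times> real" where
    "M p = (\<chi> i. LBINT x:P. g x * x $ i * (fst p \<bullet> x + snd p), LBINT x:P. g x * (fst p \<bullet> x + snd p))" for p
  have cg: "continuous_on P (\<lambda>x. g x * x $ i)" for i by (intro continuous_intros g)
  have cgp: "continuous_on P (\<lambda>x. g x * (a \<bullet> x + b))" for a b by (intro continuous_intros g)
  have M: "fst (M p) $ i = (LBINT x:P. g x * x $ i * (fst p \<bullet> x + snd p))"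
    "snd (M p) = (LBINT x:P. g x * (fst p \<bullet> x + snd p))" for p i
    by (simp_all add: M_def)
  have M': "fst (M p) $ i = (\<Sum>l\<in>UNIV. fst p $ l * (LBINT x:P. g x * x $ i * x $ l)) + snd p * (LBINT x:P. g x * x $ i)"
    "snd (M p) = (\<Sum>l\<in>UNIV. fst p $ l * (LBINT x:P. g x * x $ l)) + snd p * (LBINT x:P. g x)" for p i
    unfolding M integral_P_affine_expand[OF cg] integral_P_affine_expand[OF g(1)] by (rule refl)+
  have lin: "linear M"
    by (rule linearI) (simp_all add: prod_eq_iff vec_eq_iff M' sum.distrib sum_distrib_left algebra_simps)
  \<comment> \<open>For \<open>(a, b) = p\<close> the left side is the integral of \<open>g\<close>
    times a square, so the kernel of \<open>M\<close> is trivial.\<close>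
  have pair: "(LBINT x:P. g x * (fst p \<bullet> x + snd p) * (a \<bullet> x + b)) = a \<bullet> fst (M p) + b * snd (M p)" for p a b
    unfolding integral_P_affine_expand[OF cgp] by (simp add: inner_vec_def M mult_ac)
  have inj: "p = 0" if "M p = 0" for p
  proof -
    have "(LBINT x:P. g x * (fst p \<bullet> x + snd p) * (fst p \<bullet> x + snd p)) = 0"
      unfolding pair that by simp
    moreover have "continuous_on P (\<lambda>x. g x * (fst p \<bullet> x + snd p) * (fst p \<bullet> x + snd p))"
      by (intro continuous_intros g)
    moreover have "0 \<le> g x * (fst p \<bullet> x + snd p) * (fst p \<bullet> x + snd p)" if "x \<in> P" for x
      using g(2)[OF that] by (simp add: mult.assoc)
    ultimately have "g x * (fst p \<bullet> x + snd p) * (fst p \<bullet> x + snd p) = 0" if "x \<in> interior P" for x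
      using continuous_nonneg_integral_P_eq_0 that by blast
    moreover have "g x \<noteq> 0" if "x \<in> interior P" for x
      using g(2)[of x] that interior_subset by (metis less_irrefl subsetD)
    ultimately have "fst p \<bullet> x + snd p = 0" if "x \<in> interior P" for x
      using that by (metis mult_eq_0_iff)
    from affine_zero_on_interior[OF this] show ?thesis by (simp add: prod_eq_iff)
  qed
  have surj: "surj M"
  proof (rule linear_injective_imp_surjective[OF lin])
    show "inj M" using inj linear_injective_0[OF lin] by blast
  qed (rule refl)
  show ?thesis
  proof (rule ex_ex1I)
    have "\<exists>p. (\<chi> i. LBINT x:P. r x * x $ i, LBINT x:P. r x) = M p"
      by (rule surjD[OF surj])
    then obtain p where p: "M p = (\<chi> i. LBINT x:P. r x * x $ i, LBINT x:P. r x)"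
      by (elim exE) (drule sym)
    show "\<exists>s. affine_fun s \<and> (\<forall>\<phi>. affine_fun \<phi> \<longrightarrow>
        (LBINT x:P. r x * \<phi> x) = (LBINT x:P. s x * \<phi> x * g x))"
    proof (intro exI[of _ "\<lambda>x. fst p \<bullet> x + snd p"] conjI allI impI)
      show "affine_fun (\<lambda>x. fst p \<bullet> x + snd p)" by (auto simp: affine_fun_def)
      fix \<phi> :: "real^'n \<Rightarrow> real" assume "affine_fun \<phi>"
      then obtain a b where \<phi>: "\<phi> = (\<lambda>x. a \<bullet> x + b)" by (auto simp: affine_fun_def)
      have "(LBINT x:P. r x * \<phi> x) = a \<bullet> fst (M p) + b * snd (M p)"
        unfolding \<phi> integral_P_affine_expand[OF r] p by (simp add: inner_vec_def)
      also have "\<dots> = (LBINT x:P. (fst p \<bullet> x + snd p) * \<phi> x * g x)"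
        unfolding pair[symmetric] \<phi> by (simp add: mult_ac)
      finally show "(LBINT x:P. r x * \<phi> x) = (LBINT x:P. (fst p \<bullet> x + snd p) * \<phi> x * g x)" .
    qed
  next
    fix s s' :: "real^'n \<Rightarrow> real"
    assume s: "affine_fun s \<and> (\<forall>\<phi>. affine_fun \<phi> \<longrightarrow> (LBINT x:P. r x * \<phi> x) = (LBINT x:P. s x * \<phi> x * g x))"
      and s': "affine_fun s' \<and> (\<forall>\<phi>. affine_fun \<phi> \<longrightarrow> (LBINT x:P. r x * \<phi> x) = (LBINT x:P. s' x * \<phi> x * g x))"
    obtain a b where sd: "s = (\<lambda>x. a \<bullet> x + b)" using s by (auto simp: affine_fun_def)
    obtain a' b' where sd': "s' = (\<lambda>x. a' \<bullet> x + b')" using s' by (auto simp: affine_fun_def)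
    have *: "\<alpha> \<bullet> fst (M (a, b)) + \<beta> * snd (M (a, b)) = \<alpha> \<bullet> fst (M (a', b')) + \<beta> * snd (M (a', b'))" for \<alpha> \<beta>
    proof -
      have "affine_fun (\<lambda>x. \<alpha> \<bullet> x + \<beta>)" by (auto simp: affine_fun_def)
      then have "(LBINT x:P. s x * (\<alpha> \<bullet> x + \<beta>) * g x) = (LBINT x:P. s' x * (\<alpha> \<bullet> x + \<beta>) * g x)"
        using s[THEN conjunct2, rule_format, of "\<lambda>x. \<alpha> \<bullet> x + \<beta>"]
          s'[THEN conjunct2, rule_format, of "\<lambda>x. \<alpha> \<bullet> x + \<beta>"] by simp
      then show ?thesis unfolding pair[symmetric] sd sd' by (simp add: mult_ac)
    qed
    have "snd (M (a, b)) = snd (M (a', b'))" using *[of 0 1] by simp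
    moreover have "fst (M (a, b)) = fst (M (a', b'))"
    proof -
      have "\<forall>\<alpha>. \<alpha> \<bullet> fst (M (a, b)) = \<alpha> \<bullet> fst (M (a', b'))" using *[of _ 0] by simp
      then show ?thesis by (simp only: vector_eq_ldot)
    qed
    ultimately have "M ((a, b) - (a', b')) = 0"
      unfolding linear_diff[OF lin] by (simp add: prod_eq_iff)
    from inj[OF this] show "s = s'" by (simp add: sd sd' zero_prod_def)
  qed
qed

section \<open>Coercivity on the core and the radial estimate\<close>

lemma coercive_on_core:
  fixes A :: "'n \<Rightarrow> 'n \<Rightarrow> real^'n \<Rightarrow> real"
  assumes A: "\<And>i k. continuous_on P (A i k)" and \<kappa>: "0 < \<kappa>"
    and pos: "\<And>x v. x \<in> interior P \<Longrightarrow> v \<noteq> 0 \<Longrightarrow> 0 < v \<bullet> ((\<chi> i k. A i k x) *v v)"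
  obtains a where "0 < a" "\<And>x v. x \<in> core \<kappa> \<Longrightarrow> a * (v \<bullet> v) \<le> v \<bullet> ((\<chi> i k. A i k x) *v v)"
proof (cases "core \<kappa> = {}")
  case True
  then show thesis using that[of 1] by simp
next
  case False
  define q where "q p = (\<Sum>i\<in>UNIV. \<Sum>k\<in>UNIV. snd p $ i * (A i k (fst p) * snd p $ k))" for p :: "(real^'n) \<times> (real^'n)"
  have q: "q (x, v) = v \<bullet> ((\<chi> i k. A i k x) *v v)" for x v
    by (simp add: q_def inner_vec_def matrix_vector_mult_def sum_distrib_left)
  \<comment> \<open>On this compact set the form has a positive minimum, and homogeneity extends the
    bound to all vectors. Only a core is possible: the matrices to which this is applied degenerate
    in the normal direction on the facets.\<close>
  let ?K = "core \<kappa> \<times> sphere (0::real^'n) 1"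
  have cA: "continuous_on ?K (\<lambda>p. A i k (fst p))" for i k
    by (rule continuous_on_compose2[OF A]) (use core_subset_P[OF \<kappa>] in \<open>auto intro!: continuous_intros\<close>)
  have "continuous_on ?K q"
    unfolding q_def by (intro continuous_intros cA)
  moreover have "compact ?K" by (intro compact_Times compact_core[OF \<kappa>] compact_sphere)
  moreover have "?K \<noteq> {}" using False by (auto simp: sphere_eq_empty)
  ultimately obtain p where p: "p \<in> ?K" "\<And>p'. p' \<in> ?K \<Longrightarrow> q p \<le> q p'"
    using continuous_attains_inf[of ?K q] by blast
  have "0 < q p"
  proof -
    have "snd p \<noteq> 0" "fst p \<in> interior P" using p(1) core_subset_interior[OF \<kappa>] by auto
    then show ?thesis using pos q[of "fst p" "snd p"] by simp
  qed
  moreover have "q p * (v \<bullet> v) \<le> v \<bullet> ((\<chi> i k. A i k x) *v v)" if x: "x \<in> core \<kappa>" for x v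
  proof (cases "v = 0")
    case True
    then show ?thesis by simp
  next
    case False
    define e where "e = (1 / norm v) *\<^sub>R v"
    have "norm e = 1" using False by (simp add: e_def)
    then have "q p \<le> e \<bullet> ((\<chi> i k. A i k x) *v e)"
      using p(2)[of "(x, e)"] x by (simp add: q)
    also have "\<dots> = (v \<bullet> ((\<chi> i k. A i k x) *v v)) / (v \<bullet> v)"
      by (simp add: e_def matrix_vector_mult_scaleR dot_square_norm power2_eq_square)
    finally show ?thesis using False by (simp add: pos_le_divide_eq)
  qed
  ultimately show thesis by (rule that)
qed

text \<open>Off the core the energy density is merely nonnegative and is dropped; on the core
  \<open>trace_prod_psd_ge\<close> compares it with the Laplacian.\<close>

lemma energy_lower_bound:
  fixes A :: "'n \<Rightarrow> 'n \<Rightarrow> real^'n \<Rightarrow> real"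
  assumes U: "open U" "P \<subseteq> U" and u: "Ck_on 2 U u" "convex_on P u"
    and A: "\<And>i k. continuous_on P (A i k)" and \<kappa>: "0 < \<kappa>" and a: "0 \<le> a"
    and psd: "\<And>x v. x \<in> interior P \<Longrightarrow> v \<noteq> 0 \<Longrightarrow> 0 < v \<bullet> ((\<chi> i k. A i k x) *v v)"
    and coer: "\<And>x v. x \<in> core \<kappa> \<Longrightarrow> a * (v \<bullet> v) \<le> v \<bullet> ((\<chi> i k. A i k x) *v v)"
  shows "a * integral (core \<kappa>) (laplacian u) \<le>
    (LBINT x:P. energy A u x)"
proof -
  let ?lap = "laplacian u"
  let ?Q = "\<lambda>x. energy A u x"
  have H: "continuous_on P (\<lambda>x. hessian u x $ i $ k)" for i k
    using u(1) U(2) unfolding hessian_nth by (auto simp: numeral_2_eq_2 intro: continuous_on_subset)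
  have contL: "continuous_on (core \<kappa>) ?lap"
    by (intro continuous_on_sum continuous_on_subset[OF H core_subset_P[OF \<kappa>]])
  have intL: "set_integrable lborel (core \<kappa>) ?lap"
    unfolding set_integrable_def by (rule borel_integrable_compact[OF compact_core[OF \<kappa>] contL])
  have intQ: "set_integrable lborel P ?Q" by (intro set_integrable_P continuous_intros A H)
  have "a * integral (core \<kappa>) ?lap = (LBINT x:core \<kappa>. a * ?lap x)"
    using set_borel_integral_eq_integral(2)[OF intL] by simp
  also have "\<dots> \<le> (LBINT x:P. ?Q x)"
    unfolding set_lebesgue_integral_def
  proof (rule integral_mono_AE)
    show "integrable lborel (\<lambda>x. indicator (core \<kappa>) x *\<^sub>R (a * ?lap x))"
      using set_integrable_mult_right[OF intL, of a] by (simp add: set_integrable_def)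
    show "integrable lborel (\<lambda>x. indicator P x *\<^sub>R ?Q x)" using intQ by (simp add: set_integrable_def)
    show "AE x in lborel. indicator (core \<kappa>) x *\<^sub>R (a * ?lap x) \<le> indicator P x *\<^sub>R ?Q x"
      using AE_P_interior
    proof eventually_elim
      case (elim x)
      show ?case
      proof (cases "x \<in> P")
        case True
        then have x: "x \<in> interior P" "x \<in> U" using elim U by auto
        have B: "0 \<le> h \<bullet> (hessian u x *v h)" for h by (rule convex_hessian_psd[OF U(1) u U(2) x(1)])
        have sym: "hessian u x $ i $ k = hessian u x $ k $ i" for i k by (rule hessian_symmetric[OF U(1) u(1) x(2)])
        show ?thesis
        proof (cases "x \<in> core \<kappa>")
          case True
          from trace_prod_psd_ge[OF coer[OF True] B sym] show ?thesis using True \<open>x \<in> P\<close> by simp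
        next
          case False
          have "0 \<le> v \<bullet> ((\<chi> i k. A i k x) *v v)" for v
            using psd[OF x(1), of v] by (cases "v = 0") auto
          from sum_prod_psd_nonneg[OF this B sym] show ?thesis using False True by simp
        qed
      next
        case False
        then have "x \<notin> core \<kappa>" using core_subset_P[OF \<kappa>] by blast
        then show ?thesis using False by simp
      qed
    qed
  qed
  finally show ?thesis .
qed

text \<open>The gradient inequality at \<open>x\<close>, tested at the point moved towards
  \<open>x0\<close>, leaves \<delta> times the radial derivative of \<open>u\<close>. Adding the
  nonnegative \<open>\<delta> * CARD('n) * u x\<close> completes it to a divergence, which
  \<open>radial_identity\<close> turns into a boundary term.\<close>

lemma radial_integral_bound:
  assumes U: "open U" "P \<subseteq> U" and u: "Ck_on 2 U u" "convex_on P u" and pos: "\<And>x. x \<in> P \<Longrightarrow> 0 \<le> u x"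
    and x0: "x0 \<in> P" and \<delta>: "0 \<le> \<delta>" "\<delta> \<le> 1"
  shows "(LBINT x:P. u x) \<le> (LBINT x:P. u (x0 + (1 - \<delta>) *\<^sub>R (x - x0))) + \<delta> * (\<Sum>j<d. L j x0 * face_mean j u)"
proof -
  have u1: "Ck_on (Suc 0) U u" using u(1) by (simp add: numeral_2_eq_2)
  have contu: "continuous_on P u" and contu': "continuous_on P (partial i u)" for i
    using u1 U(2) by (auto intro: continuous_on_subset)
  define D where "D x = (\<Sum>i\<in>UNIV. (x - x0) $ i * partial i u x)" for x
  have contD: "continuous_on P D" unfolding D_def by (intro continuous_intros contu')
  have inP: "x0 + (1 - \<delta>) *\<^sub>R (x - x0) \<in> P" if "x \<in> P" for x
    using convexD_alt[OF convex_P x0 that, of "1 - \<delta>"] \<delta> by (simp add: algebra_simps)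
  have contd: "continuous_on P (\<lambda>x. u (x0 + (1 - \<delta>) *\<^sub>R (x - x0)))"
    by (rule continuous_on_compose2[OF contu]) (use inP in \<open>auto intro!: continuous_intros\<close>)
  have pt: "u x \<le> u (x0 + (1 - \<delta>) *\<^sub>R (x - x0)) + \<delta> * (real CARD('n) * u x + D x)" if x: "x \<in> P" for x
  proof -
    have "x0 + (1 - \<delta>) *\<^sub>R (x - x0) - x = (- \<delta>) *\<^sub>R (x - x0)" by (simp add: algebra_simps)
    then have "(\<Sum>i\<in>UNIV. (x0 + (1 - \<delta>) *\<^sub>R (x - x0) - x) $ i * partial i u x) = - \<delta> * D x"
      by (simp only: D_def sum_distrib_left) (simp add: mult.assoc)
    then have "u x - \<delta> * D x \<le> u (x0 + (1 - \<delta>) *\<^sub>R (x - x0))"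
      using convex_gradient_inequality[OF U(1) u1 u(2) U(2) x inP[OF x]] by simp
    moreover have "0 \<le> \<delta> * (real CARD('n) * u x)" using \<delta> pos[OF x] by simp
    ultimately show ?thesis by (simp add: distrib_left)
  qed
  have "(LBINT x:P. u x) \<le> (LBINT x:P. u (x0 + (1 - \<delta>) *\<^sub>R (x - x0)) + \<delta> * (real CARD('n) * u x + D x))"
    using pt by (intro set_integral_mono set_integrable_P continuous_intros contu contd contD)
  also have "\<dots> = (LBINT x:P. u (x0 + (1 - \<delta>) *\<^sub>R (x - x0))) + (LBINT x:P. \<delta> * (real CARD('n) * u x + D x))"
    by (intro set_integral_add(2) set_integrable_P continuous_intros contu contd contD)
  also have "(LBINT x:P. \<delta> * (real CARD('n) * u x + D x)) = \<delta> * (\<Sum>j<d. L j x0 * face_mean j u)"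
    unfolding D_def using radial_identity[OF U u1, of x0] by simp
  finally show ?thesis .
qed

end

section \<open>Stability\<close>

context simple_polytope
begin

lemma face_mean_nonneg:
  assumes "j < d" "continuous_on P u" "\<And>x. x \<in> P \<Longrightarrow> 0 \<le> u x"
  shows "0 \<le> face_mean j u"
  using face_mean_mono[OF assms(1) continuous_on_const[of P 0] assms(2)] assms(3)
  by (simp add: face_mean_def)

text \<open>The neighbourhood \<open>W\<close> may depend on \<open>u\<close>, the constant
  \<open>lam\<close> may not: the estimate is later applied to dilations whose neighbourhoods shrink
  to \<open>P\<close>.\<close>

lemma C2_stability:
  assumes U: "open U" "P \<subseteq> U" and A: "\<And>i k. Ck_on 2 U (A i k)"
    and sym: "\<And>x i k. x \<in> P \<Longrightarrow> A i k x = A k i x"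
    and w: "continuous_on P w" "\<And>x. x \<in> P \<Longrightarrow> 0 < w x"
    and zero: "\<And>j \<eta> k. j < d \<Longrightarrow> \<eta> \<in> P \<Longrightarrow> L j \<eta> = 0 \<Longrightarrow> (\<Sum>i\<in>UNIV. nrm j $ i * A i k \<eta>) = 0"
    and normal: "\<And>j \<xi>. j < d \<Longrightarrow> \<xi> \<in> P \<Longrightarrow> L j \<xi> = 0 \<Longrightarrow>
      ((\<lambda>t. \<Sum>k\<in>UNIV. nrm j $ k * (\<Sum>i\<in>UNIV. nrm j $ i * A i k (\<xi> + t *\<^sub>R nrm j)))
        has_real_derivative 2 * w \<xi> * (nrm j \<bullet> nrm j)) (at 0)"
    and pos: "\<And>x v. x \<in> interior P \<Longrightarrow> v \<noteq> 0 \<Longrightarrow> 0 < v \<bullet> ((\<chi> i k. A i k x) *v v)"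
    and x0: "x0 \<in> interior P"
  obtains lam where "0 < lam"
    "\<And>u W. \<lbrakk>open W; P \<subseteq> W; Ck_on 2 W u; convex_on P u; u x0 = 0; \<And>x. x \<in> P \<Longrightarrow> 0 \<le> u x\<rbrakk> \<Longrightarrow>
      lam * bdry_mean w u \<le> 2 * bdry_mean w u +
        (LBINT x:P. div2 A x * u x)"
proof -
  have x0P: "x0 \<in> P" using x0 interior_subset by blast
  define \<rho> where "\<rho> x = div2 A x" for x
  have contA: "continuous_on P (A i k)" and contA2: "continuous_on P (partial l (partial m (A i k)))" for i k l m
  proof -
    have "continuous_on U (A i k)" "continuous_on U (partial l (partial m (A i k)))"
      using A[of i k] by (auto simp: numeral_2_eq_2)
    then show "continuous_on P (A i k)" "continuous_on P (partial l (partial m (A i k)))"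
      using U(2) continuous_on_subset by blast+
  qed
  have cont\<rho>: "continuous_on P \<rho>" unfolding \<rho>_def by (intro continuous_intros contA2)
  obtain R where R: "0 \<le> R" "\<And>x. x \<in> P \<Longrightarrow> \<bar>\<rho> x\<bar> \<le> R" using bounded_P_continuous[OF cont\<rho>] by blast
  obtain m where m: "0 < m" "\<And>x. x \<in> P \<Longrightarrow> m \<le> w x"
  proof -
    obtain y where "y \<in> P" "\<And>x. x \<in> P \<Longrightarrow> w y \<le> w x"
      using continuous_attains_inf[OF compact_P _ w(1)] x0P by blast
    then show thesis using that[of "w y"] w(2) by blast
  qed
  define \<Lambda> where "\<Lambda> = (\<Sum>j<d. L j x0)"
  have Lpos: "0 \<le> L j x0" if "j < d" for j using x0P that by (auto simp: polytope_of_def)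
  have \<Lambda>: "L j x0 \<le> \<Lambda>" if "j < d" for j
    unfolding \<Lambda>_def using that Lpos by (intro member_le_sum) auto
  have "0 \<le> \<Lambda>" unfolding \<Lambda>_def using Lpos by (intro sum_nonneg) auto
  define b where "b = R * (\<Lambda> / m)"
  \<comment> \<open>The radial boundary term then has coefficient \<open>b / (b + 2)\<close>, so it
    consumes at most one of the two copies of \<open>N\<close> in \<open>F\<close>. The summand 2
    keeps \<delta> below 1 even if \<open>b = 0\<close>.\<close>
  define \<delta> where "\<delta> = 1 / (b + 2)"
  have "0 \<le> b" using R \<open>0 \<le> \<Lambda>\<close> m by (simp add: b_def)
  moreover have "R * (\<delta> * (\<Lambda> / m)) = b / (b + 2)" by (simp add: b_def \<delta>_def)
  ultimately have \<delta>: "0 < \<delta>" "\<delta> < 1" "R * (\<delta> * (\<Lambda> / m)) \<le> 1"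
    by (simp_all add: \<delta>_def)
  obtain \<kappa> C where \<kappa>: "0 < \<kappa>" and C: "0 \<le> C" and est: "\<And>u U x. \<lbrakk>open U; P \<subseteq> U; Ck_on 2 U u; convex_on P u; u x0 = 0;
      \<And>x. x \<in> P \<Longrightarrow> 0 \<le> u x; x \<in> P\<rbrakk> \<Longrightarrow>
      u (x0 + (1 - \<delta>) *\<^sub>R (x - x0)) \<le> C * integral (core \<kappa>) (laplacian u)"
    by (rule interior_estimate[OF x0 \<delta>(1,2)]) blast
  obtain a where a: "0 < a" "\<And>x v. x \<in> core \<kappa> \<Longrightarrow> a * (v \<bullet> v) \<le> v \<bullet> ((\<chi> i k. A i k x) *v v)"
    by (rule coercive_on_core[OF contA \<kappa> pos]) blast+
  define \<mu> where "\<mu> = (LBINT x:P. (1::real))"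
  have "0 \<le> \<mu>"
    using integral_P_mono[of "\<lambda>_. 0" "\<lambda>_. 1"] by (simp add: \<mu>_def)
  \<comment> \<open>Chosen so that the interior part \<open>R * (C * \<mu>) * E\<close> equals
    \<open>K * (a * E)\<close>, which is at most \<open>K * F\<close>.\<close>
  define K where "K = R * (C * \<mu>) / a"
  have "0 \<le> K" using R C \<open>0 \<le> \<mu>\<close> a by (simp add: K_def)
  show thesis
  proof (rule that)
    show "0 < 1 / (1 + K)" using \<open>0 \<le> K\<close> by simp
    fix u :: "real^'n \<Rightarrow> real" and W
    assume W: "open W" "P \<subseteq> W" and uW: "Ck_on 2 W u" and conv: "convex_on P u" and u0: "u x0 = 0"
      and upos: "\<And>x. x \<in> P \<Longrightarrow> 0 \<le> u x"
    define V where "V = U \<inter> W"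
    have V: "open V" "P \<subseteq> V" and uV: "Ck_on 2 V u" and AV: "Ck_on 2 V (A i k)" for i k
      using U W Ck_on_subset[OF uW, of V] Ck_on_subset[OF A, of V] by (auto simp: V_def)
    have contu: "continuous_on P u" using Ck_on_continuous[OF uV] V(2) continuous_on_subset by blast
    define N where "N = bdry_mean w u"
    define E where "E = integral (core \<kappa>) (laplacian u)"
    define F where "F = 2 * N + (LBINT x:P. \<rho> x * u x)"
    have "F = (LBINT x:P. energy A u x)"
      unfolding F_def N_def \<rho>_def by (rule energy_identity[OF V AV uV sym w(1) zero normal, symmetric])
    then have FE: "a * E \<le> F"
      unfolding E_def using energy_lower_bound[OF V uV conv contA \<kappa> _ pos a(2)] a(1) by simp
    have radial: "(LBINT x:P. u x) \<le> C * E * \<mu> + \<delta> * (\<Lambda> / m) * N"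
    proof -
      have inP: "x0 + (1 - \<delta>) *\<^sub>R (x - x0) \<in> P" if "x \<in> P" for x
        using convexD_alt[OF convex_P x0P that, of "1 - \<delta>"] \<delta> by (simp add: algebra_simps)
      have contd: "continuous_on P (\<lambda>x. u (x0 + (1 - \<delta>) *\<^sub>R (x - x0)))"
        by (rule continuous_on_compose2[OF contu]) (use inP in \<open>auto intro!: continuous_intros\<close>)
      have "(LBINT x:P. u (x0 + (1 - \<delta>) *\<^sub>R (x - x0))) \<le> (LBINT x:P. C * E * 1)"
        using est[OF V uV conv u0 upos] interior_subset unfolding E_def
        by (intro integral_P_mono contd continuous_intros) auto
      also have "\<dots> = C * E * \<mu>"
        unfolding \<mu>_def by (rule set_integral_mult_right)
      finally have 1: "(LBINT x:P. u (x0 + (1 - \<delta>) *\<^sub>R (x - x0))) \<le> C * E * \<mu>" .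
      have "(\<Sum>j<d. L j x0 * face_mean j u) \<le> (\<Sum>j<d. \<Lambda> / m * face_mean j (\<lambda>x. w x * u x))"
      proof (rule sum_mono)
        fix j assume "j \<in> {..<d}"
        then have j: "j < d" by simp
        have "L j x0 * face_mean j u \<le> \<Lambda> * face_mean j u"
          by (rule mult_right_mono[OF \<Lambda>[OF j] face_mean_nonneg[OF j contu upos]])
        also have "face_mean j u \<le> face_mean j (\<lambda>x. 1 / m * (w x * u x))"
        proof (rule face_mean_mono[OF j contu])
          show "continuous_on P (\<lambda>x. 1 / m * (w x * u x))" by (intro continuous_intros w contu)
          show "u x \<le> 1 / m * (w x * u x)" if "x \<in> P" for x
            using mult_right_mono[OF m(2)[OF that] upos[OF that]] m(1) by (simp add: pos_le_divide_eq mult.commute)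
        qed
        then have "\<Lambda> * face_mean j u \<le> \<Lambda> * (1 / m * face_mean j (\<lambda>x. w x * u x))"
          unfolding face_mean_cmult using \<open>0 \<le> \<Lambda>\<close> by (rule mult_left_mono)
        finally show "L j x0 * face_mean j u \<le> \<Lambda> / m * face_mean j (\<lambda>x. w x * u x)" by simp
      qed
      also have "\<dots> = \<Lambda> / m * N" by (simp add: N_def sum_distrib_left)
      finally have "\<delta> * (\<Sum>j<d. L j x0 * face_mean j u) \<le> \<delta> * (\<Lambda> / m * N)"
        using \<delta> by (intro mult_left_mono) auto
      with 1 show ?thesis
        using radial_integral_bound[OF V uV conv upos x0P, of \<delta>] \<delta> by (simp add: mult.assoc)
    qed
    have wu: "0 \<le> w x * u x" if "x \<in> P" for x using w(2)[OF that] upos[OF that] by simp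
    have "0 \<le> N"
      unfolding N_def
      by (intro sum_nonneg face_mean_nonneg continuous_intros contu w(1) wu) auto
    have "- (LBINT x:P. \<rho> x * u x) = (LBINT x:P. - (\<rho> x * u x))"
      by (simp add: set_lebesgue_integral_def)
    also have "\<dots> \<le> (LBINT x:P. R * u x)"
    proof (intro integral_P_mono continuous_intros cont\<rho> contu)
      fix x assume "x \<in> interior P"
      then have x: "x \<in> P" using interior_subset by blast
      have "- \<rho> x \<le> R" using R(2)[OF x] by linarith
      from mult_right_mono[OF this upos[OF x]] show "- (\<rho> x * u x) \<le> R * u x" by simp
    qed
    also have "\<dots> = R * (LBINT x:P. u x)" by (rule set_integral_mult_right)
    also have "\<dots> \<le> R * (C * E * \<mu> + \<delta> * (\<Lambda> / m) * N)"
      by (rule mult_left_mono[OF radial R(1)])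
    also have "\<dots> = R * (C * \<mu>) * E + R * (\<delta> * (\<Lambda> / m)) * N" by (simp add: algebra_simps)
    also have "\<dots> \<le> K * F + 1 * N"
    proof (rule add_mono)
      have "R * (C * \<mu>) * E = K * (a * E)" using a by (simp add: K_def)
      also have "\<dots> \<le> K * F" by (rule mult_left_mono[OF FE \<open>0 \<le> K\<close>])
      finally show "R * (C * \<mu>) * E \<le> K * F" .
      show "R * (\<delta> * (\<Lambda> / m)) * N \<le> 1 * N" by (rule mult_right_mono[OF \<delta>(3) \<open>0 \<le> N\<close>])
    qed
    \<comment> \<open>Since \<open>F\<close> is \<open>2 * N\<close> plus the integral of
      \<open>\<rho> * u\<close>, the estimate just obtained reads
      \<open>2 * N - F \<le> K * F + N\<close>.\<close>
    finally have "N \<le> (1 + K) * F" by (simp add: F_def algebra_simps)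
    then have "1 / (1 + K) * N \<le> F" using \<open>0 \<le> K\<close> by (simp add: pos_divide_le_eq mult.commute)
    then show "1 / (1 + K) * bdry_mean w u \<le> 2 * bdry_mean w u +
        (LBINT x:P. div2 A x * u x)"
      unfolding F_def N_def \<rho>_def .
  qed
qed

section \<open>Limits of integrals and approximation by dilations\<close>

lemma tendsto_integral_P:
  fixes g :: "nat \<Rightarrow> real^'n \<Rightarrow> real"
  assumes g: "\<And>n. continuous_on P (g n)" and h: "continuous_on P h"
    and bnd: "\<And>n x. x \<in> P \<Longrightarrow> \<bar>g n x\<bar> \<le> M" and lim: "\<And>x. x \<in> P \<Longrightarrow> (\<lambda>n. g n x) \<longlonglongrightarrow> h x"
  shows "(\<lambda>n. LBINT x:P. g n x) \<longlonglongrightarrow> (LBINT x:P. h x)"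
  unfolding set_lebesgue_integral_def
proof (rule integral_dominated_convergence[where w="\<lambda>x. indicator P x *\<^sub>R M"])
  show "integrable lborel (\<lambda>x. indicator P x *\<^sub>R M)"
    using set_integrable_P[OF continuous_on_const] by (simp add: set_integrable_def)
  show "AE x in lborel. (\<lambda>n. indicator P x *\<^sub>R g n x) \<longlonglongrightarrow> indicator P x *\<^sub>R h x"
    using lim by (auto simp: indicator_def)
  show "AE x in lborel. norm (indicator P x *\<^sub>R g n x) \<le> indicator P x *\<^sub>R M" for n
    using bnd by (auto simp: indicator_def)
qed (use measurable_P_continuous g h in auto)

lemma tendsto_face_mean:
  fixes g :: "nat \<Rightarrow> real^'n \<Rightarrow> real"
  assumes j: "j < d" and g: "\<And>n. continuous_on P (g n)" and h: "continuous_on P h"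
    and bnd: "\<And>n x. x \<in> P \<Longrightarrow> \<bar>g n x\<bar> \<le> M" and lim: "\<And>x. x \<in> P \<Longrightarrow> (\<lambda>n. g n x) \<longlonglongrightarrow> h x"
  shows "(\<lambda>n. face_mean j (g n)) \<longlonglongrightarrow> face_mean j h"
  unfolding face_mean_def set_lebesgue_integral_def
proof (rule integral_dominated_convergence[where w="\<lambda>y. indicator (fcyl j) y *\<^sub>R M"])
  show "integrable lborel (\<lambda>y. indicator (fcyl j) y *\<^sub>R M)"
    using set_integrable_fcyl[OF j continuous_on_const] by (simp add: set_integrable_def)
  show "AE y in lborel. (\<lambda>n. indicator (fcyl j) y *\<^sub>R g n (fproj j y)) \<longlonglongrightarrow> indicator (fcyl j) y *\<^sub>R h (fproj j y)"
    using lim fproj_in_P[OF j] by (auto simp: indicator_def)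
  show "AE y in lborel. norm (indicator (fcyl j) y *\<^sub>R g n (fproj j y)) \<le> indicator (fcyl j) y *\<^sub>R M" for n
    using bnd fproj_in_P[OF j] by (auto simp: indicator_def)
  show "(\<lambda>y. indicator (fcyl j) y *\<^sub>R h (fproj j y)) \<in> borel_measurable lborel"
    using set_integrable_fcyl[OF j h] unfolding set_integrable_def by (rule borel_measurable_integrable)
  show "(\<lambda>y. indicator (fcyl j) y *\<^sub>R g n (fproj j y)) \<in> borel_measurable lborel" for n
    using set_integrable_fcyl[OF j g] unfolding set_integrable_def by (rule borel_measurable_integrable)
qed

lemma closure_interior_P: "closure (interior P) = P"
  using convex_closure_interior[OF convex_P interior_P_nonempty] closed_P by simp

end

text \<open>The transpose of the inverse is also a right inverse of \<open>H\<close>, hence equal to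
  the inverse.\<close>

lemma matrix_inv_symmetric:
  fixes H :: "real^'n::finite^'n"
  assumes "invertible H" "transpose H = H"
  shows "transpose (matrix_inv H) = matrix_inv H"
proof -
  have 1: "matrix_inv H ** H = mat 1" "H ** matrix_inv H = mat 1"
    using someI_ex[OF assms(1)[unfolded invertible_def]] unfolding matrix_inv_def by blast+
  have "H ** transpose (matrix_inv H) = mat 1"
    using arg_cong[OF 1(1), of transpose] assms(2) by (simp add: matrix_transpose_mul)
  then have "matrix_inv H ** (H ** transpose (matrix_inv H)) = matrix_inv H" by simp
  then show ?thesis by (simp add: matrix_mul_assoc 1)
qed

text \<open>A member of \<open>C_tilde\<close> need not be differentiable at the boundary, but the
  dilation carries a neighbourhood of \<open>P\<close> into the interior, where \<open>u\<close> is
  smooth. Being centred at \<open>x0\<close>, it also preserves the value there.\<close>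

lemma (in simple_polytope) dilation_approximation:
  assumes x0: "x0 \<in> interior P" and u: "u \<in> C_tilde d nrm c x0" and t: "0 < t" "t < 1"
  shows "\<exists>W. open W \<and> P \<subseteq> W \<and> Ck_on 2 W (\<lambda>x. u (x0 + t *\<^sub>R (x - x0)))"
    "convex_on P (\<lambda>x. u (x0 + t *\<^sub>R (x - x0)))"
    "x \<in> P \<Longrightarrow> x0 + t *\<^sub>R (x - x0) \<in> P"
proof -
  have x0P: "x0 \<in> P" using x0 interior_subset by blast
  have u': "convex_on P u" "Ck_on 2 (interior P) u"
    using u smooth_on_imp_Ck_on by (auto simp: C_tilde_def C_infty_def)
  have eq: "x0 + t *\<^sub>R (x - x0) = (1 - t) *\<^sub>R x0 + t *\<^sub>R x" for x by (simp add: algebra_simps)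
  show inP: "x0 + t *\<^sub>R (x - x0) \<in> P" if "x \<in> P" for x
    unfolding eq using convexD_alt[OF convex_P x0P that, of t] t by simp
  let ?W = "{x. (1 - t) *\<^sub>R x0 + t *\<^sub>R x \<in> interior P}"
  have "open ((\<lambda>x. (1 - t) *\<^sub>R x0 + t *\<^sub>R x) -` interior P)"
    by (intro open_vimage continuous_intros) auto
  then have "open ?W" by (simp add: vimage_def)
  moreover have "P \<subseteq> ?W"
  proof
    fix x assume x: "x \<in> P"
    have "0 < L j ((1 - t) *\<^sub>R x0 + t *\<^sub>R x)" if j: "j < d" for j
    proof -
      have "0 < (1 - t) * L j x0" using x0 t j by (auto simp: interior_P_iff)
      moreover have "0 \<le> t * L j x" using x t j by (auto simp: polytope_of_def)
      ultimately show ?thesis unfolding L_convex_combination by linarith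
    qed
    then show "x \<in> ?W" by (simp add: interior_P_iff)
  qed
  moreover have "Ck_on 2 ?W (\<lambda>x. u (x0 + t *\<^sub>R (x - x0)))"
    unfolding eq by (rule Ck_on_affine_rescale[OF open_interior u'(2)])
  ultimately show "\<exists>W. open W \<and> P \<subseteq> W \<and> Ck_on 2 W (\<lambda>x. u (x0 + t *\<^sub>R (x - x0)))" by blast
  show "convex_on P (\<lambda>x. u (x0 + t *\<^sub>R (x - x0)))"
  proof (rule convex_onI[OF _ convex_P])
    fix s x y assume s: "0 < (s::real)" "s < 1" and xy: "x \<in> P" "y \<in> P"
    have "x0 + t *\<^sub>R ((1 - s) *\<^sub>R x + s *\<^sub>R y - x0) =
        (1 - s) *\<^sub>R (x0 + t *\<^sub>R (x - x0)) + s *\<^sub>R (x0 + t *\<^sub>R (y - x0))"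
      by (simp add: algebra_simps)
    then show "u (x0 + t *\<^sub>R ((1 - s) *\<^sub>R x + s *\<^sub>R y - x0)) \<le>
        (1 - s) * u (x0 + t *\<^sub>R (x - x0)) + s * u (x0 + t *\<^sub>R (y - x0))"
      using convex_onD[OF u'(1), of s] s inP xy by simp
  qed
qed

theorem theorem3p10:
  fixes d :: nat and nrm :: "nat \<Rightarrow> real^'n::finite" and c :: "nat \<Rightarrow> real"
    and f :: "real^'n \<Rightarrow> real" and x0 :: "real^'n" and v :: "real^'n \<Rightarrow> real"
  assumes m2: "CARD('n) \<ge> 2"
    and poly: "simple_labelled_polytope d nrm c"
    and f_aff: "affine_fun f"
    and f_pos: "\<forall>x\<in>polytope_of d nrm c. f x > 0"
    and x0: "x0 \<in> interior (polytope_of d nrm c)"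
    and vS: "v \<in> class_S d nrm c"
    and abreu: "\<forall>x\<in>interior (polytope_of d nrm c).
        - (f x ^ (2 * CARD('n) + 1)) *
          (\<Sum>i\<in>UNIV. \<Sum>j\<in>UNIV. partial i (partial j
              (\<lambda>y. matrix_inv (hessian v y) $ i $ j / f y ^ (2 * CARD('n) - 1))) x)
        = s_fun d nrm c f x"
  shows "\<exists>lam>0. \<forall>u\<in>C_tilde d nrm c x0. Futaki d nrm c f u \<ge> lam * bnorm d nrm c f u"
proof -
  interpret simple_polytope d nrm c by (rule simple_polytope.intro[OF poly])
  have x0P: "x0 \<in> P" using x0 interior_subset by blast
  define p where "p = 2 * CARD('n) - 1"
  define q where "q = 2 * CARD('n) + 1"
  note vS' = vS[unfolded class_S_def Let_def mem_Collect_eq]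
  have v: "smooth_on (interior P) v" "\<And>x. x \<in> interior P \<Longrightarrow> invertible (hessian v x)"
    using vS'[THEN conjunct1] vS'[THEN conjunct2, THEN conjunct2, THEN conjunct1] by simp_all
  obtain U0 G where UG: "open U0 \<and> P \<subseteq> U0 \<and> (\<forall>i j. smooth_on U0 (\<lambda>x. G x $ i $ j)) \<and>
      (\<forall>x\<in>interior P. G x = matrix_inv (hessian v x)) \<and>
      (\<forall>j<d. \<forall>\<xi>\<in>facet d nrm c j. G \<xi> *v nrm j = 0 \<and>
        ((\<lambda>x. nrm j \<bullet> (G x *v nrm j)) has_derivative (\<lambda>h. 2 * (nrm j \<bullet> h))) (at \<xi>)) \<and>
      (\<forall>\<xi>\<in>P. \<forall>v. v \<noteq> 0 \<longrightarrow> (\<forall>j<d. L j \<xi> = 0 \<longrightarrow> nrm j \<bullet> v = 0) \<longrightarrow> v \<bullet> (G \<xi> *v v) > 0)"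
    using vS'[THEN conjunct2, THEN conjunct2, THEN conjunct2] by (elim exE) (rule that)
  have U0: "open U0" "P \<subseteq> U0" and G: "\<And>i j. smooth_on U0 (\<lambda>x. G x $ i $ j)"
    and Gint: "\<And>x. x \<in> interior P \<Longrightarrow> G x = matrix_inv (hessian v x)"
    using UG by (elim conjE, simp)+
  have Gfacet: "G \<xi> *v nrm j = 0 \<and>
      ((\<lambda>x. nrm j \<bullet> (G x *v nrm j)) has_derivative (\<lambda>h. 2 * (nrm j \<bullet> h))) (at \<xi>)"
    if "j < d" "\<xi> \<in> facet d nrm c j" for j \<xi>
    using UG that by (elim conjE) (rule bspec, drule spec, erule mp)
  have Gpos: "v \<bullet> (G \<xi> *v v) > 0"
    if "\<xi> \<in> P" "v \<noteq> 0" "\<forall>j<d. L j \<xi> = 0 \<longrightarrow> nrm j \<bullet> v = 0" for \<xi> v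
    using UG that by (elim conjE) (drule bspec, assumption, blast)
  obtain \<alpha> \<beta> where f: "f = (\<lambda>x. \<alpha> \<bullet> x + \<beta>)" using f_aff by (auto simp: affine_fun_def)
  have contf: "continuous_on S f" for S unfolding f by (intro continuous_intros)
  have fP: "0 < f x" if "x \<in> P" for x using f_pos that by blast
  define U where "U = U0 \<inter> {x. 0 < f x}"
  have U: "open U" "P \<subseteq> U"
    using U0 fP open_Collect_less[OF continuous_on_const contf[of UNIV], of 0] by (auto simp: U_def)
  define w where "w x = inverse (f x ^ p)" for x
  have Ckw: "Ck_on k U w" for k
    unfolding w_def
  proof (rule Ck_on_inverse[OF U(1)])
    show "f x ^ p \<noteq> 0" if "x \<in> U" for x using that by (simp add: U_def)
    show "Ck_on k U (\<lambda>x. f x ^ p)"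
      unfolding f by (intro Ck_on_power Ck_on_affine U)
  qed
  have w: "continuous_on P w" "\<And>x. x \<in> P \<Longrightarrow> 0 < w x"
    using continuous_on_subset[OF Ck_on_continuous[OF Ckw] U(2)] fP by (auto simp: w_def)
  \<comment> \<open>Built from the extension \<open>G\<close>, so that it is twice differentiable
    across the boundary of \<open>P\<close>.\<close>
  define A where "A i k x = G x $ i $ k * w x" for i k x
  have A: "Ck_on 2 U (A i k)" for i k
    unfolding A_def
  proof (rule Ck_on_mult[OF U(1) _ Ckw])
    show "Ck_on 2 U (\<lambda>x. G x $ i $ k)"
      by (rule Ck_on_subset[OF smooth_on_imp_Ck_on[OF G]]) (simp add: U_def)
  qed
  \<comment> \<open>In the interior \<open>G\<close> is the inverse of a symmetric Hessian; density
    of the interior and continuity give the boundary.\<close>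
  have Gsym: "G x $ i $ k = G x $ k $ i" if "x \<in> P" for x i k
  proof -
    have "G x $ i $ k - G x $ k $ i = 0"
    proof (rule continuous_constant_on_closure[of "interior P" "\<lambda>x. G x $ i $ k - G x $ k $ i"])
      have cG: "continuous_on P (\<lambda>x. G x $ i $ k)" for i k
        using Ck_on_continuous[OF smooth_on_imp_Ck_on[OF G, of 0]] U0(2) continuous_on_subset by blast
      show "continuous_on (closure (interior P)) (\<lambda>x. G x $ i $ k - G x $ k $ i)"
        unfolding closure_interior_P by (rule continuous_on_diff[OF cG cG])
      show "G x $ i $ k - G x $ k $ i = 0" if x: "x \<in> interior P" for x
      proof -
        have "transpose (hessian v x) = hessian v x"
          using hessian_symmetric[OF open_interior smooth_on_imp_Ck_on[OF v(1)] x]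
          by (simp add: vec_eq_iff transpose_def)
        from matrix_inv_symmetric[OF v(2)[OF x] this] have "transpose (G x) = G x" by (simp add: Gint[OF x])
        then show ?thesis by (simp add: vec_eq_iff transpose_def)
      qed
    qed (use that closure_interior_P in auto)
    then show ?thesis by simp
  qed
  have sym: "A i k x = A k i x" if "x \<in> P" for x i k using Gsym[OF that] by (simp add: A_def)
  have facetI: "\<xi> \<in> facet d nrm c j" if "\<xi> \<in> P" "L j \<xi> = 0" for \<xi> j using that by (simp add: facet_def)
  have zero: "(\<Sum>i\<in>UNIV. nrm j $ i * A i k \<eta>) = 0" if "j < d" "\<eta> \<in> P" "L j \<eta> = 0" for j \<eta> k
  proof -
    have "(\<Sum>i\<in>UNIV. nrm j $ i * A i k \<eta>) = (G \<eta> *v nrm j) $ k * w \<eta>"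
      using Gsym[OF that(2)] by (simp add: A_def matrix_vector_mult_def sum_distrib_left mult_ac)
    then show ?thesis using Gfacet[OF that(1) facetI[OF that(2,3)]] by simp
  qed
  \<comment> \<open>The derivative of \<open>w\<close> enters the product rule only multiplied by
    \<open>nrm j \<bullet> (G \<xi> *v nrm j)\<close>, which is 0 on the facet.\<close>
  have normal: "((\<lambda>t. \<Sum>k\<in>UNIV. nrm j $ k * (\<Sum>i\<in>UNIV. nrm j $ i * A i k (\<xi> + t *\<^sub>R nrm j)))
      has_real_derivative 2 * w \<xi> * (nrm j \<bullet> nrm j)) (at 0)" if j: "j < d" and \<xi>: "\<xi> \<in> P" "L j \<xi> = 0" for j \<xi>
  proof -
    let ?n = "nrm j"
    have Gd: "((\<lambda>x. ?n \<bullet> (G x *v ?n)) has_derivative (\<lambda>h. 2 * (?n \<bullet> h))) (at \<xi>)" and G0: "G \<xi> *v ?n = 0"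
      using Gfacet[OF j facetI[OF \<xi>]] by auto
    have line: "((\<lambda>t. \<xi> + t *\<^sub>R ?n) has_derivative (\<lambda>t. t *\<^sub>R ?n)) (at 0)"
      by (auto intro!: derivative_eq_intros)
    have "((\<lambda>t. ?n \<bullet> (G (\<xi> + t *\<^sub>R ?n) *v ?n)) has_derivative (\<lambda>t. 2 * (?n \<bullet> (t *\<^sub>R ?n)))) (at 0)"
      by (rule has_derivative_compose[OF line]) (use Gd in simp)
    moreover have "(\<lambda>t. 2 * (?n \<bullet> (t *\<^sub>R ?n))) = (*) (2 * (?n \<bullet> ?n))" by (simp add: fun_eq_iff)
    ultimately have 1: "((\<lambda>t. ?n \<bullet> (G (\<xi> + t *\<^sub>R ?n) *v ?n)) has_real_derivative 2 * (?n \<bullet> ?n)) (at 0)"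
      unfolding has_field_derivative_def by simp
    have 2: "((\<lambda>t. w (\<xi> + t *\<^sub>R ?n)) has_real_derivative (\<Sum>i\<in>UNIV. ?n $ i * partial i w (\<xi> + 0 *\<^sub>R ?n))) (at 0)"
      using \<xi>(1) U(2) by (intro C1_line_derivative[OF U(1) Ckw]) auto
    have "((\<lambda>t. ?n \<bullet> (G (\<xi> + t *\<^sub>R ?n) *v ?n) * w (\<xi> + t *\<^sub>R ?n)) has_real_derivative 2 * w \<xi> * (?n \<bullet> ?n)) (at 0)"
      using DERIV_mult[OF 1 2] by (simp add: G0 mult_ac)
    moreover have "?n \<bullet> (G x *v ?n) * w x = (\<Sum>k\<in>UNIV. ?n $ k * (\<Sum>i\<in>UNIV. ?n $ i * A i k x))" for x
    proof -
      have "(\<Sum>k\<in>UNIV. ?n $ k * (\<Sum>i\<in>UNIV. ?n $ i * A i k x)) = (\<Sum>k\<in>UNIV. \<Sum>i\<in>UNIV. ?n $ i * G x $ i $ k * ?n $ k * w x)"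
        by (simp add: A_def sum_distrib_left mult_ac)
      also have "\<dots> = (\<Sum>i\<in>UNIV. \<Sum>k\<in>UNIV. ?n $ i * G x $ i $ k * ?n $ k * w x)"
        by (rule sum.swap)
      finally show ?thesis
        by (simp add: inner_vec_def matrix_vector_mult_def sum_distrib_left sum_distrib_right mult_ac)
    qed
    ultimately show ?thesis by simp
  qed
  have posA: "0 < v \<bullet> ((\<chi> i k. A i k x) *v v)" if x: "x \<in> interior P" and v: "v \<noteq> 0" for x v
  proof -
    have xP: "x \<in> P" using x interior_subset by blast
    have "0 < v \<bullet> (G x *v v)"
      by (rule Gpos[OF xP v]) (use x in \<open>auto simp: interior_P_iff\<close>)
    moreover have "v \<bullet> ((\<chi> i k. A i k x) *v v) = w x * (v \<bullet> (G x *v v))"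
      by (simp add: A_def inner_vec_def matrix_vector_mult_def sum_distrib_left mult_ac)
    ultimately show ?thesis using w(2)[OF xP] by simp
  qed
  define \<rho> where "\<rho> x = div2 A x" for x
  have cont\<rho>: "continuous_on P \<rho>"
  proof -
    have "continuous_on U (partial i (partial k (A i k)))" for i k
      using A[of i k] by (auto simp: numeral_2_eq_2)
    then show ?thesis
      unfolding \<rho>_def using U(2) by (intro continuous_on_sum) (blast intro: continuous_on_subset)
  qed
  have s_int: "s_fun d nrm c f x = - (f x ^ q) * \<rho> x" if x: "x \<in> interior P" for x
  proof -
    have eq: "partial i (partial k (\<lambda>y. matrix_inv (hessian v y) $ i $ k / f y ^ p)) x = partial i (partial k (A i k)) x" for i k
    proof (rule partial_cong(1)[OF open_interior x])
      fix y assume y: "y \<in> interior P"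
      show "partial k (\<lambda>y. matrix_inv (hessian v y) $ i $ k / f y ^ p) y = partial k (A i k) y"
        by (rule partial_cong(1)[OF open_interior y]) (simp add: A_def w_def Gint divide_inverse)
    qed
    show ?thesis
      using abreu[rule_format, OF x, folded p_def q_def] unfolding eq \<rho>_def by (rule HOL.sym)
  qed
  define g where "g x = inverse (f x ^ q)" for x
  have g: "continuous_on P g" "\<And>x. x \<in> P \<Longrightarrow> 0 < g x"
    unfolding g_def using fP by (auto intro!: continuous_intros contf) fastforce+
  have bdry: "boundary_integral d nrm c (\<lambda>x. u x / f x ^ (2 * CARD('n) - 1)) = bdry_mean w u"
    if "continuous_on P u" for u
  proof -
    have "(\<lambda>x. u x / f x ^ (2 * CARD('n) - 1)) = (\<lambda>x. w x * u x)"
      by (simp add: w_def p_def divide_inverse mult.commute)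
    then show ?thesis using boundary_integral_eq[of "\<lambda>x. w x * u x"] that w(1) by (simp add: continuous_on_mult)
  qed
  have affine_continuous: "continuous_on P \<phi>" if "affine_fun \<phi>" for \<phi> :: "real^'n \<Rightarrow> real"
    using that by (auto simp: affine_fun_def intro!: continuous_intros)
  \<comment> \<open>An affine function has zero Hessian, hence zero energy. The energy identity thus
    represents the boundary functional that defines \<open>s_fun\<close> by the density
    \<open>- \<rho>\<close>, without reference to \<open>s_fun\<close>.\<close>
  have s_char: "2 * boundary_integral d nrm c (\<lambda>x. \<phi> x / f x ^ (2 * CARD('n) - 1)) = (LBINT x:P. - \<rho> x * \<phi> x)"
    if aff: "affine_fun \<phi>" for \<phi>
  proof -
    obtain a b where \<phi>: "\<phi> = (\<lambda>x. a \<bullet> x + b)" using aff by (auto simp: affine_fun_def)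
    have Ck: "Ck_on 2 U \<phi>" unfolding \<phi> by (rule Ck_on_affine[OF U(1)])
    have "hessian \<phi> x $ i $ k = 0" for x i k unfolding \<phi> by (rule hessian_affine)
    then have "(LBINT x:P. energy A \<phi> x) = 0"
      by (simp add: set_lebesgue_integral_def)
    moreover have "(LBINT x:P. energy A \<phi> x) =
        2 * bdry_mean w \<phi> + (LBINT x:P. \<rho> x * \<phi> x)"
      unfolding \<rho>_def by (rule energy_identity[OF U A Ck sym w(1) zero normal])
    ultimately have "2 * bdry_mean w \<phi> = - (LBINT x:P. \<rho> x * \<phi> x)"
      by linarith
    moreover have "(LBINT x:P. - \<rho> x * \<phi> x) = - (LBINT x:P. \<rho> x * \<phi> x)"
      by (simp add: set_lebesgue_integral_def)
    ultimately show ?thesis unfolding bdry[OF affine_continuous[OF aff]] by (simp only:)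
  qed
  text \<open>The Abreu equation determines \<open>s_fun\<close> only in the interior. Were its \<open>THE\<close> description not uniquely
    satisfiable, its values on the boundary could be non-measurable, and the integral would be 0.\<close>
  have s_iff: "affine_fun s \<and> (\<forall>\<phi>. affine_fun \<phi> \<longrightarrow>
      2 * boundary_integral d nrm c (\<lambda>x. \<phi> x / f x ^ (2 * CARD('n) - 1)) =
        (LBINT x:P. s x * \<phi> x / f x ^ (2 * CARD('n) + 1))) \<longleftrightarrow>
    affine_fun s \<and> (\<forall>\<phi>. affine_fun \<phi> \<longrightarrow>
      (LBINT x:P. - \<rho> x * \<phi> x) = (LBINT x:P. s x * \<phi> x * g x))" for s
    unfolding g_def q_def divide_inverse[symmetric]
    by (intro conj_cong refl all_cong1 imp_cong) (simp only: s_char)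
  have "\<exists>!s. affine_fun s \<and> (\<forall>\<phi>. affine_fun \<phi> \<longrightarrow>
      2 * boundary_integral d nrm c (\<lambda>x. \<phi> x / f x ^ (2 * CARD('n) - 1)) =
        (LBINT x:P. s x * \<phi> x / f x ^ (2 * CARD('n) + 1)))"
    unfolding s_iff by (rule ex1_affine_representative[OF g continuous_on_minus[OF cont\<rho>]])
  from theI'[OF this] have "affine_fun (s_fun d nrm c f)" unfolding s_fun_def by blast
  then have conts: "continuous_on P (s_fun d nrm c f)" by (rule affine_continuous)
  \<comment> \<open>The Abreu equation turns \<open>s_fun / f^q\<close> into \<open>- \<rho>\<close>
    in the interior; continuity of the affine function \<open>s_fun\<close> up to the boundary makes
    \<open>integral_P_cong\<close> applicable.\<close>
  have Fut: "Futaki d nrm c f u = 2 * bdry_mean w u + (LBINT x:P. \<rho> x * u x)"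
    if u: "continuous_on P u" for u
  proof -
    have "(LBINT x:P. s_fun d nrm c f x * u x / f x ^ (2 * CARD('n) + 1)) = (LBINT x:P. - (\<rho> x * u x))"
    proof (rule integral_P_cong)
      have "f x ^ q \<noteq> 0" if "x \<in> P" for x using fP[OF that] by simp
      then show "continuous_on P (\<lambda>x. s_fun d nrm c f x * u x / f x ^ (2 * CARD('n) + 1))"
        unfolding q_def by (intro continuous_intros conts u contf) blast
      show "continuous_on P (\<lambda>x. - (\<rho> x * u x))" by (intro continuous_intros cont\<rho> u)
      show "s_fun d nrm c f x * u x / f x ^ (2 * CARD('n) + 1) = - (\<rho> x * u x)" if x: "x \<in> interior P" for x
      proof -
        have "f x \<noteq> 0" using fP[of x] x interior_subset by fastforce
        then show ?thesis unfolding s_int[OF x] q_def[symmetric] by simp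
      qed
    qed
    also have "\<dots> = - (LBINT x:P. \<rho> x * u x)" by (simp add: set_lebesgue_integral_def)
    finally show ?thesis unfolding Futaki_def bdry[OF u] by simp
  qed
  obtain lam where lam: "0 < lam" and stab: "\<And>u W. \<lbrakk>open W; P \<subseteq> W; Ck_on 2 W u; convex_on P u; u x0 = 0; \<And>x. x \<in> P \<Longrightarrow> 0 \<le> u x\<rbrakk> \<Longrightarrow>
      lam * bdry_mean w u \<le> 2 * bdry_mean w u + (LBINT x:P. \<rho> x * u x)"
    unfolding \<rho>_def by (rule C2_stability[OF U A sym w zero normal posA x0]) blast+
  show ?thesis
  proof (intro exI[of _ lam] conjI lam ballI)
    fix u assume u: "u \<in> C_tilde d nrm c x0"
    then have contu: "continuous_on P u" and u0: "u x0 = 0" and upos: "\<And>x. x \<in> P \<Longrightarrow> 0 \<le> u x"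
      by (auto simp: C_tilde_def C_infty_def)
    \<comment> \<open>The shift by 2 keeps the factor positive already for
      \<open>n = 0\<close>.\<close>
    define t where "t n = 1 - 1 / (real n + 2)" for n
    have t: "0 < t n" "t n < 1" for n by (auto simp: t_def divide_simps)
    have tlim: "t \<longlonglongrightarrow> 1"
    proof -
      have "(\<lambda>n. 1 - 1 / real (n + 2)) \<longlonglongrightarrow> 1 - 0"
        by (intro tendsto_intros LIMSEQ_ignore_initial_segment lim_1_over_n)
      then show ?thesis by (simp add: t_def[abs_def] add.commute)
    qed
    define un where "un n x = u (x0 + t n *\<^sub>R (x - x0))" for n x
    note dil = dilation_approximation[OF x0 u t]
    have contn: "continuous_on P (un n)" for n
      unfolding un_def[abs_def]
      by (rule continuous_on_compose2[OF contu]) (use dil(3) in \<open>auto intro!: continuous_intros\<close>)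
    have limn: "(\<lambda>n. un n x) \<longlonglongrightarrow> u x" if "x \<in> P" for x
      unfolding un_def
    proof (rule continuous_on_tendsto_compose[OF contu _ that])
      have "(\<lambda>n. x0 + t n *\<^sub>R (x - x0)) \<longlonglongrightarrow> x0 + 1 *\<^sub>R (x - x0)" by (intro tendsto_intros tlim)
      then show "(\<lambda>n. x0 + t n *\<^sub>R (x - x0)) \<longlonglongrightarrow> x" by simp
      show "\<forall>\<^sub>F n in sequentially. x0 + t n *\<^sub>R (x - x0) \<in> P" using dil(3) that by simp
    qed
    have ineq: "lam * bdry_mean w (un n) \<le>
        2 * bdry_mean w (un n) + (LBINT x:P. \<rho> x * un n x)" for n
    proof -
      obtain W where "open W" "P \<subseteq> W" "Ck_on 2 W (un n)" using dil(1)[of n] unfolding un_def[abs_def] by blast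
      then show ?thesis
        by (rule stab) (use dil(2,3) u0 upos in \<open>auto simp: un_def[abs_def]\<close>)
    qed
    obtain M where M: "0 \<le> M" "\<And>x. x \<in> P \<Longrightarrow> \<bar>u x\<bar> \<le> M" using bounded_P_continuous[OF contu] by blast
    have lim_weighted: "(\<lambda>n. LBINT x:P. h x * un n x) \<longlonglongrightarrow> (LBINT x:P. h x * u x)"
      "j < d \<Longrightarrow> (\<lambda>n. face_mean j (\<lambda>x. h x * un n x)) \<longlonglongrightarrow> face_mean j (\<lambda>x. h x * u x)"
      if h: "continuous_on P h" for h j
    proof -
      obtain B where B: "0 \<le> B" "\<And>x. x \<in> P \<Longrightarrow> \<bar>h x\<bar> \<le> B" using bounded_P_continuous[OF h] by blast
      have 1: "continuous_on P (\<lambda>x. h x * un n x)" "continuous_on P (\<lambda>x. h x * u x)" for n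
        by (intro continuous_intros h contn contu)+
      have 2: "\<bar>h x * un n x\<bar> \<le> B * M" if "x \<in> P" for x n
        unfolding abs_mult un_def using B M dil(3)[OF that] that by (intro mult_mono) auto
      have 3: "(\<lambda>n. h x * un n x) \<longlonglongrightarrow> h x * u x" if "x \<in> P" for x
        by (intro tendsto_intros limn that)
      show "(\<lambda>n. LBINT x:P. h x * un n x) \<longlonglongrightarrow> (LBINT x:P. h x * u x)"
        by (rule tendsto_integral_P[OF 1 2 3])
      show "(\<lambda>n. face_mean j (\<lambda>x. h x * un n x)) \<longlonglongrightarrow> face_mean j (\<lambda>x. h x * u x)" if "j < d"
        by (rule tendsto_face_mean[OF that 1 2 3])
    qed
    have limN: "(\<lambda>n. \<Sum>j<d. face_mean j (\<lambda>x. w x * un n x)) \<longlonglongrightarrow> bdry_mean w u"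
      using lim_weighted(2)[OF w(1)] by (intro tendsto_sum) auto
    have "lam * bdry_mean w u \<le>
        2 * bdry_mean w u + (LBINT x:P. \<rho> x * u x)"
      by (rule LIMSEQ_le[OF tendsto_mult_left[OF limN]
            tendsto_add[OF tendsto_mult_left[OF limN] lim_weighted(1)[OF cont\<rho>]]])
        (use ineq in blast)
    then show "lam * bnorm d nrm c f u \<le> Futaki d nrm c f u"
      unfolding bnorm_def bdry[OF contu] Fut[OF contu] .
  qed
qed

end
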